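(* Let $G$ be a finitely generated abelian group and let $H$ be a finitely generated residually finite group which has a box space that embeds coarsely into a Hilbert space. Then there is a box space of the wreath product $G\wr H$ which coarsely embeds into a Hilbert space.
   Context: **Wreath product.** $G\wr H=\bigoplus_H G\rtimes H$, where $\bigoplus_H G$ is the group of finitely supported functions $H\to G$ and $H$ acts by $(h\mathbf g)(z)=\mathbf g(h^{-1}z)$. It is finitely generated when $G$ and $H$ are. **Box space.** Let $\Gamma$ be a finitely generated residually finite group with a fixed finite generating set, and let $\{K_i\}_{i\in\mathbb N}$ be a nested (decreasing) sequence of finite index normal subgroups of $\Gamma$ with $\bigcap_i K_i=\{1\}$. The box space $\Box_{\{K_i\}}\Gamma$ is the disjoint union $\bigsqcup_i\Gamma/K_i$ equipped with a metric whose restriction to each $\Gamma/K_i$ is the word metric induced by the image of the generating set of $\Gamma$, and for which the distance between any two distinct quotients is chosen to be greater than the maximum of their diameters. A box space of $\Gamma$ is $\Box_{\{K_i\}}\Gamma$ for some such sequence $\{K_i\}$. **Coarse embedding.** A metric space $(X,d)$ coarsely embeds into a Hilbert space if there are a Hilbert space $\mathcal H$, a map $f\colon X\to\mathcal H$ and non-decreasing functions $\rho_-,\rho_+\colon[0,\infty)\to[0,\infty)$ with $\lim_{t\to\infty}\rho_{\pm}(t)=+\infty$ such that $\rho_-(d(x,x'))\le\|f(x)-f(x')\|\le\rho_+(d(x,x'))$ for all $x,x'\in X$. *)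

theory Defs
  imports "HOL-Analysis.Analysis" "HOL-Algebra.Product_Groups" "HOL-Algebra.Module"
begin

section \<open>Generating sets and residual finiteness\<close>

definition finite_generating_set :: "('a, 'm) monoid_scheme \<Rightarrow> 'a set \<Rightarrow> bool" where
  "finite_generating_set \<Gamma> S \<longleftrightarrow>
     finite S \<and> S \<subseteq> carrier \<Gamma> \<and> generate \<Gamma> S = carrier \<Gamma>"

definition finitely_generated :: "('a, 'm) monoid_scheme \<Rightarrow> bool" where
  "finitely_generated \<Gamma> \<longleftrightarrow> (\<exists>S. finite_generating_set \<Gamma> S)"

definition finite_index_normal :: "'a set \<Rightarrow> ('a, 'm) monoid_scheme \<Rightarrow> bool" where
  "finite_index_normal N \<Gamma> \<longleftrightarrow> N \<lhd> \<Gamma> \<and> finite (rcosets\<^bsub>\<Gamma>\<^esub> N)"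

definition residually_finite :: "('a, 'm) monoid_scheme \<Rightarrow> bool" where
  "residually_finite \<Gamma> \<longleftrightarrow>
     (\<forall>g \<in> carrier \<Gamma>. g \<noteq> \<one>\<^bsub>\<Gamma>\<^esub> \<longrightarrow> (\<exists>N. finite_index_normal N \<Gamma> \<and> g \<notin> N))"


section \<open>Wreath products\<close>

definition semidirect_product ::
  "('n, 'k) monoid_scheme \<Rightarrow> ('h, 'l) monoid_scheme \<Rightarrow> ('h \<Rightarrow> 'n \<Rightarrow> 'n) \<Rightarrow> ('n \<times> 'h) monoid" where
  "semidirect_product N H \<phi> =
     \<lparr>carrier = carrier N \<times> carrier H,
      mult = (\<lambda>(n, h) (n', h'). (n \<otimes>\<^bsub>N\<^esub> \<phi> h n', h \<otimes>\<^bsub>H\<^esub> h')),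
      one = (\<one>\<^bsub>N\<^esub>, \<one>\<^bsub>H\<^esub>)\<rparr>"

definition shift_action :: "('h, 'l) monoid_scheme \<Rightarrow> 'h \<Rightarrow> ('h \<Rightarrow> 'g) \<Rightarrow> ('h \<Rightarrow> 'g)" where
  "shift_action H h f = (\<lambda>z \<in> carrier H. f (inv\<^bsub>H\<^esub> h \<otimes>\<^bsub>H\<^esub> z))"

text \<open>The library's \<^const>\<open>sum_group\<close> consists of the finitely supported functions,
  which are \<^const>\<open>undefined\<close> outside the index set.\<close>

definition wreath_product ::
  "('g, 'k) monoid_scheme \<Rightarrow> ('h, 'l) monoid_scheme \<Rightarrow> (('h \<Rightarrow> 'g) \<times> 'h) monoid"
  (infixr \<open>\<wr>\<close> 70) where
  "G \<wr> H = semidirect_product (sum_group (carrier H) (\<lambda>_. G)) H (shift_action H)"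

lemma wreath_simps:
  assumes "group G"
  shows "carrier (G \<wr> H) = {f \<in> carrier H \<rightarrow>\<^sub>E carrier G. finite {z \<in> carrier H. f z \<noteq> \<one>\<^bsub>G\<^esub>}} \<times> carrier H"
    and "(f, h) \<otimes>\<^bsub>G \<wr> H\<^esub> (f', h') = 
      (\<lambda>z\<in>carrier H. f z \<otimes>\<^bsub>G\<^esub> f' (inv\<^bsub>H\<^esub> h \<otimes>\<^bsub>H\<^esub> z), h \<otimes>\<^bsub>H\<^esub> h')"
    and "\<one>\<^bsub>G \<wr> H\<^esub> = (\<lambda>z\<in>carrier H. \<one>\<^bsub>G\<^esub>, \<one>\<^bsub>H\<^esub>)"
  by (auto simp: wreath_product_def semidirect_product_def shift_action_def carrier_sum_group assms)

lemma wreath_group: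
  assumes "group G" "group H"
  shows "group (G \<wr> H)"
proof -
  interpret G: group G by fact
  interpret H: group H by fact
  note ws = wreath_simps[OF assms(1)]
  have shift: "finite {z \<in> carrier H. f (h \<otimes>\<^bsub>H\<^esub> z) \<noteq> \<one>\<^bsub>G\<^esub>}"
    if f: "finite {z \<in> carrier H. f z \<noteq> \<one>\<^bsub>G\<^esub>}" and h: "h \<in> carrier H" for f h
  proof -
    have "{z \<in> carrier H. f (h \<otimes>\<^bsub>H\<^esub> z) \<noteq> \<one>\<^bsub>G\<^esub>}
            \<subseteq> (\<lambda>z. inv\<^bsub>H\<^esub> h \<otimes>\<^bsub>H\<^esub> z) ` {z \<in> carrier H. f z \<noteq> \<one>\<^bsub>G\<^esub>}" (is "?A \<subseteq> _ ` ?B")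
    proof
      fix z assume z: "z \<in> ?A"
      then have "z = inv\<^bsub>H\<^esub> h \<otimes>\<^bsub>H\<^esub> (h \<otimes>\<^bsub>H\<^esub> z)" using h by (simp flip: H.m_assoc)
      moreover have "h \<otimes>\<^bsub>H\<^esub> z \<in> ?B" using z h by auto
      ultimately show "z \<in> (\<lambda>z. inv\<^bsub>H\<^esub> h \<otimes>\<^bsub>H\<^esub> z) ` ?B" by blast
    qed
    then show ?thesis by (rule finite_subset) (use f in simp)
  qed
  show ?thesis
  proof (rule groupI)
    fix x y assume x: "x \<in> carrier (G \<wr> H)" and y: "y \<in> carrier (G \<wr> H)"
    obtain f h f' h' where xy: "x = (f, h)" "y = (f', h')" by fastforce
    have "finite {z \<in> carrier H. f z \<otimes>\<^bsub>G\<^esub> f' (inv\<^bsub>H\<^esub> h \<otimes>\<^bsub>H\<^esub> z) \<noteq> \<one>\<^bsub>G\<^esub>}"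
      by (rule finite_subset[of _ "{z \<in> carrier H. f z \<noteq> \<one>\<^bsub>G\<^esub>} \<union> {z \<in> carrier H. f' (inv\<^bsub>H\<^esub> h \<otimes>\<^bsub>H\<^esub> z) \<noteq> \<one>\<^bsub>G\<^esub>}"])
         (use x y in \<open>auto simp: xy ws intro: shift\<close>)
    then show "x \<otimes>\<^bsub>G \<wr> H\<^esub> y \<in> carrier (G \<wr> H)"
      using x y by (auto simp: xy ws PiE_iff cong: conj_cong)
  next
    show "\<one>\<^bsub>G \<wr> H\<^esub> \<in> carrier (G \<wr> H)" by (auto simp: ws cong: conj_cong)
  next
    fix x y z assume "x \<in> carrier (G \<wr> H)" "y \<in> carrier (G \<wr> H)" "z \<in> carrier (G \<wr> H)"
    then show "x \<otimes>\<^bsub>G \<wr> H\<^esub> y \<otimes>\<^bsub>G \<wr> H\<^esub> z = x \<otimes>\<^bsub>G \<wr> H\<^esub> (y \<otimes>\<^bsub>G \<wr> H\<^esub> z)"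
      by (cases x; cases y; cases z)
         (auto simp: ws PiE_iff G.m_assoc H.m_assoc H.inv_mult_group intro!: restrict_ext)
  next
    fix x assume "x \<in> carrier (G \<wr> H)"
    then show "\<one>\<^bsub>G \<wr> H\<^esub> \<otimes>\<^bsub>G \<wr> H\<^esub> x = x"
      by (cases x) (auto simp: ws PiE_iff extensional_def fun_eq_iff)
  next
    fix x assume x: "x \<in> carrier (G \<wr> H)"
    obtain f h where xy: "x = (f, h)" by fastforce
    let ?y = "(\<lambda>z\<in>carrier H. inv\<^bsub>G\<^esub> f (h \<otimes>\<^bsub>H\<^esub> z), inv\<^bsub>H\<^esub> h)"
    have "finite {z \<in> carrier H. inv\<^bsub>G\<^esub> f (h \<otimes>\<^bsub>H\<^esub> z) \<noteq> \<one>\<^bsub>G\<^esub>}"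
      by (rule finite_subset[OF _ shift[of f h]]) (use x in \<open>auto simp: xy ws\<close>)
    then have "?y \<in> carrier (G \<wr> H)" using x by (auto simp: xy ws PiE_iff cong: conj_cong)
    moreover have "?y \<otimes>\<^bsub>G \<wr> H\<^esub> x = \<one>\<^bsub>G \<wr> H\<^esub>"
      using x by (auto simp: xy ws PiE_iff intro!: restrict_ext)
    ultimately show "\<exists>y\<in>carrier (G \<wr> H). y \<otimes>\<^bsub>G \<wr> H\<^esub> x = \<one>\<^bsub>G \<wr> H\<^esub>" by blast
  qed
qed

lemma wreath_finitely_generated:
  fixes G :: "('a, 'm) monoid_scheme" and H :: "('b, 'n) monoid_scheme"
  assumes "group G" "group H" "finitely_generated G" "finitely_generated H"
  shows "finitely_generated (G \<wr> H)"
proof -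
  interpret G: group G by fact
  interpret H: group H by fact
  interpret W: group "G \<wr> H" by (rule wreath_group) fact+
  note ws = wreath_simps[OF assms(1)]
  obtain A B where A: "finite_generating_set G A" and B: "finite_generating_set H B"
    using assms(3,4) by (auto simp: finitely_generated_def)
  define \<delta> :: "'b \<Rightarrow> 'a \<Rightarrow> 'b \<Rightarrow> 'a" where "\<delta> h g = (\<lambda>z\<in>carrier H. if z = h then g else \<one>\<^bsub>G\<^esub>)" for h g
  define i :: "'b \<Rightarrow> ('b \<Rightarrow> 'a) \<times> 'b" where "i h = (\<lambda>z\<in>carrier H. \<one>\<^bsub>G\<^esub>, h)" for h
  define j :: "'a \<Rightarrow> ('b \<Rightarrow> 'a) \<times> 'b" where "j g = (\<delta> \<one>\<^bsub>H\<^esub> g, \<one>\<^bsub>H\<^esub>)" for g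
  define U where "U = i ` B \<union> j ` A"
  have \<delta>: "\<delta> h g \<in> carrier H \<rightarrow>\<^sub>E carrier G" "finite {z \<in> carrier H. \<delta> h g z \<noteq> \<one>\<^bsub>G\<^esub>}" if "g \<in> carrier G" for h g
  proof -
    show "\<delta> h g \<in> carrier H \<rightarrow>\<^sub>E carrier G" using that by (auto simp: \<delta>_def)
    show "finite {z \<in> carrier H. \<delta> h g z \<noteq> \<one>\<^bsub>G\<^esub>}"
      by (rule finite_subset[of _ "{h}"]) (auto simp: \<delta>_def)
  qed
  have ic: "i h \<in> carrier (G \<wr> H)" if "h \<in> carrier H" for h
    using that by (auto simp: i_def ws cong: conj_cong)
  have jc: "j g \<in> carrier (G \<wr> H)" if "g \<in> carrier G" for g
    using that by (auto simp: j_def ws \<delta>)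
  have ih: "i \<in> hom H (G \<wr> H)"
    by (rule homI) (auto simp: ic, auto simp: i_def ws intro!: restrict_ext)
  have jh: "j \<in> hom G (G \<wr> H)"
    by (rule homI) (auto simp: jc, auto simp: j_def ws \<delta>_def intro!: restrict_ext)
  interpret i: group_hom H "G \<wr> H" i by unfold_locales (rule ih)
  interpret j: group_hom G "G \<wr> H" j by unfold_locales (rule jh)
  have Uc: "U \<subseteq> carrier (G \<wr> H)" using A B ic jc by (auto simp: U_def finite_generating_set_def)
  let ?K = "generate (G \<wr> H) U"
  have iK: "i h \<in> ?K" if "h \<in> carrier H" for h
  proof -
    have "i ` carrier H = generate (G \<wr> H) (i ` B)"
      using i.generate_img[of B] B by (simp add: finite_generating_set_def)
    also have "\<dots> \<subseteq> ?K" by (rule W.mono_generate) (auto simp: U_def)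
    finally show ?thesis using that by blast
  qed
  have jK: "j g \<in> ?K" if "g \<in> carrier G" for g
  proof -
    have "j ` carrier G = generate (G \<wr> H) (j ` A)"
      using j.generate_img[of A] A by (simp add: finite_generating_set_def)
    also have "\<dots> \<subseteq> ?K" by (rule W.mono_generate) (auto simp: U_def)
    finally show ?thesis using that by blast
  qed
  have dK: "(\<delta> h g, \<one>\<^bsub>H\<^esub>) \<in> ?K" if h: "h \<in> carrier H" and g: "g \<in> carrier G" for h g
  proof -
    have e: "inv\<^bsub>H\<^esub> h \<otimes>\<^bsub>H\<^esub> z = \<one>\<^bsub>H\<^esub> \<longleftrightarrow> z = h" if "z \<in> carrier H" for z
      using h that by (metis H.inv_closed H.inv_equality H.inv_inv H.l_inv)
    have "i h \<otimes>\<^bsub>G \<wr> H\<^esub> j g \<otimes>\<^bsub>G \<wr> H\<^esub> i (inv\<^bsub>H\<^esub> h) = (\<delta> h g, \<one>\<^bsub>H\<^esub>)"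
      using h g by (auto simp: i_def j_def ws \<delta>_def e intro!: restrict_ext)
    then show ?thesis using iK[OF h] jK[OF g] iK[of "inv\<^bsub>H\<^esub> h"] h by (metis H.inv_closed generate.eng)
  qed
  have fK: "(f, \<one>\<^bsub>H\<^esub>) \<in> ?K"
    if "finite F" "f \<in> carrier H \<rightarrow>\<^sub>E carrier G" "{z \<in> carrier H. f z \<noteq> \<one>\<^bsub>G\<^esub>} \<subseteq> F" for F f
    using that
  proof (induction F arbitrary: f rule: finite_induct)
    case empty
    then have "(f, \<one>\<^bsub>H\<^esub>) = \<one>\<^bsub>G \<wr> H\<^esub>" by (auto simp: ws fun_eq_iff PiE_iff extensional_def)
    then show ?case by (metis generate.one)
  next
    case (insert h F)
    show ?case
    proof (cases "h \<in> carrier H")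
      case False
      then show ?thesis using insert.prems by (intro insert.IH) auto
    next
      case True
      have fc: "f z \<in> carrier G" if "z \<in> carrier H" for z using insert.prems that by (auto simp: PiE_iff)
      have "(f(h := \<one>\<^bsub>G\<^esub>), \<one>\<^bsub>H\<^esub>) \<in> ?K"
        by (rule insert.IH) (use insert.prems True in \<open>auto simp: PiE_iff extensional_def\<close>)
      moreover have "(\<delta> h (f h), \<one>\<^bsub>H\<^esub>) \<in> ?K" using dK True fc by blast
      moreover have "(\<delta> h (f h), \<one>\<^bsub>H\<^esub>) \<otimes>\<^bsub>G \<wr> H\<^esub> (f(h := \<one>\<^bsub>G\<^esub>), \<one>\<^bsub>H\<^esub>) = (f, \<one>\<^bsub>H\<^esub>)"
        using insert.prems fc by (auto simp: ws \<delta>_def fun_eq_iff PiE_iff extensional_def)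
      ultimately show ?thesis by (metis generate.eng)
    qed
  qed
  have "carrier (G \<wr> H) \<subseteq> ?K"
  proof
    fix x assume x: "x \<in> carrier (G \<wr> H)"
    obtain f h where xy: "x = (f, h)" by fastforce
    have "(f, \<one>\<^bsub>H\<^esub>) \<in> ?K" by (rule fK) (use x in \<open>auto simp: xy ws\<close>)
    moreover have "i h \<in> ?K" using x iK by (auto simp: xy ws)
    moreover have "(f, \<one>\<^bsub>H\<^esub>) \<otimes>\<^bsub>G \<wr> H\<^esub> i h = x"
      using x by (auto simp: xy ws i_def fun_eq_iff PiE_iff extensional_def)
    ultimately show "x \<in> ?K" by (metis generate.eng)
  qed
  then have "finite_generating_set (G \<wr> H) U"
    using Uc A B W.generate_incl[OF Uc] by (auto simp: finite_generating_set_def U_def)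
  then show ?thesis by (auto simp: finitely_generated_def)
qed


section \<open>Box spaces\<close>

definition word_length :: "('a, 'm) monoid_scheme \<Rightarrow> 'a set \<Rightarrow> 'a \<Rightarrow> nat" where
  "word_length \<Gamma> S g =
     (LEAST n. \<exists>ws. length ws = n \<and> set ws \<subseteq> S \<union> m_inv \<Gamma> ` S
                     \<and> foldr (\<otimes>\<^bsub>\<Gamma>\<^esub>) ws \<one>\<^bsub>\<Gamma>\<^esub> = g)"

definition word_metric :: "('a, 'm) monoid_scheme \<Rightarrow> 'a set \<Rightarrow> 'a \<Rightarrow> 'a \<Rightarrow> nat" where
  "word_metric \<Gamma> S x y = word_length \<Gamma> S (inv\<^bsub>\<Gamma>\<^esub> x \<otimes>\<^bsub>\<Gamma>\<^esub> y)"

text \<open>Only used for finite groups, where the maximum exists.\<close>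

definition word_diameter :: "('a, 'm) monoid_scheme \<Rightarrow> 'a set \<Rightarrow> nat" where
  "word_diameter \<Gamma> S = Max {word_metric \<Gamma> S x y |x y. x \<in> carrier \<Gamma> \<and> y \<in> carrier \<Gamma>}"

definition quotient_generators :: "('a, 'm) monoid_scheme \<Rightarrow> 'a set \<Rightarrow> 'a set \<Rightarrow> 'a set set" where
  "quotient_generators \<Gamma> S N = (\<lambda>s. N #>\<^bsub>\<Gamma>\<^esub> s) ` S"

definition box_points :: "('a, 'm) monoid_scheme \<Rightarrow> (nat \<Rightarrow> 'a set) \<Rightarrow> (nat \<times> 'a set) set" where
  "box_points \<Gamma> K = (SIGMA i:UNIV. carrier (\<Gamma> Mod K i))"

text \<open>\<open>box_space \<Gamma> S K d\<close>: the set \<open>box_points \<Gamma> K\<close> with the metric \<open>d\<close> is a box space of \<open>\<Gamma>\<close>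
  along the sequence \<open>K\<close>, where \<open>S\<close> is the fixed generating set of \<open>\<Gamma>\<close>.  The distance between
  two quotients is the least distance between their points, so the last condition compares the
  distance of any two points in different quotients with the diameters.  Quotients with
  different indices count as distinct, even if the subgroups coincide.\<close>

definition box_space ::
  "('a, 'm) monoid_scheme \<Rightarrow> 'a set \<Rightarrow> (nat \<Rightarrow> 'a set) \<Rightarrow>
   (nat \<times> 'a set \<Rightarrow> nat \<times> 'a set \<Rightarrow> real) \<Rightarrow> bool" where
  "box_space \<Gamma> S K d \<longleftrightarrow>
     group \<Gamma> \<and> residually_finite \<Gamma> \<and> finite_generating_set \<Gamma> S \<and>
     (\<forall>i. finite_index_normal (K i) \<Gamma>) \<and> (\<forall>i. K (Suc i) \<subseteq> K i) \<and> (\<Inter>i. K i) = {\<one>\<^bsub>\<Gamma>\<^esub>} \<and>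
     Metric_space (box_points \<Gamma> K) d \<and>
     (\<forall>i. \<forall>x \<in> carrier (\<Gamma> Mod K i). \<forall>y \<in> carrier (\<Gamma> Mod K i).
        d (i, x) (i, y) = real (word_metric (\<Gamma> Mod K i) (quotient_generators \<Gamma> S (K i)) x y)) \<and>
     (\<forall>i j. i \<noteq> j \<longrightarrow>
        (\<forall>x \<in> carrier (\<Gamma> Mod K i). \<forall>y \<in> carrier (\<Gamma> Mod K j).
           d (i, x) (j, y) > real (max (word_diameter (\<Gamma> Mod K i) (quotient_generators \<Gamma> S (K i)))
                                       (word_diameter (\<Gamma> Mod K j) (quotient_generators \<Gamma> S (K j))))))"


section \<open>Coarse embeddings into Hilbert spaces\<close>

definition real_ring :: "real ring" where
  "real_ring = \<lparr>carrier = UNIV, mult = (*), one = 1, ring.zero = 0, add = (+)\<rparr>"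

text \<open>Hilbert spaces are treated as structures on a carrier set (and not as types), so that one
  can quantify existentially over them.  A complex Hilbert space is also a real one, with
  the same norm.\<close>

locale real_hilbert_space = Module.module real_ring V
  for V :: "(real, 'v) module" (structure) +
  fixes ip :: "'v \<Rightarrow> 'v \<Rightarrow> real"
  assumes ip_commute: "\<lbrakk>x \<in> carrier V; y \<in> carrier V\<rbrakk> \<Longrightarrow> ip x y = ip y x"
    and ip_add_left: "\<lbrakk>x \<in> carrier V; y \<in> carrier V; z \<in> carrier V\<rbrakk>
      \<Longrightarrow> ip (x \<oplus> y) z = ip x z + ip y z"
    and ip_smult_left: "\<lbrakk>x \<in> carrier V; y \<in> carrier V\<rbrakk> \<Longrightarrow> ip (a \<odot> x) y = a * ip x y"
    and ip_nonneg: "x \<in> carrier V \<Longrightarrow> 0 \<le> ip x x"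
    and ip_eq_zero: "x \<in> carrier V \<Longrightarrow> ip x x = 0 \<longleftrightarrow> x = \<zero>"
    and complete: "\<lbrakk>range v \<subseteq> carrier V;
        \<forall>e>0. \<exists>N. \<forall>m\<ge>N. \<forall>n\<ge>N. sqrt (ip (v m \<ominus> v n) (v m \<ominus> v n)) < e\<rbrakk>
      \<Longrightarrow> \<exists>x \<in> carrier V. (\<lambda>n. sqrt (ip (v n \<ominus> x) (v n \<ominus> x))) \<longlonglongrightarrow> 0"

definition control_function :: "(real \<Rightarrow> real) \<Rightarrow> bool" where
  "control_function \<rho> \<longleftrightarrow>
     \<rho> ` {0..} \<subseteq> {0..} \<and> mono_on {0..} \<rho> \<and> filterlim \<rho> at_top at_top"

text \<open>The first argument is the type from which the vectors of the Hilbert space are taken.\<close>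

definition coarsely_embeds_into_hilbert ::
  "'v itself \<Rightarrow> 'x set \<Rightarrow> ('x \<Rightarrow> 'x \<Rightarrow> real) \<Rightarrow> bool" where
  "coarsely_embeds_into_hilbert (_ :: 'v itself) X d \<longleftrightarrow>
     (\<exists>(V :: (real, 'v) module) ip f \<rho>\<^sub>m \<rho>\<^sub>p.
        real_hilbert_space V ip \<and> f \<in> X \<rightarrow> carrier V \<and>
        control_function \<rho>\<^sub>m \<and> control_function \<rho>\<^sub>p \<and>
        (\<forall>x \<in> X. \<forall>x' \<in> X.
           \<rho>\<^sub>m (d x x') \<le> sqrt (ip (f x \<ominus>\<^bsub>V\<^esub> f x') (f x \<ominus>\<^bsub>V\<^esub> f x')) \<and>
           sqrt (ip (f x \<ominus>\<^bsub>V\<^esub> f x') (f x \<ominus>\<^bsub>V\<^esub> f x')) \<le> \<rho>\<^sub>p (d x x')))"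

end

theory Submission
  imports Defs "HOL-Algebra.Free_Abelian_Groups"
begin

text \<open>
  Let \<open>\<theta>\<^sub>i\<close> map a finitely generated group \<open>\<Gamma>\<close> onto finite groups \<open>Q\<^sub>i\<close>.  Two elements of the same
  quotient are at distance at most \<open>n\<close> exactly when they differ by the image of a word of length at
  most \<open>n\<close>, and there are only finitely many such words in \<open>\<Gamma>\<close>.  A coarse embedding of a box space can
  therefore be discussed without generating sets: what matters is a family of squared Euclidean
  distances \<open>\<kappa>\<^sub>i\<close> on the \<open>Q\<^sub>i\<close> such that, uniformly in \<open>i\<close>, \<open>\<kappa>\<^sub>i(q, q\<theta>\<^sub>i(w))\<close> is bounded for each fixed
  \<open>w \<in> \<Gamma>\<close>, and a bound on \<open>\<kappa>\<^sub>i(q, r)\<close> forces \<open>r = q\<theta>\<^sub>i(w)\<close> for some \<open>w\<close> in a finite subset of \<open>\<Gamma>\<close>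
  (\<open>controlled_kernels\<close> below).  Such a family embeds the box space into \<open>\<ell>\<^sup>2\<close>: the components are
  placed in orthogonal coordinates, and one further coordinate keeps them far apart.

  Let \<open>M\<^sub>i\<close> be the given chain in \<open>H\<close>.  As \<open>G\<close> is abelian, multiplying the values of a finitely
  supported function over each coset of \<open>M\<^sub>i\<close> gives a homomorphism from \<open>G \<wr> H\<close> onto the finite group
  \<open>(G/N\<^sub>i) \<wr> (H/M\<^sub>i)\<close>, where \<open>N\<^sub>i\<close> is a chain in \<open>G\<close>.  The kernels of these maps form the chain in
  \<open>G \<wr> H\<close>; they are nested and separating because the \<open>M\<^sub>i\<close> and \<open>N\<^sub>i\<close> are.  Controlled kernels on
  \<open>(G/N\<^sub>i) \<wr> (H/M\<^sub>i)\<close> come from three ingredients.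

  \<^item> \<^emph>\<open>The base.\<close>  The embedding of the box space of \<open>H\<close> gives points in a Euclidean space.  Random
    signed sums of their coordinates are real-valued functions whose expected differences are
    comparable to the Euclidean distances, by Khintchine's inequality.  Cutting these functions at
    integer levels yields weighted families of subsets \<open>E\<close> of \<open>H/M\<^sub>i\<close> for which the total weight
    \<open>\<omega>\<^sub>i(x, y)\<close> of the sets separating \<open>x\<close> from \<open>y\<close> is controlled.

  \<^item> \<^emph>\<open>The lamps.\<close>  A finitely generated abelian group is residually finite, so that a chain \<open>N\<^sub>i\<close>
    exists, and it is amenable: the uniform measures on the boxes of exponents of side \<open>2\<^sup>n\<close>, pushed
    forward to \<open>G/N\<^sub>i\<close>, are almost invariant at a rate that does not depend on \<open>i\<close>.  Comparing their
    translates gives controlled kernels \<open>\<alpha>\<^sub>i\<close> on \<open>G/N\<^sub>i\<close>.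

  \<^item> \<^emph>\<open>Their combination.\<close>  A set \<open>E\<close> is made to see the pair \<open>(f, h)\<close> only when \<open>h \<in> E\<close>, and then it
    sees \<open>f\<close> outside \<open>E\<close>.  Moving the lighter changes what \<open>E\<close> sees only if \<open>E\<close> separates the two
    positions, and switching a lamp near the lighter changes it only if \<open>E\<close> separates the lighter
    from the lamp.  Conversely, if \<open>(f, h)\<close> and \<open>(f', h')\<close> are seen differently by few of the sets and their complements, then \<open>h'\<close> and
    all lamps on which \<open>f\<close> and \<open>f'\<close> differ are close to \<open>h\<close>.  Adding \<open>\<alpha>\<^sub>i\<close> over all lamps also bounds
    the change of each lamp, so the difference lifts to one of finitely many elements of \<open>G \<wr> H\<close>.

  The three ingredients are \<open>controlled_cut_kernels\<close>, \<open>abelian_controlled_kernels\<close> and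
  \<open>wreath_kernel_of_cuts\<close>; \<open>wreath_controlled_kernels\<close> assembles them, and the locale
  \<open>box_quotients\<close> turns the result into an embedding of a box space.
\<close>

section \<open>Squared Euclidean distances as kernels\<close>

definition euclidean_kernel :: "'x set \<Rightarrow> ('x \<Rightarrow> 'x \<Rightarrow> real) \<Rightarrow> bool" where
  "euclidean_kernel X \<kappa> \<longleftrightarrow>
     (\<exists>(n::nat) a. \<forall>x\<in>X. \<forall>y\<in>X. \<kappa> x y = (\<Sum>k<n. (a k x - a k y)\<^sup>2))"

lemma euclidean_kernelI:
  assumes "finite J" and \<kappa>: "\<And>x y. x \<in> X \<Longrightarrow> y \<in> X \<Longrightarrow> \<kappa> x y = (\<Sum>j\<in>J. (a j x - a j y)\<^sup>2)"
  shows "euclidean_kernel X \<kappa>"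
proof -
  obtain b where b: "bij_betw b {0..<card J} J"
    using ex_bij_betw_nat_finite[OF \<open>finite J\<close>] by blast
  have "\<kappa> x y = (\<Sum>k<card J. (a (b k) x - a (b k) y)\<^sup>2)" if "x \<in> X" "y \<in> X" for x y
    using \<kappa>[OF that] sum.reindex_bij_betw[OF b, of "\<lambda>j. (a j x - a j y)\<^sup>2"]
    by (simp add: lessThan_atLeast0)
  then show ?thesis unfolding euclidean_kernel_def
    by (intro exI[of _ "card J"] exI[of _ "\<lambda>k. a (b k)"]) blast
qed

text \<open>Orthogonal direct sum: each summand gets its own block of coordinates, scaled by the square root
  of its weight.\<close>

lemma euclidean_kernel_weighted_sum:
  assumes "finite J" and w: "\<And>j. j \<in> J \<Longrightarrow> 0 \<le> w j" and \<kappa>: "\<And>j. j \<in> J \<Longrightarrow> euclidean_kernel X (\<kappa> j)"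
  shows "euclidean_kernel X (\<lambda>x y. \<Sum>j\<in>J. w j * \<kappa> j x y)"
proof -
  have "\<forall>j\<in>J. \<exists>n a. \<forall>x\<in>X. \<forall>y\<in>X. \<kappa> j x y = (\<Sum>k<(n::nat). (a k x - a k y)\<^sup>2)"
    using \<kappa> by (auto simp: euclidean_kernel_def)
  then obtain n a where na: "\<And>j x y. j \<in> J \<Longrightarrow> x \<in> X \<Longrightarrow> y \<in> X \<Longrightarrow>
      \<kappa> j x y = (\<Sum>k<(n j::nat). (a j k x - a j k y)\<^sup>2)"
    by metis
  show ?thesis
  proof (rule euclidean_kernelI[of "SIGMA j:J. {..<n j}" _ _ "\<lambda>(j, k) x. sqrt (w j) * a j k x"])
    fix x y assume xy: "x \<in> X" "y \<in> X"
    have "(\<Sum>j\<in>J. w j * \<kappa> j x y) = (\<Sum>j\<in>J. \<Sum>k<n j. (sqrt (w j) * a j k x - sqrt (w j) * a j k y)\<^sup>2)"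
      by (intro sum.cong) (auto simp: na xy sum_distrib_left w power_mult_distrib simp flip: right_diff_distrib)
    then show "(\<Sum>j\<in>J. w j * \<kappa> j x y) =
      (\<Sum>jk\<in>(SIGMA j:J. {..<n j}). ((case jk of (j, k) \<Rightarrow> \<lambda>x. sqrt (w j) * a j k x) x - (case jk of (j, k) \<Rightarrow> \<lambda>x. sqrt (w j) * a j k x) y)\<^sup>2)"
      by (simp add: sum.Sigma \<open>finite J\<close> case_prod_unfold)
  qed (use \<open>finite J\<close> in auto)
qed

lemma euclidean_kernel_sum:
  assumes "finite J" and "\<And>j. j \<in> J \<Longrightarrow> euclidean_kernel X (\<kappa> j)"
  shows "euclidean_kernel X (\<lambda>x y. \<Sum>j\<in>J. \<kappa> j x y)"
  using euclidean_kernel_weighted_sum[of J "\<lambda>_. 1" X \<kappa>] assms by simp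

lemma euclidean_kernel_add:
  assumes "euclidean_kernel X \<kappa>" and "euclidean_kernel X \<kappa>'"
  shows "euclidean_kernel X (\<lambda>x y. \<kappa> x y + \<kappa>' x y)"
proof -
  have "euclidean_kernel X (\<lambda>x y. \<Sum>b\<in>{True, False}. (if b then \<kappa> else \<kappa>') x y)"
    by (rule euclidean_kernel_sum) (use assms in auto)
  then show ?thesis by simp
qed

lemma euclidean_kernel_pullback:
  assumes "euclidean_kernel Y \<kappa>" and "\<And>x. x \<in> X \<Longrightarrow> g x \<in> Y"
  shows "euclidean_kernel X (\<lambda>x y. \<kappa> (g x) (g y))"
proof -
  obtain n a where "\<forall>x\<in>Y. \<forall>y\<in>Y. \<kappa> x y = (\<Sum>k<(n::nat). (a k x - a k y)\<^sup>2)"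
    using assms(1) by (auto simp: euclidean_kernel_def)
  then show ?thesis
    by (intro euclidean_kernelI[of "{..<n}" _ _ "\<lambda>k x. a k (g x)"]) (use assms(2) in auto)
qed

lemma euclidean_kernel_nonneg:
  "euclidean_kernel X \<kappa> \<Longrightarrow> x \<in> X \<Longrightarrow> y \<in> X \<Longrightarrow> 0 \<le> \<kappa> x y"
  by (auto simp: euclidean_kernel_def intro!: sum_nonneg)

lemma euclidean_kernel_refl:
  "euclidean_kernel X \<kappa> \<Longrightarrow> x \<in> X \<Longrightarrow> \<kappa> x x = 0"
  by (auto simp: euclidean_kernel_def)

section \<open>Kernels controlled uniformly along a sequence of quotients\<close>

text \<open>The two halves replace the functions \<open>\<rho>\<^sub>+\<close> and \<open>\<rho>\<^sub>-\<close> of a coarse embedding that is uniform in \<open>i\<close>.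
  The finite set \<open>F\<close> lives in \<open>\<Gamma>\<close> and not in the quotients; this is what makes the second half
  uniform.\<close>

definition controlled_kernels ::
  "('g, 'm) monoid_scheme \<Rightarrow> (nat \<Rightarrow> ('q, 'l) monoid_scheme) \<Rightarrow> (nat \<Rightarrow> 'g \<Rightarrow> 'q) \<Rightarrow> (nat \<Rightarrow> 'q \<Rightarrow> 'q \<Rightarrow> real) \<Rightarrow> bool"
  where
  "controlled_kernels \<Gamma> Q \<theta> \<kappa> \<longleftrightarrow>
     (\<forall>w\<in>carrier \<Gamma>. \<exists>C. \<forall>i. \<forall>q\<in>carrier (Q i). \<kappa> i q (q \<otimes>\<^bsub>Q i\<^esub> \<theta> i w) \<le> C) \<and>
     (\<forall>C. \<exists>F\<subseteq>carrier \<Gamma>. finite F \<and>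
        (\<forall>i. \<forall>q\<in>carrier (Q i). \<forall>r\<in>carrier (Q i). \<kappa> i q r \<le> C \<longrightarrow> (\<exists>w\<in>F. r = q \<otimes>\<^bsub>Q i\<^esub> \<theta> i w)))"

section \<open>Gram matrices\<close>

text \<open>The case of the Cauchy--Schwarz inequality in which one vector has norm zero: the quadratic form on
  the plane of \<open>x\<close> and \<open>p\<close> is affine in the coefficient of \<open>p\<close> and bounded below, hence constant.\<close>

lemma positive_kernel_cauchy_schwarz_zero:
  fixes k :: "'x \<Rightarrow> 'x \<Rightarrow> real"
  assumes "finite X" and sym: "\<And>x y. x \<in> X \<Longrightarrow> y \<in> X \<Longrightarrow> k x y = k y x"
    and pos: "\<And>c. 0 \<le> (\<Sum>x\<in>X. \<Sum>y\<in>X. c x * c y * k x y)"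
    and p: "p \<in> X" "k p p = 0" and x: "x \<in> X"
  shows "k p x = 0"
proof (cases "x = p")
  case False
  define r where "r = k p x"
  have quad: "0 \<le> s * s * k x x + 2 * (s * t) * r" for s t
  proof -
    define c where "c = (\<lambda>z. if z = x then s else if z = p then t else 0)"
    have "(\<Sum>z\<in>X. \<Sum>y\<in>X. c z * c y * k z y) = (\<Sum>z\<in>{x,p}. \<Sum>y\<in>{x,p}. c z * c y * k z y)"
    proof -
      have "(\<Sum>z\<in>X. \<Sum>y\<in>X. c z * c y * k z y) = (\<Sum>z\<in>{x,p}. \<Sum>y\<in>X. c z * c y * k z y)"
        by (rule sum.mono_neutral_right) (use p x \<open>finite X\<close> in \<open>auto simp: c_def\<close>)
      also have "\<dots> = (\<Sum>z\<in>{x,p}. \<Sum>y\<in>{x,p}. c z * c y * k z y)"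
        by (intro sum.cong refl sum.mono_neutral_right) (use p x \<open>finite X\<close> in \<open>auto simp: c_def\<close>)
      finally show ?thesis .
    qed
    also have "\<dots> = s * s * k x x + 2 * (s * t) * r"
      using False p sym[OF x p(1)] by (simp add: c_def r_def algebra_simps)
    finally show ?thesis using pos[of c] by simp
  qed
  have "r = 0"
  proof (rule ccontr)
    assume "r \<noteq> 0"
    then have "2 * (1 * (- (k x x + 1) / (2 * r))) * r = - (k x x + 1)" by simp
    \<comment> \<open>This choice of the second coefficient makes the quadratic form equal to -1.\<close>
    then show False using quad[of 1 "- (k x x + 1) / (2 * r)"] by simp
  qed
  then show ?thesis by (simp add: r_def)
qed (use p in simp)

text \<open>Gram--Schmidt without vectors.  Projecting away from a point \<open>p\<close> with \<open>k p p > 0\<close> replaces \<open>k x y\<close> by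
  \<open>k x y - k x p * k y p / k p p\<close>, which is again positive and vanishes at \<open>p\<close>; the subtracted
  term is a new coordinate.  The proof does this for all points of \<open>X\<close> in turn; \<open>Y\<close> is the set of
  points at which the kernel has not yet been made to vanish.\<close>

lemma positive_kernel_gram:
  fixes k :: "'x \<Rightarrow> 'x \<Rightarrow> real"
  assumes "finite X" and "\<And>x y. x \<in> X \<Longrightarrow> y \<in> X \<Longrightarrow> k x y = k y x"
    and "\<And>c. 0 \<le> (\<Sum>x\<in>X. \<Sum>y\<in>X. c x * c y * k x y)"
  shows "\<exists>(n::nat) a. \<forall>x\<in>X. \<forall>y\<in>X. k x y = (\<Sum>i<n. a i x * a i y)"
proof -
  have "\<exists>(n::nat) a. \<forall>x\<in>X. \<forall>y\<in>X. k x y = (\<Sum>i<n. a i x * a i y)"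
    if "finite Y" "Y \<subseteq> X" "\<And>x y. x \<in> X \<Longrightarrow> y \<in> X \<Longrightarrow> k x y = k y x"
      "\<And>c. 0 \<le> (\<Sum>x\<in>X. \<Sum>y\<in>X. c x * c y * k x y)"
      "\<And>x y. x \<in> X - Y \<Longrightarrow> y \<in> X \<Longrightarrow> k x y = 0" for Y and k :: "'x \<Rightarrow> 'x \<Rightarrow> real"
    using that
  proof (induction Y arbitrary: k rule: finite_induct)
    case empty
    then show ?case by (intro exI[of _ 0]) auto
  next
    case (insert p Y)
    have p: "p \<in> X" using insert.prems by auto
    define q where "q = k p p"
    show ?case
    proof (cases "q = 0")
      case True
      have "k p x = 0" if "x \<in> X" for x
        by (rule positive_kernel_cauchy_schwarz_zero[OF \<open>finite X\<close>])
           (use insert.prems p that True in \<open>auto simp: q_def\<close>)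
      then have "k x y = 0" if "x \<in> X - Y" "y \<in> X" for x y
        using insert.prems(4)[of x y] that by (cases "x = p") auto
      then show ?thesis by (intro insert.IH) (use insert.prems in auto)
    next
      case False
      have d: "(\<Sum>y\<in>X. of_bool (y = p) * g y) = g p" for g :: "'x \<Rightarrow> real"
      proof -
        have "(\<Sum>y\<in>X. of_bool (y = p) * g y) = (\<Sum>y\<in>X. if y = p then g y else 0)"
          by (intro sum.cong) auto
        then show ?thesis using p \<open>finite X\<close> by simp
      qed
      have "0 \<le> (\<Sum>x\<in>X. \<Sum>y\<in>X. of_bool (x = p) * of_bool (y = p) * k x y)"
        by (rule insert.prems(3))
      also have "\<dots> = (\<Sum>x\<in>X. of_bool (x = p) * (\<Sum>y\<in>X. of_bool (y = p) * k x y))"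
        by (simp only: sum_distrib_left mult.assoc)
      also have "\<dots> = q" unfolding d q_def ..
      finally have q: "q > 0" using False by simp
      define k' where "k' = (\<lambda>x y. k x y - k x p * k y p / q)"
      have sym: "k x y = k y x" if "x \<in> X" "y \<in> X" for x y using insert.prems that by auto
      have "\<exists>(n::nat) a. \<forall>x\<in>X. \<forall>y\<in>X. k' x y = (\<Sum>i<n. a i x * a i y)"
      proof (rule insert.IH)
        show "Y \<subseteq> X" using insert.prems by auto
        show "k' x y = k' y x" if "x \<in> X" "y \<in> X" for x y
          using sym[OF that] by (simp add: k'_def mult.commute)
        show "k' x y = 0" if "x \<in> X - Y" "y \<in> X" for x y
        proof (cases "x = p")
          case True then show ?thesis using q sym[OF p that(2)] by (simp add: k'_def q_def)
        next
          case False then show ?thesis using insert.prems(4) that p by (simp add: k'_def)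
        qed
        fix c :: "'x \<Rightarrow> real"
        \<comment> \<open>The form of the projected kernel at c is the original form at c', the projection of c.\<close>
        define l where "l = (\<Sum>x\<in>X. c x * k x p)"
        define c' where "c' = (\<lambda>x. c x - l / q * of_bool (x = p))"
        have inner: "(\<Sum>y\<in>X. c' y * k x y) = (\<Sum>y\<in>X. c y * k x y) - l / q * k x p" for x
        proof -
          have "(\<Sum>y\<in>X. c' y * k x y) = (\<Sum>y\<in>X. c y * k x y - of_bool (y = p) * (l / q * k x y))"
            by (intro sum.cong refl) (simp add: c'_def left_diff_distrib)
          then show ?thesis by (simp only: sum_subtractf d)
        qed
        have inner': "(\<Sum>x\<in>X. c' x * g x) = (\<Sum>x\<in>X. c x * g x) - l / q * g p" for g
        proof -
          have "(\<Sum>x\<in>X. c' x * g x) = (\<Sum>x\<in>X. c x * g x - of_bool (x = p) * (l / q * g x))"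
            by (intro sum.cong refl) (simp add: c'_def left_diff_distrib)
          then show ?thesis by (simp only: sum_subtractf d)
        qed
        have "(\<Sum>x\<in>X. \<Sum>y\<in>X. c' x * c' y * k x y) = (\<Sum>x\<in>X. c' x * (\<Sum>y\<in>X. c' y * k x y))"
          by (simp only: sum_distrib_left mult.assoc)
        also have "\<dots> = (\<Sum>x\<in>X. c' x * (\<Sum>y\<in>X. c y * k x y)) - l / q * (\<Sum>x\<in>X. c' x * k x p)"
          unfolding inner right_diff_distrib sum_subtractf by (simp only: sum_distrib_left mult_ac)
        also have "(\<Sum>x\<in>X. c' x * (\<Sum>y\<in>X. c y * k x y))
          = (\<Sum>x\<in>X. c x * (\<Sum>y\<in>X. c y * k x y)) - l / q * (\<Sum>y\<in>X. c y * k p y)"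
          by (rule inner')
        also have "(\<Sum>y\<in>X. c y * k p y) = l" unfolding l_def
          by (intro sum.cong refl) (use sym p in auto)
        also have "(\<Sum>x\<in>X. c' x * k x p) = 0"
          using q by (simp add: inner' flip: l_def q_def)
        also have "(\<Sum>x\<in>X. c x * (\<Sum>y\<in>X. c y * k x y)) - l / q * l - l / q * 0
          = (\<Sum>x\<in>X. \<Sum>y\<in>X. c x * c y * k' x y)"
        proof -
          have "(\<Sum>x\<in>X. \<Sum>y\<in>X. c x * c y * (k x p * k y p / q)) = (\<Sum>x\<in>X. c x * k x p) * (\<Sum>y\<in>X. c y * k y p) / q"
            by (simp only: sum_product sum_divide_distrib) (simp add: mult_ac)
          then have e: "(\<Sum>x\<in>X. \<Sum>y\<in>X. c x * c y * (k x p * k y p / q)) = l / q * l"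
            by (simp add: l_def)
          have "(\<Sum>x\<in>X. \<Sum>y\<in>X. c x * c y * k' x y) =
              (\<Sum>x\<in>X. \<Sum>y\<in>X. c x * c y * k x y) - l / q * l"
            unfolding k'_def right_diff_distrib sum_subtractf e ..
          then show ?thesis by (simp add: sum_distrib_left mult.assoc)
        qed
        finally show "0 \<le> (\<Sum>x\<in>X. \<Sum>y\<in>X. c x * c y * k' x y)" using insert.prems(3)[of c'] by simp
      qed
      then obtain n a where na: "\<And>x y. x \<in> X \<Longrightarrow> y \<in> X \<Longrightarrow> k' x y = (\<Sum>i<(n::nat). a i x * a i y)" by blast
      define a' where "a' = (\<lambda>i x. if i = n then k x p / sqrt q else a i x)"
      have "k x y = (\<Sum>i<Suc n. a' i x * a' i y)" if "x \<in> X" "y \<in> X" for x y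
      proof -
        have "k x y = k' x y + k x p / sqrt q * (k y p / sqrt q)" using q by (simp add: k'_def)
        then show ?thesis using na[OF that] by (simp add: a'_def)
      qed
      then show ?thesis by blast
    qed
  qed
  from this[of X k] show ?thesis using assms by auto
qed

section \<open>Khintchine's inequality\<close>

text \<open>The subset \<open>A\<close> encodes a choice of signs, so that averages over signs are sums over \<^term>\<open>Pow {..<n}\<close>.\<close>

definition signed_sum :: "nat \<Rightarrow> nat set \<Rightarrow> (nat \<Rightarrow> real) \<Rightarrow> real" where
  "signed_sum n A v = (\<Sum>k<n. if k \<in> A then v k else - v k)"

lemma sum_Pow_lessThan_Suc:
  "(\<Sum>A\<in>Pow {..<Suc n}. g A) = (\<Sum>A\<in>Pow {..<n}. g A + (g (insert n A) :: real))"
proof -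
  have "(\<Sum>A\<in>Pow {..<Suc n}. g A) = (\<Sum>A\<in>Pow {..<n}. g A) + (\<Sum>A\<in>insert n ` Pow {..<n}. g A)"
    unfolding lessThan_Suc Pow_insert by (rule sum.union_disjoint) auto
  also have "(\<Sum>A\<in>insert n ` Pow {..<n}. g A) = (\<Sum>A\<in>Pow {..<n}. g (insert n A))"
  proof (subst sum.reindex)
    have "n \<notin> A" if "A \<in> Pow {..<n}" for A using that by auto
    then show "inj_on (insert n) (Pow {..<n})" unfolding inj_on_def by (metis insert_ident)
  qed simp
  finally show ?thesis by (simp add: sum.distrib)
qed

lemma signed_sum_Suc:
  "A \<subseteq> {..<n} \<Longrightarrow> signed_sum (Suc n) A v = signed_sum n A v - v n"
  "signed_sum (Suc n) (insert n A) v = signed_sum n A v + v n"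
proof -
  assume "A \<subseteq> {..<n}"
  then have "n \<notin> A" by auto
  then show "signed_sum (Suc n) A v = signed_sum n A v - v n" by (simp add: signed_sum_def)
next
  have "(\<Sum>k<n. if k \<in> insert n A then v k else - v k) = (\<Sum>k<n. if k \<in> A then v k else - v k)"
    by (intro sum.cong) auto
  then show "signed_sum (Suc n) (insert n A) v = signed_sum n A v + v n" by (simp add: signed_sum_def)
qed

lemma signed_sum_moment2:
  "(\<Sum>A\<in>Pow {..<n}. (signed_sum n A v)\<^sup>2) = 2 ^ n * (\<Sum>k<n. (v k)\<^sup>2)"
proof (induction n)
  case 0 show ?case by (simp add: signed_sum_def)
next
  case (Suc n)
  have "(\<Sum>A\<in>Pow {..<Suc n}. (signed_sum (Suc n) A v)\<^sup>2)
    = (\<Sum>A\<in>Pow {..<n}. 2 * (signed_sum n A v)\<^sup>2 + 2 * (v n)\<^sup>2)"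
    unfolding sum_Pow_lessThan_Suc
    by (intro sum.cong refl) (auto simp: signed_sum_Suc power2_eq_square algebra_simps)
  then show ?case using Suc by (simp add: sum.distrib card_Pow algebra_simps flip: sum_distrib_left)
qed

lemma signed_sum_moment4:
  "(\<Sum>A\<in>Pow {..<n}. (signed_sum n A v) ^ 4) \<le> 3 * 2 ^ n * (\<Sum>k<n. (v k)\<^sup>2)\<^sup>2"
proof (induction n)
  case 0 show ?case by (simp add: signed_sum_def)
next
  case (Suc n)
  define s where "s = (\<Sum>k<n. (v k)\<^sup>2)"
  have e: "(X - a) ^ 4 + (X + a) ^ 4 = 2 * X ^ 4 + 12 * a\<^sup>2 * X\<^sup>2 + 2 * a ^ 4" for X a :: real
    by (simp add: power4_eq_xxxx power2_eq_square algebra_simps)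
  have "(\<Sum>A\<in>Pow {..<Suc n}. (signed_sum (Suc n) A v) ^ 4)
    = (\<Sum>A\<in>Pow {..<n}. 2 * (signed_sum n A v) ^ 4 + 12 * (v n)\<^sup>2 * (signed_sum n A v)\<^sup>2 + 2 * (v n) ^ 4)"
    unfolding sum_Pow_lessThan_Suc
    by (intro sum.cong refl) (auto simp: signed_sum_Suc e)
  also have "\<dots> = 2 * (\<Sum>A\<in>Pow {..<n}. (signed_sum n A v) ^ 4) + 12 * (v n)\<^sup>2 * (2 ^ n * s) + 2 ^ n * (2 * (v n) ^ 4)"
    by (simp add: sum.distrib card_Pow signed_sum_moment2 s_def flip: sum_distrib_left)
  also have "\<dots> \<le> 2 * (3 * 2 ^ n * s\<^sup>2) + 12 * (v n)\<^sup>2 * (2 ^ n * s) + 2 ^ n * (6 * (v n) ^ 4)"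
  proof -
    have "2 ^ n * (2 * (v n) ^ 4) \<le> 2 ^ n * (6 * (v n) ^ 4)" by simp
    then show ?thesis using Suc.IH unfolding s_def by linarith
  qed
  also have "\<dots> = 3 * 2 ^ Suc n * (s + (v n)\<^sup>2)\<^sup>2"
    by (simp add: power4_eq_xxxx power2_eq_square algebra_simps)
  finally show ?case by (simp add: s_def)
qed

text \<open>With \<open>r\<^sup>2\<close> the second moment and \<open>t = \<bar>X\<bar>\<close>, the pointwise inequality \<open>t\<^sup>3 - 6 r\<^sup>2 t + 6 r\<^sup>3 \<ge> 0\<close>,
  multiplied by \<open>t\<close>, bounds the first absolute moment from below by the second moment, which is known
  exactly, and the fourth, which is at most \<open>3 r\<^sup>4\<close>.\<close>

lemma khintchine_lower:
  "2 ^ n * sqrt (\<Sum>k<n. (v k)\<^sup>2) / 2 \<le> (\<Sum>A\<in>Pow {..<n}. \<bar>signed_sum n A v\<bar>)"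
proof -
  define s where "s = (\<Sum>k<n. (v k)\<^sup>2)"
  define r where "r = sqrt s"
  have "s \<ge> 0" by (simp add: s_def sum_nonneg)
  then have rs: "r\<^sup>2 = s" "r \<ge> 0" by (auto simp: r_def)
  show ?thesis
  proof (cases "r = 0")
    case True then show ?thesis by (simp add: r_def s_def sum_nonneg)
  next
    case False
    then have r: "r > 0" using rs by simp
    have ineq: "6 * r\<^sup>2 * X\<^sup>2 - X ^ 4 \<le> 6 * r ^ 3 * \<bar>X\<bar>" for X
    proof -
      define t where "t = \<bar>X\<bar>"
      have t: "t \<ge> 0" "X\<^sup>2 = t\<^sup>2" "X ^ 4 = t ^ 4" by (auto simp: t_def power_even_abs)
      define q where "q = sqrt 2"
      have q: "q \<ge> 0" "q * q = 2" by (auto simp: q_def)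
      have q1: "q \<le> 3/2" unfolding q_def by (rule real_le_lsqrt) (auto simp: power2_eq_square)
      \<comment> \<open>For t \<ge> 0 the cubic is minimal at t = sqrt 2 * r, with the value (6 - 4 * sqrt 2) * r ^ 3 \<ge> 0.\<close>
      have "t ^ 3 - 6 * r\<^sup>2 * t + 6 * r ^ 3 = (t - q * r)\<^sup>2 * (t + 2 * q * r) + (6 - 2 * (q * q) * q) * r ^ 3 - 3 * (2 - q * q) * r\<^sup>2 * t"
        by (simp add: power2_eq_square power3_eq_cube algebra_simps)
      also have "\<dots> = (t - q * r)\<^sup>2 * (t + 2 * q * r) + (6 - 4 * q) * r ^ 3"
        by (simp add: q)
      also have "\<dots> \<ge> 0" using q q1 t r by (intro add_nonneg_nonneg mult_nonneg_nonneg) auto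
      finally have "0 \<le> t * (t ^ 3 - 6 * r\<^sup>2 * t + 6 * r ^ 3)" using t by simp
      then have "6 * r\<^sup>2 * t\<^sup>2 - t ^ 4 \<le> 6 * r ^ 3 * t"
        by (simp add: power4_eq_xxxx power2_eq_square power3_eq_cube algebra_simps)
      then show ?thesis by (simp only: t t_def[symmetric])
    qed
    have "6 * r\<^sup>2 * (2 ^ n * s) - 3 * 2 ^ n * s\<^sup>2 \<le>
       6 * r\<^sup>2 * (\<Sum>A\<in>Pow {..<n}. (signed_sum n A v)\<^sup>2) - (\<Sum>A\<in>Pow {..<n}. (signed_sum n A v) ^ 4)"
      using signed_sum_moment4[of n v] by (simp add: signed_sum_moment2 s_def)
    also have "\<dots> = (\<Sum>A\<in>Pow {..<n}. 6 * r\<^sup>2 * (signed_sum n A v)\<^sup>2 - (signed_sum n A v) ^ 4)"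
      by (simp add: sum_subtractf sum_distrib_left)
    also have "\<dots> \<le> (\<Sum>A\<in>Pow {..<n}. 6 * r ^ 3 * \<bar>signed_sum n A v\<bar>)"
      by (rule sum_mono) (rule ineq)
    also have "\<dots> = 6 * r ^ 3 * (\<Sum>A\<in>Pow {..<n}. \<bar>signed_sum n A v\<bar>)"
      by (simp add: sum_distrib_left)
    finally have "6 * r ^ 3 * (2 ^ n * r / 2) \<le> 6 * r ^ 3 * (\<Sum>A\<in>Pow {..<n}. \<bar>signed_sum n A v\<bar>)"
      by (simp add: rs(1)[symmetric] power2_eq_square power3_eq_cube algebra_simps)
    then have "2 ^ n * r / 2 \<le> (\<Sum>A\<in>Pow {..<n}. \<bar>signed_sum n A v\<bar>)"
      by (rule mult_left_le_imp_le) (use r in simp)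
    then show ?thesis by (simp add: r_def s_def)
  qed
qed

lemma khintchine_upper:
  "(\<Sum>A\<in>Pow {..<n}. \<bar>signed_sum n A v\<bar>) \<le> 2 ^ n * sqrt (\<Sum>k<n. (v k)\<^sup>2)"
proof -
  have "(\<Sum>A\<in>Pow {..<n}. \<bar>signed_sum n A v\<bar>)\<^sup>2 \<le>
      (\<Sum>A\<in>Pow {..<n}. (signed_sum n A v)\<^sup>2) * real (card (Pow {..<n}))"
    using sum_squared_le_sum_of_squares[of "\<lambda>A. \<bar>signed_sum n A v\<bar>" "Pow {..<n}"] by simp
  also have "\<dots> = (2 ^ n * sqrt (\<Sum>k<n. (v k)\<^sup>2))\<^sup>2"
    by (simp add: signed_sum_moment2 card_Pow power_mult_distrib sum_nonneg) (simp add: power2_eq_square)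
  finally show ?thesis by (rule power2_le_imp_le) (simp add: sum_nonneg)
qed

section \<open>Cut kernels\<close>

text \<open>The sets \<open>E j\<close> are the cuts, and \<open>\<omega> x y\<close> is the weight of those that separate \<open>x\<close> from \<open>y\<close>.  The index
  type is that of the only construction of cuts below: a choice of signs and an integer level.\<close>

definition cut_kernel :: "'x set \<Rightarrow> ('x \<Rightarrow> 'x \<Rightarrow> real) \<Rightarrow> bool" where
  "cut_kernel X \<omega> \<longleftrightarrow>
     (\<exists>(J :: (nat set \<times> int) set) w E. finite J \<and> (\<forall>j\<in>J. 0 \<le> w j) \<and>
        (\<forall>x\<in>X. \<forall>y\<in>X. \<omega> x y = (\<Sum>j\<in>J. w j * of_bool ((x \<in> E j) \<noteq> (y \<in> E j)))))"

text \<open>The cuts are the superlevel sets of the integer parts of the random signed sums.  For one choice of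
  signs they count the distance of two integer parts, which differs from the distance of the sums by
  at most 1; averaging over the signs, Khintchine's inequality compares with the Euclidean distance.\<close>

lemma cut_kernel_approximates_euclidean:
  assumes "finite X" and "euclidean_kernel X \<kappa>"
  shows "\<exists>\<omega>. cut_kernel X \<omega> \<and>
    (\<forall>x\<in>X. \<forall>y\<in>X. sqrt (\<kappa> x y) / 2 - 1 \<le> \<omega> x y \<and> \<omega> x y \<le> sqrt (\<kappa> x y) + 1)"
proof -
  obtain n a where \<kappa>: "\<And>x y. x \<in> X \<Longrightarrow> y \<in> X \<Longrightarrow> \<kappa> x y = (\<Sum>k<(n::nat). (a k x - a k y)\<^sup>2)"
    using assms(2) by (auto simp: euclidean_kernel_def)
  define u where "u A x = signed_sum n A (\<lambda>k. a k x)" for A x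
  define T where "T = Max (insert 0 ((\<lambda>(A, x). \<bar>\<lfloor>u A x\<rfloor>\<bar>) ` (Pow {..<n} \<times> X)))"
  have T: "\<bar>\<lfloor>u A x\<rfloor>\<bar> \<le> T" if "A \<in> Pow {..<n}" "x \<in> X" for A x
    unfolding T_def by (rule Max_ge) (use \<open>finite X\<close> that in force)+
  define J where "J = Pow {..<n} \<times> {-T..<T}"
  define E where "E = (\<lambda>(A, t). {x. t < \<lfloor>u A x\<rfloor>})"
  define \<omega> where "\<omega> x y = (\<Sum>j\<in>J. 1 / 2 ^ n * of_bool ((x \<in> E j) \<noteq> (y \<in> E j)) :: real)" for x y
  have "cut_kernel X \<omega>" unfolding cut_kernel_def
    by (intro exI[of _ J] exI[of _ "\<lambda>_. 1 / 2 ^ n"] exI[of _ E]) (auto simp: J_def \<omega>_def)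
  moreover have "sqrt (\<kappa> x y) / 2 - 1 \<le> \<omega> x y \<and> \<omega> x y \<le> sqrt (\<kappa> x y) + 1" if xy: "x \<in> X" "y \<in> X" for x y
  proof -
    have level: "(\<Sum>t\<in>{-T..<T}. of_bool ((t < p) \<noteq> (t < q)) :: real) = \<bar>real_of_int p - real_of_int q\<bar>"
      if "\<bar>p\<bar> \<le> T" "\<bar>q\<bar> \<le> T" for p q
    proof -
      have "(\<Sum>t\<in>{-T..<T}. of_bool ((t < p) \<noteq> (t < q)) :: real) = real (card {t \<in> {-T..<T}. (t < p) \<noteq> (t < q)})"
        by (simp add: of_bool_def sum.If_cases Int_def)
      also have "{t \<in> {-T..<T}. (t < p) \<noteq> (t < q)} = {min p q..<max p q}" using that by auto
      also have "real (card \<dots>) = \<bar>real_of_int p - real_of_int q\<bar>" by (simp add: min_def max_def)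
      finally show ?thesis .
    qed
    have uxy: "u A x - u A y = signed_sum n A (\<lambda>k. a k x - a k y)" for A
      unfolding u_def signed_sum_def by (simp flip: sum_subtractf) (rule sum.cong, auto)
    have \<omega>: "\<omega> x y = (\<Sum>A\<in>Pow {..<n}. \<bar>real_of_int \<lfloor>u A x\<rfloor> - real_of_int \<lfloor>u A y\<rfloor>\<bar>) / 2 ^ n"
    proof -
      have "\<omega> x y = (\<Sum>A\<in>Pow {..<n}. \<Sum>t\<in>{-T..<T}. of_bool ((t < \<lfloor>u A x\<rfloor>) \<noteq> (t < \<lfloor>u A y\<rfloor>))) / 2 ^ n"
      proof -
        have "\<omega> x y = (\<Sum>(A, t)\<in>Pow {..<n} \<times> {-T..<T}. 1 / 2 ^ n * of_bool ((t < \<lfloor>u A x\<rfloor>) \<noteq> (t < \<lfloor>u A y\<rfloor>)))"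
          unfolding \<omega>_def J_def by (intro sum.cong refl) (auto simp: E_def)
        also have "\<dots> = (\<Sum>A\<in>Pow {..<n}. \<Sum>t\<in>{-T..<T}. 1 / 2 ^ n * of_bool ((t < \<lfloor>u A x\<rfloor>) \<noteq> (t < \<lfloor>u A y\<rfloor>)))"
          by (rule sum.cartesian_product[symmetric])
        finally show ?thesis unfolding sum_distrib_left[symmetric] by (simp only: mult_1 times_divide_eq_left)
      qed
      also have "(\<Sum>A\<in>Pow {..<n}. \<Sum>t\<in>{-T..<T}. of_bool ((t < \<lfloor>u A x\<rfloor>) \<noteq> (t < \<lfloor>u A y\<rfloor>)) :: real)
        = (\<Sum>A\<in>Pow {..<n}. \<bar>real_of_int \<lfloor>u A x\<rfloor> - real_of_int \<lfloor>u A y\<rfloor>\<bar>)"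
        by (intro sum.cong refl level T) (use xy in auto)
      finally show ?thesis .
    qed
    have fl: "\<bar>p - q\<bar> - 1 \<le> \<bar>real_of_int \<lfloor>p\<rfloor> - real_of_int \<lfloor>q\<rfloor>\<bar>" "\<bar>real_of_int \<lfloor>p\<rfloor> - real_of_int \<lfloor>q\<rfloor>\<bar> \<le> \<bar>p - q\<bar> + 1" for p q :: real
      by linarith+
    define S where "S = (\<Sum>A\<in>Pow {..<n}. \<bar>signed_sum n A (\<lambda>k. a k x - a k y)\<bar>)"
    have "(\<Sum>A\<in>Pow {..<n}. \<bar>u A x - u A y\<bar> - 1) \<le> \<omega> x y * 2 ^ n"
      unfolding \<omega> by simp (rule sum_mono, rule fl)
    then have lo: "S - 2 ^ n \<le> \<omega> x y * 2 ^ n" by (simp add: S_def uxy sum_subtractf card_Pow)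
    have "\<omega> x y * 2 ^ n \<le> (\<Sum>A\<in>Pow {..<n}. \<bar>u A x - u A y\<bar> + 1)"
      unfolding \<omega> by simp (rule sum_mono, rule fl)
    then have up: "\<omega> x y * 2 ^ n \<le> S + 2 ^ n" by (simp add: S_def uxy sum.distrib card_Pow)
    have "(sqrt (\<kappa> x y) / 2 - 1) * 2 ^ n \<le> \<omega> x y * 2 ^ n"
      using lo khintchine_lower[of n "\<lambda>k. a k x - a k y"] by (simp add: S_def \<kappa> xy algebra_simps)
    moreover have "\<omega> x y * 2 ^ n \<le> (sqrt (\<kappa> x y) + 1) * 2 ^ n"
      using up khintchine_upper[of n "\<lambda>k. a k x - a k y"] by (simp add: S_def \<kappa> xy algebra_simps)
    ultimately show ?thesis by simp
  qed
  ultimately show ?thesis by blast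
qed

section \<open>Control functions\<close>

text \<open>The natural choices are \<open>\<rho>(t) = inf {\<delta> x y | d x y \<ge> t}\<close> and \<open>\<rho>'(t) = sup {\<delta> x y | d x y \<le> t}\<close>.
  Adding \<open>t\<close> itself to both sets keeps them nonempty and makes both functions finite and unbounded.\<close>

lemma control_functions_exist:
  fixes d \<delta> :: "'x \<Rightarrow> 'x \<Rightarrow> real"
  assumes nonneg: "\<And>x y. x \<in> X \<Longrightarrow> y \<in> X \<Longrightarrow> 0 \<le> \<delta> x y"
    and upper: "\<And>r. \<exists>C. \<forall>x\<in>X. \<forall>y\<in>X. d x y \<le> r \<longrightarrow> \<delta> x y \<le> C"
    and lower: "\<And>C. \<exists>r. \<forall>x\<in>X. \<forall>y\<in>X. \<delta> x y \<le> C \<longrightarrow> d x y \<le> r"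
  shows "\<exists>\<rho> \<rho>'. control_function \<rho> \<and> control_function \<rho>' \<and>
    (\<forall>x\<in>X. \<forall>y\<in>X. 0 \<le> d x y \<longrightarrow> \<rho> (d x y) \<le> \<delta> x y \<and> \<delta> x y \<le> \<rho>' (d x y))"
proof -
  define L where "L t = insert t {\<delta> x y |x y. x \<in> X \<and> y \<in> X \<and> t \<le> d x y}" for t
  define U where "U t = insert t {\<delta> x y |x y. x \<in> X \<and> y \<in> X \<and> d x y \<le> t}" for t
  have bL: "bdd_below (L t)" for t
    by (rule bdd_belowI[of _ "min t 0"]) (use nonneg in \<open>force simp: L_def min_def\<close>)
  have bU: "bdd_above (U t)" for t
  proof -
    obtain C where "\<forall>x\<in>X. \<forall>y\<in>X. d x y \<le> t \<longrightarrow> \<delta> x y \<le> C" using upper by blast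
    then show ?thesis by (intro bdd_aboveI[of _ "max t C"]) (force simp: U_def max_def)
  qed
  have "control_function (\<lambda>t. Inf (L t))"
    unfolding control_function_def
  proof (intro conjI)
    show "(\<lambda>t. Inf (L t)) ` {0..} \<subseteq> {0..}"
      by (auto intro!: cInf_greatest) (auto simp: L_def nonneg)
    show "mono_on {0..} (\<lambda>t. Inf (L t))"
    proof (rule mono_onI)
      fix s t :: real assume "s \<le> t"
      show "Inf (L s) \<le> Inf (L t)"
      proof (rule cInf_greatest)
        show "L t \<noteq> {}" by (auto simp: L_def)
        fix z assume "z \<in> L t"
        then have "z = t \<or> z \<in> L s" using \<open>s \<le> t\<close> by (fastforce simp: L_def)
        moreover have "Inf (L s) \<le> s" by (rule cInf_lower[OF _ bL]) (simp add: L_def)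
        moreover have "z \<in> L s \<Longrightarrow> Inf (L s) \<le> z" by (rule cInf_lower[OF _ bL])
        ultimately show "Inf (L s) \<le> z" using \<open>s \<le> t\<close> by auto
      qed
    qed
    show "filterlim (\<lambda>t. Inf (L t)) at_top at_top"
      unfolding filterlim_at_top
    proof
      fix C
      obtain r where r: "\<forall>x\<in>X. \<forall>y\<in>X. \<delta> x y \<le> C \<longrightarrow> d x y \<le> r" using lower by blast
      have "C \<le> Inf (L t)" if "max r C < t" for t
        by (rule cInf_greatest) (use r that in \<open>force simp: L_def\<close>)+
      then show "eventually (\<lambda>t. C \<le> Inf (L t)) at_top"
        by (auto simp: eventually_at_top_dense intro!: exI[of _ "max r C"])
    qed
  qed
  moreover have "control_function (\<lambda>t. Sup (U t))"
    unfolding control_function_def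
  proof (intro conjI)
    have tU: "t \<le> Sup (U t)" for t by (rule cSup_upper[OF _ bU]) (simp add: U_def)
    show "(\<lambda>t. Sup (U t)) ` {0..} \<subseteq> {0..}"
      using tU by (auto intro: order_trans)
    show "mono_on {0..} (\<lambda>t. Sup (U t))"
    proof (rule mono_onI)
      fix s t :: real assume "s \<le> t"
      show "Sup (U s) \<le> Sup (U t)"
      proof (rule cSup_least)
        show "U s \<noteq> {}" by (auto simp: U_def)
        fix z assume "z \<in> U s"
        then have "z = s \<or> z \<in> U t" using \<open>s \<le> t\<close> by (fastforce simp: U_def)
        moreover have "z \<in> U t \<Longrightarrow> z \<le> Sup (U t)" by (rule cSup_upper[OF _ bU])
        ultimately show "z \<le> Sup (U t)" using \<open>s \<le> t\<close> tU[of t] by auto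
      qed
    qed
    show "filterlim (\<lambda>t. Sup (U t)) at_top at_top"
      by (rule filterlim_at_top_mono[OF filterlim_ident]) (use tU in auto)
  qed
  moreover have "Inf (L (d x y)) \<le> \<delta> x y \<and> \<delta> x y \<le> Sup (U (d x y))" if "x \<in> X" "y \<in> X" for x y
    using that by (auto simp: L_def U_def intro!: cInf_lower[OF _ bL[unfolded L_def]] cSup_upper[OF _ bU[unfolded U_def]])
  ultimately show ?thesis by blast
qed

section \<open>The Hilbert space of square-summable sequences\<close>

text \<open>The record type of modules extends that of rings, so a multiplication and a unit must be supplied;
  the pointwise ones are chosen.\<close>

definition l2 :: "(real, nat \<Rightarrow> real) module" where
  "l2 = \<lparr>carrier = {x. summable (\<lambda>k. (x k)\<^sup>2)}, mult = (\<lambda>x y k. x k * y k), one = (\<lambda>k. 1),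
     ring.zero = (\<lambda>k. 0), add = (\<lambda>x y k. x k + y k), smult = (\<lambda>c x k. c * x k)\<rparr>"

definition l2_ip :: "(nat \<Rightarrow> real) \<Rightarrow> (nat \<Rightarrow> real) \<Rightarrow> real" where
  "l2_ip x y = suminf (\<lambda>k. x k * y k)"

lemma l2_simps:
  "x \<in> carrier l2 \<longleftrightarrow> summable (\<lambda>k. (x k)\<^sup>2)" "x \<oplus>\<^bsub>l2\<^esub> y = (\<lambda>k. x k + y k)"
  "\<zero>\<^bsub>l2\<^esub> = (\<lambda>k. 0)" "c \<odot>\<^bsub>l2\<^esub> x = (\<lambda>k. c * x k)"
  by (auto simp: l2_def)

lemma l2_summable_mult:
  assumes "x \<in> carrier l2" "y \<in> carrier l2"
  shows "summable (\<lambda>k. x k * y k)"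
proof (rule summable_comparison_test)
  show "summable (\<lambda>k. (x k)\<^sup>2 + (y k)\<^sup>2)" using assms by (simp add: l2_simps summable_add)
  have "norm (a * b) \<le> a\<^sup>2 + b\<^sup>2" for a b :: real
    using sum_squares_bound[of "\<bar>a\<bar>" "\<bar>b\<bar>"] mult_nonneg_nonneg[of "\<bar>a\<bar>" "\<bar>b\<bar>"]
    by (simp add: abs_mult del: mult_nonneg_nonneg zero_le_mult_iff)
  then show "\<exists>N. \<forall>k\<ge>N. norm (x k * y k) \<le> (x k)\<^sup>2 + (y k)\<^sup>2" by blast
qed

lemma l2_add_closed:
  assumes "x \<in> carrier l2" "y \<in> carrier l2"
  shows "(\<lambda>k. x k + y k) \<in> carrier l2"
proof -
  have "summable (\<lambda>k. (x k)\<^sup>2 + (y k)\<^sup>2 + 2 * (x k * y k))"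
    using assms l2_summable_mult[OF assms] by (intro summable_add summable_mult) (auto simp: l2_simps)
  then show ?thesis by (simp add: l2_simps power2_sum mult.assoc)
qed

lemma l2_smult_closed: "x \<in> carrier l2 \<Longrightarrow> (\<lambda>k. c * x k) \<in> carrier l2"
  by (simp add: l2_simps power_mult_distrib summable_mult)

lemma cring_real_ring: "cring real_ring"
proof (rule cringI)
  show "abelian_group real_ring"
    by (rule abelian_groupI) (auto simp: real_ring_def intro: exI[of _ "- _"] add.left_inverse)
  show "comm_monoid real_ring"
    by (rule comm_monoidI) (auto simp: real_ring_def)
qed (auto simp: real_ring_def algebra_simps)

lemma abelian_group_l2: "abelian_group l2"
proof (rule abelian_groupI)
  fix x assume "x \<in> carrier l2"
  then have "(\<lambda>k. (- 1) * x k) \<in> carrier l2" by (rule l2_smult_closed)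
  then show "\<exists>y\<in>carrier l2. y \<oplus>\<^bsub>l2\<^esub> x = \<zero>\<^bsub>l2\<^esub>"
    by (rule rev_bexI) (simp add: l2_simps)
qed (auto simp: l2_simps(2,3) l2_add_closed algebra_simps, simp add: l2_simps)

lemma module_l2: "Module.module real_ring l2"
proof (rule moduleI[OF cring_real_ring abelian_group_l2])
  fix a x assume "x \<in> carrier l2"
  then show "a \<odot>\<^bsub>l2\<^esub> x \<in> carrier l2" unfolding l2_simps(4) by (rule l2_smult_closed)
qed (simp_all add: l2_simps(2,4) real_ring_def distrib_left distrib_right mult.assoc)

lemma l2_minus:
  assumes "x \<in> carrier l2" "y \<in> carrier l2"
  shows "x \<ominus>\<^bsub>l2\<^esub> y = (\<lambda>k. x k - y k)"
proof -
  interpret abelian_group l2 by (rule abelian_group_l2)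
  have "(\<lambda>k. (- 1) * y k) \<in> carrier l2" by (rule l2_smult_closed) fact
  then have "\<ominus>\<^bsub>l2\<^esub> y = (\<lambda>k. (- 1) * y k)"
    using assms by (intro minus_equality) (auto simp: l2_simps)
  then show ?thesis using assms by (simp add: a_minus_def l2_simps)
qed

text \<open>Coordinatewise limits exist by completeness of the reals.  The Cauchy bound passes to the limit in
  every finite partial sum, and hence to the whole series.\<close>

lemma l2_complete:
  assumes v: "range v \<subseteq> carrier l2"
    and cauchy: "\<And>e. e > 0 \<Longrightarrow> \<exists>N. \<forall>m\<ge>N. \<forall>n\<ge>N. sqrt (suminf (\<lambda>k. (v m k - v n k)\<^sup>2)) < e"
  shows "\<exists>x\<in>carrier l2. (\<lambda>n. sqrt (suminf (\<lambda>k. (v n k - x k)\<^sup>2))) \<longlonglongrightarrow> 0"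
proof -
  have vc: "v n \<in> carrier l2" for n using v by auto
  have diff: "summable (\<lambda>k. (x k - y k)\<^sup>2)" if "x \<in> carrier l2" "y \<in> carrier l2" for x y
    using l2_add_closed[OF that(1) l2_smult_closed[OF that(2), of "- 1"]] by (simp add: l2_simps)
  have partial: "(\<Sum>k<K. (v m k - v n k)\<^sup>2) \<le> e\<^sup>2"
    if "sqrt (suminf (\<lambda>k. (v m k - v n k)\<^sup>2)) < e" for K m n e
  proof -
    have "(\<Sum>k<K. (v m k - v n k)\<^sup>2) \<le> suminf (\<lambda>k. (v m k - v n k)\<^sup>2)"
      by (rule sum_le_suminf) (use diff vc in auto)
    also have "\<dots> \<le> e\<^sup>2"
    proof -
      have nn: "0 \<le> suminf (\<lambda>k. (v m k - v n k)\<^sup>2)" by (rule suminf_nonneg) (use diff vc in auto)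
      then have "(sqrt (suminf (\<lambda>k. (v m k - v n k)\<^sup>2)))\<^sup>2 \<le> e\<^sup>2"
        using that by (intro power_mono) auto
      then show ?thesis using nn by simp
    qed
    finally show ?thesis .
  qed
  have "convergent (\<lambda>n. v n k)" for k
  proof (rule Cauchy_convergent, rule metric_CauchyI)
    fix e :: real assume "e > 0"
    then obtain N where N: "\<forall>m\<ge>N. \<forall>n\<ge>N. sqrt (suminf (\<lambda>k. (v m k - v n k)\<^sup>2)) < e / 2"
      using cauchy[of "e / 2"] by auto
    have "dist (v m k) (v n k) < e" if "m \<ge> N" "n \<ge> N" for m n
    proof -
      have "(v m k - v n k)\<^sup>2 \<le> (\<Sum>k<Suc k. (v m k - v n k)\<^sup>2)"
        by (simp add: sum_nonneg)
      also have "\<dots> \<le> (e / 2)\<^sup>2" by (rule partial) (use N that in auto)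
      finally have "\<bar>v m k - v n k\<bar> \<le> e / 2"
        using \<open>e > 0\<close> abs_le_square_iff[of "v m k - v n k" "e / 2"] by simp
      then show ?thesis using \<open>e > 0\<close> by (simp add: dist_real_def)
    qed
    then show "\<exists>N. \<forall>m\<ge>N. \<forall>n\<ge>N. dist (v m k) (v n k) < e" by blast
  qed
  then obtain x where x: "\<And>k. (\<lambda>n. v n k) \<longlonglongrightarrow> x k"
    unfolding convergent_def by (metis (full_types))
  have tail: "summable (\<lambda>k. (v m k - x k)\<^sup>2) \<and> suminf (\<lambda>k. (v m k - x k)\<^sup>2) \<le> e\<^sup>2"
    if N: "\<forall>m\<ge>N. \<forall>n\<ge>N. sqrt (suminf (\<lambda>k. (v m k - v n k)\<^sup>2)) < e" and m: "m \<ge> N" for e N m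
  proof -
    have b: "(\<Sum>k<K. (v m k - x k)\<^sup>2) \<le> e\<^sup>2" for K
    proof (rule tendsto_upperbound)
      show "(\<lambda>n. \<Sum>k<K. (v m k - v n k)\<^sup>2) \<longlonglongrightarrow> (\<Sum>k<K. (v m k - x k)\<^sup>2)"
        by (intro tendsto_intros x)
      show "\<forall>\<^sub>F n in sequentially. (\<Sum>k<K. (v m k - v n k)\<^sup>2) \<le> e\<^sup>2"
        using eventually_ge_at_top[of N]
        by eventually_elim (rule partial, use N m in auto)
    qed simp
    have s: "summable (\<lambda>k. (v m k - x k)\<^sup>2)"
      by (rule summableI_nonneg_bounded[OF _ b]) auto
    moreover have "suminf (\<lambda>k. (v m k - x k)\<^sup>2) \<le> e\<^sup>2"
      by (rule suminf_le_const[OF s b])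
    ultimately show ?thesis by blast
  qed
  have xc: "x \<in> carrier l2"
  proof -
    obtain N where "\<forall>m\<ge>N. \<forall>n\<ge>N. sqrt (suminf (\<lambda>k. (v m k - v n k)\<^sup>2)) < 1" using cauchy[of 1] by auto
    then have "(\<lambda>k. v N k - x k) \<in> carrier l2" using tail[of N 1 N] by (simp add: l2_simps)
    then have "(\<lambda>k. v N k + (- 1) * (v N k - x k)) \<in> carrier l2"
      by (intro l2_add_closed l2_smult_closed vc)
    then show ?thesis by simp
  qed
  moreover have "(\<lambda>n. sqrt (suminf (\<lambda>k. (v n k - x k)\<^sup>2))) \<longlonglongrightarrow> 0"
  proof (rule LIMSEQ_I)
    fix e :: real assume e: "e > 0"
    then obtain N where N: "\<forall>m\<ge>N. \<forall>n\<ge>N. sqrt (suminf (\<lambda>k. (v m k - v n k)\<^sup>2)) < e / 2"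
      using cauchy[of "e / 2"] by auto
    have "norm (sqrt (suminf (\<lambda>k. (v n k - x k)\<^sup>2)) - 0) < e" if "n \<ge> N" for n
    proof -
      have "sqrt (suminf (\<lambda>k. (v n k - x k)\<^sup>2)) \<le> e / 2"
        using tail[OF N that] e by (intro real_le_lsqrt) auto
      moreover have "0 \<le> suminf (\<lambda>k. (v n k - x k)\<^sup>2)" using tail[OF N that] by (intro suminf_nonneg) auto
      ultimately show ?thesis using e by simp
    qed
    then show "\<exists>N. \<forall>n\<ge>N. norm (sqrt (suminf (\<lambda>k. (v n k - x k)\<^sup>2)) - 0) < e" by blast
  qed
  ultimately show ?thesis by blast
qed

lemma real_hilbert_space_l2: "real_hilbert_space l2 l2_ip"
proof -
  interpret Module.module real_ring l2 by (rule module_l2)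
  show ?thesis
  proof unfold_locales
    fix x y z assume c: "x \<in> carrier l2" "y \<in> carrier l2" "z \<in> carrier l2"
    show "l2_ip (x \<oplus>\<^bsub>l2\<^esub> y) z = l2_ip x z + l2_ip y z"
      using l2_summable_mult c by (simp add: l2_ip_def l2_simps(2) distrib_right suminf_add)
  next
    fix a x y assume c: "x \<in> carrier l2" "y \<in> carrier l2"
    show "l2_ip (a \<odot>\<^bsub>l2\<^esub> x) y = a * l2_ip x y"
      using l2_summable_mult[OF c] by (simp add: l2_ip_def l2_simps(4) mult.assoc suminf_mult)
  next
    fix x assume c: "x \<in> carrier l2"
    show "0 \<le> l2_ip x x" using l2_summable_mult[OF c c] by (auto simp: l2_ip_def intro: suminf_nonneg)
    show "l2_ip x x = 0 \<longleftrightarrow> x = \<zero>\<^bsub>l2\<^esub>"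
      using suminf_eq_zero_iff[OF l2_summable_mult[OF c c]] by (auto simp: l2_ip_def l2_simps(3))
  next
    fix v :: "nat \<Rightarrow> nat \<Rightarrow> real"
    assume v: "range v \<subseteq> carrier l2"
      and cauchy: "\<forall>e>0. \<exists>N. \<forall>m\<ge>N. \<forall>n\<ge>N. sqrt (l2_ip (v m \<ominus>\<^bsub>l2\<^esub> v n) (v m \<ominus>\<^bsub>l2\<^esub> v n)) < e"
    have vc: "v n \<in> carrier l2" for n using v by auto
    obtain x where "x \<in> carrier l2" "(\<lambda>n. sqrt (suminf (\<lambda>k. (v n k - x k)\<^sup>2))) \<longlonglongrightarrow> 0"
      using l2_complete[OF v] cauchy by (auto simp: l2_ip_def l2_minus vc power2_eq_square)
    then show "\<exists>x\<in>carrier l2. (\<lambda>n. sqrt (l2_ip (v n \<ominus>\<^bsub>l2\<^esub> x) (v n \<ominus>\<^bsub>l2\<^esub> x))) \<longlonglongrightarrow> 0"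
      by (auto simp: l2_ip_def l2_minus vc power2_eq_square)
  qed (auto simp: l2_ip_def mult.commute)
qed

section \<open>Words and the word metric of a quotient\<close>

text \<open>The ball of radius \<open>n\<close> about the identity in the word metric.\<close>

definition word_ball :: "('a, 'm) monoid_scheme \<Rightarrow> 'a set \<Rightarrow> nat \<Rightarrow> 'a set" where
  "word_ball \<Gamma> S n = {foldr (\<otimes>\<^bsub>\<Gamma>\<^esub>) ws \<one>\<^bsub>\<Gamma>\<^esub> |ws. length ws \<le> n \<and> set ws \<subseteq> S \<union> m_inv \<Gamma> ` S}"

context group
begin

lemma foldr_mult_closed: "set ws \<subseteq> carrier G \<Longrightarrow> foldr (\<otimes>) ws \<one> \<in> carrier G"
  by (induction ws) auto

lemma foldr_mult_append:
  "set us \<subseteq> carrier G \<Longrightarrow> set ws \<subseteq> carrier G \<Longrightarrow>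
     foldr (\<otimes>) (us @ ws) \<one> = foldr (\<otimes>) us \<one> \<otimes> foldr (\<otimes>) ws \<one>"
  by (induction us) (auto simp: foldr_mult_closed m_assoc)

lemma inv_foldr_mult:
  "set ws \<subseteq> carrier G \<Longrightarrow> inv (foldr (\<otimes>) ws \<one>) = foldr (\<otimes>) (rev (map (m_inv G) ws)) \<one>"
proof (induction ws)
  case (Cons a ws)
  then have "set (rev (map (m_inv G) ws)) \<subseteq> carrier G" by auto
  then show ?case using Cons
    by (auto simp: inv_mult_group foldr_mult_closed foldr_mult_append simp del: foldr_append)
qed simp

lemma letters_closed: "S \<subseteq> carrier G \<Longrightarrow> S \<union> m_inv G ` S \<subseteq> carrier G"
  by auto

lemma word_ball_closed: "S \<subseteq> carrier G \<Longrightarrow> word_ball G S n \<subseteq> carrier G"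
proof
  fix x assume S: "S \<subseteq> carrier G" and "x \<in> word_ball G S n"
  then obtain ws where "x = foldr (\<otimes>) ws \<one>" "set ws \<subseteq> S \<union> m_inv G ` S"
    unfolding word_ball_def by blast
  moreover from this have "set ws \<subseteq> carrier G" using letters_closed[OF S] by (meson subset_trans)
  ultimately show "x \<in> carrier G" using foldr_mult_closed by simp
qed

lemma finite_word_ball: "finite S \<Longrightarrow> finite (word_ball G S n)"
proof -
  assume "finite S"
  then have "finite {ws. set ws \<subseteq> S \<union> m_inv G ` S \<and> length ws \<le> n}"
    by (intro finite_lists_length_le) auto
  then have "finite ((\<lambda>ws. foldr (\<otimes>) ws \<one>) ` {ws. set ws \<subseteq> S \<union> m_inv G ` S \<and> length ws \<le> n})"
    by (rule finite_imageI)
  then show ?thesis by (rule rev_finite_subset) (auto simp: word_ball_def)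
qed

lemma word_ball_mono: "m \<le> n \<Longrightarrow> word_ball G S m \<subseteq> word_ball G S n"
  unfolding word_ball_def by (blast intro: order_trans)

lemma word_ball_0: "word_ball G S 0 = {\<one>}"
  by (auto simp: word_ball_def)

lemma word_ball_mult:
  assumes "S \<subseteq> carrier G" "u \<in> word_ball G S m" "w \<in> word_ball G S n"
  shows "u \<otimes> w \<in> word_ball G S (m + n)"
proof -
  obtain us ws where "u = foldr (\<otimes>) us \<one>" "length us \<le> m" "set us \<subseteq> S \<union> m_inv G ` S"
    "w = foldr (\<otimes>) ws \<one>" "length ws \<le> n" "set ws \<subseteq> S \<union> m_inv G ` S"
    using assms(2,3) by (auto simp: word_ball_def)
  moreover from this have "u \<otimes> w = foldr (\<otimes>) (us @ ws) \<one>"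
    using foldr_mult_append[of us ws] letters_closed[OF assms(1)] by (metis subset_trans)
  ultimately show ?thesis unfolding word_ball_def
    by (intro CollectI exI[of _ "us @ ws"]) auto
qed

lemma word_ball_inv:
  assumes "S \<subseteq> carrier G" "w \<in> word_ball G S n"
  shows "inv w \<in> word_ball G S n"
proof -
  obtain ws where ws: "w = foldr (\<otimes>) ws \<one>" "length ws \<le> n" "set ws \<subseteq> S \<union> m_inv G ` S"
    using assms(2) by (auto simp: word_ball_def)
  have "inv w = foldr (\<otimes>) (rev (map (m_inv G) ws)) \<one>"
    using inv_foldr_mult[of ws] letters_closed[OF assms(1)] ws by (metis subset_trans)
  moreover have "set (rev (map (m_inv G) ws)) \<subseteq> S \<union> m_inv G ` S"
  proof
    fix x assume "x \<in> set (rev (map (m_inv G) ws))"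
    then obtain y where "y \<in> S \<union> m_inv G ` S" "x = inv y" using ws(3) unfolding set_rev set_map by blast
    then show "x \<in> S \<union> m_inv G ` S" using assms(1) by auto
  qed
  ultimately show ?thesis using ws(2) unfolding word_ball_def
    by (intro CollectI exI[of _ "rev (map (m_inv G) ws)"]) auto
qed

lemma generate_in_word_ball:
  assumes "S \<subseteq> carrier G" "g \<in> generate G S"
  shows "\<exists>n. g \<in> word_ball G S n"
  using assms(2)
proof (induction rule: generate.induct)
  case one then show ?case using word_ball_0 by blast
next
  case (incl h)
  then have "h \<in> word_ball G S 1" using assms(1) unfolding word_ball_def
    by (intro CollectI exI[of _ "[h]"]) auto
  then show ?case ..
next
  case (inv h)
  then have "inv h \<in> word_ball G S 1" using assms(1) unfolding word_ball_def
    by (intro CollectI exI[of _ "[inv h]"]) auto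
  then show ?case ..
next
  case (eng h1 h2)
  then show ?case using word_ball_mult[OF assms(1)] by blast
qed

lemma finite_subset_word_ball:
  assumes "finite_generating_set G S" "finite F" "F \<subseteq> carrier G"
  shows "\<exists>n. F \<subseteq> word_ball G S n"
  using assms(2,3)
proof (induction F rule: finite_induct)
  case (insert x F)
  then obtain n where "F \<subseteq> word_ball G S n" by auto
  moreover obtain m where "x \<in> word_ball G S m"
    using generate_in_word_ball[of S x] assms(1) insert.prems by (auto simp: finite_generating_set_def)
  ultimately have "insert x F \<subseteq> word_ball G S (max m n)"
    using word_ball_mono[of m "max m n" S] word_ball_mono[of n "max m n" S] by auto
  then show ?case ..
qed simp

lemma word_length_le_iff:
  assumes "g \<in> word_ball G S m"
  shows "word_length G S g \<le> n \<longleftrightarrow> g \<in> word_ball G S n"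
proof -
  let ?P = "\<lambda>n. \<exists>ws. length ws = n \<and> set ws \<subseteq> S \<union> m_inv G ` S \<and> foldr (\<otimes>) ws \<one> = g"
  show ?thesis
  proof
    assume le: "word_length G S g \<le> n"
    have "\<exists>n. ?P n" using assms by (auto simp: word_ball_def)
    then have "?P (word_length G S g)" unfolding word_length_def by (rule LeastI_ex)
    then show "g \<in> word_ball G S n" using le by (auto simp: word_ball_def)
  next
    assume "g \<in> word_ball G S n"
    then obtain k where "k \<le> n" "?P k" unfolding word_ball_def by blast
    have "(LEAST k. ?P k) \<le> k" by (rule Least_le) fact
    then show "word_length G S g \<le> n" unfolding word_length_def using \<open>k \<le> n\<close> by simp
  qed
qed

end

lemma (in group_hom) hom_foldr_mult:
  "set ws \<subseteq> carrier G \<Longrightarrow> h (foldr (\<otimes>\<^bsub>G\<^esub>) ws \<one>\<^bsub>G\<^esub>) = foldr (\<otimes>\<^bsub>H\<^esub>) (map h ws) \<one>\<^bsub>H\<^esub>"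
  by (induction ws) (auto simp: G.foldr_mult_closed)

lemma (in group_hom) image_word_ball:
  assumes "S \<subseteq> carrier G"
  shows "word_ball H (h ` S) n = h ` word_ball G S n"
proof -
  let ?L = "S \<union> m_inv G ` S"
  have L: "?L \<subseteq> carrier G" using G.letters_closed[OF assms] .
  have "m_inv H ` h ` S = h ` m_inv G ` S"
    using assms by (force simp: image_image hom_inv)
  then have hL: "h ` S \<union> m_inv H ` h ` S = h ` ?L" by auto
  have 1: "set (map h ws) \<subseteq> h ` ?L \<and> foldr (\<otimes>\<^bsub>H\<^esub>) (map h ws) \<one>\<^bsub>H\<^esub> = h (foldr (\<otimes>\<^bsub>G\<^esub>) ws \<one>\<^bsub>G\<^esub>)"
    if "set ws \<subseteq> ?L" for ws
  proof -
    have "set ws \<subseteq> carrier G" using that L by (rule subset_trans)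
    then show ?thesis using hom_foldr_mult[of ws] that by auto
  qed
  have 2: "\<exists>us. ws = map h us \<and> set us \<subseteq> ?L" if "set ws \<subseteq> h ` ?L" for ws
    using that lists_image[of h ?L] unfolding lists_eq_set by blast
  show ?thesis
  proof (intro equalityI subsetI)
    fix x assume "x \<in> word_ball H (h ` S) n"
    then obtain ws where ws: "length ws \<le> n" "set ws \<subseteq> h ` ?L" "x = foldr (\<otimes>\<^bsub>H\<^esub>) ws \<one>\<^bsub>H\<^esub>"
      unfolding word_ball_def hL by blast
    then obtain us where us: "ws = map h us" "set us \<subseteq> ?L" using 2 by blast
    then have "x = h (foldr (\<otimes>\<^bsub>G\<^esub>) us \<one>\<^bsub>G\<^esub>)" using ws 1 by simp
    moreover have "foldr (\<otimes>\<^bsub>G\<^esub>) us \<one>\<^bsub>G\<^esub> \<in> word_ball G S n" unfolding word_ball_def using us ws by auto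
    ultimately show "x \<in> h ` word_ball G S n" by blast
  next
    fix x assume "x \<in> h ` word_ball G S n"
    then obtain us where us: "set us \<subseteq> ?L" "length us \<le> n" "x = h (foldr (\<otimes>\<^bsub>G\<^esub>) us \<one>\<^bsub>G\<^esub>)"
      unfolding word_ball_def by blast
    show "x \<in> word_ball H (h ` S) n" unfolding word_ball_def hL
      by (intro CollectI exI[of _ "map h us"]) (use us 1[OF us(1)] in auto)
  qed
qed

text \<open>Word metrics are accessed through this equivalence: a distance in a quotient is at most \<open>n\<close> iff it is realised
  by an element of the ball of radius \<open>n\<close> in the group itself, which does not depend on the quotient.\<close>

lemma (in normal) word_metric_FactGroup_le_iff:
  assumes S: "finite_generating_set G S" and x: "x \<in> carrier G" and y: "y \<in> carrier G"
  shows "word_metric (G Mod H) (quotient_generators G S H) (H #> x) (H #> y) \<le> n \<longleftrightarrow>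
    (\<exists>w\<in>word_ball G S n. H #> y = H #> (x \<otimes> w))"
proof -
  let ?Q = "G Mod H"
  interpret Q: group ?Q by (rule factorgroup_is_group)
  interpret q: group_hom G ?Q "\<lambda>a. H #> a" by unfold_locales (rule r_coset_hom_Mod)
  have SG: "S \<subseteq> carrier G" using S by (simp add: finite_generating_set_def)
  have ball: "word_ball ?Q (quotient_generators G S H) k = (\<lambda>a. H #> a) ` word_ball G S k" for k
    unfolding quotient_generators_def by (rule q.image_word_ball[OF SG])
  obtain m where "inv x \<otimes> y \<in> word_ball G S m"
    using finite_subset_word_ball[OF S, of "{inv x \<otimes> y}"] x y by auto
  then have "H #> (inv x \<otimes> y) \<in> word_ball ?Q (quotient_generators G S H) m" unfolding ball by blast
  note le = Q.word_length_le_iff[OF this]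
  have "inv\<^bsub>?Q\<^esub> (H #> x) \<otimes>\<^bsub>?Q\<^esub> (H #> y) = H #> (inv x \<otimes> y)"
    using x y by (simp only: q.hom_inv[symmetric] q.hom_mult[symmetric] inv_closed)
  then have "word_metric ?Q (quotient_generators G S H) (H #> x) (H #> y) \<le> n \<longleftrightarrow>
     (\<exists>w\<in>word_ball G S n. H #> (inv x \<otimes> y) = H #> w)"
    unfolding word_metric_def by (simp only: le ball image_iff)
  also have "\<dots> \<longleftrightarrow> (\<exists>w\<in>word_ball G S n. H #> y = H #> (x \<otimes> w))"
  proof (intro bex_cong refl)
    fix w assume "w \<in> word_ball G S n"
    then have w: "w \<in> carrier G" using word_ball_closed[OF SG] by blast
    have "H #> (inv x \<otimes> y) = inv\<^bsub>?Q\<^esub> (H #> x) \<otimes>\<^bsub>?Q\<^esub> (H #> y)"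
      "H #> (x \<otimes> w) = (H #> x) \<otimes>\<^bsub>?Q\<^esub> (H #> w)"
      using x y w by (simp_all only: q.hom_inv[symmetric] q.hom_mult[symmetric] inv_closed)
    then show "H #> (inv x \<otimes> y) = H #> w \<longleftrightarrow> H #> y = H #> (x \<otimes> w)"
      using q.hom_closed[OF x] q.hom_closed[OF y] q.hom_closed[OF w]
      by (metis Q.inv_solve_left')
  qed
  finally show ?thesis .
qed

section \<open>Box spaces from controlled kernels\<close>

text \<open>The chain of subgroups is presented by homomorphisms to arbitrary finite groups, so that kernels can be
  defined on concrete groups, such as wreath products, instead of sets of cosets.\<close>

locale box_quotients =
  \<Gamma>: group \<Gamma> for \<Gamma> :: "('g, 'm) monoid_scheme" +
  fixes T :: "'g set" and Q :: "nat \<Rightarrow> ('q, 'l) monoid_scheme" and \<theta> :: "nat \<Rightarrow> 'g \<Rightarrow> 'q"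
  assumes gens: "finite_generating_set \<Gamma> T"
    and Q_group: "group (Q i)" and finite_Q: "finite (carrier (Q i))"
    and hom: "\<theta> i \<in> hom \<Gamma> (Q i)"
    and nested: "kernel \<Gamma> (Q (Suc i)) (\<theta> (Suc i)) \<subseteq> kernel \<Gamma> (Q i) (\<theta> i)"
    and separating: "(\<Inter>i. kernel \<Gamma> (Q i) (\<theta> i)) = {\<one>\<^bsub>\<Gamma>\<^esub>}"
begin

sublocale \<theta>: group_hom \<Gamma> "Q i" "\<theta> i" for i
  by (rule group_hom.intro[OF \<Gamma>.is_group Q_group group_hom_axioms.intro[OF hom]])

abbreviation "K i \<equiv> kernel \<Gamma> (Q i) (\<theta> i)"

lemma normal_K: "K i \<lhd> \<Gamma>"
  by (rule \<theta>.normal_kernel)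

abbreviation quotient_dist :: "nat \<Rightarrow> 'g set \<Rightarrow> 'g set \<Rightarrow> nat" where
  "quotient_dist i \<equiv> word_metric (\<Gamma> Mod K i) (quotient_generators \<Gamma> T (K i))"

abbreviation diam :: "nat \<Rightarrow> nat" where
  "diam i \<equiv> word_diameter (\<Gamma> Mod K i) (quotient_generators \<Gamma> T (K i))"

lemma coset_eq_iff:
  assumes "x \<in> carrier \<Gamma>" "y \<in> carrier \<Gamma>"
  shows "K i #>\<^bsub>\<Gamma>\<^esub> x = K i #>\<^bsub>\<Gamma>\<^esub> y \<longleftrightarrow> \<theta> i x = \<theta> i y"
proof
  assume "K i #>\<^bsub>\<Gamma>\<^esub> x = K i #>\<^bsub>\<Gamma>\<^esub> y"
  then have "x \<in> K i #>\<^bsub>\<Gamma>\<^esub> y"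
    using \<Gamma>.rcos_self[OF assms(1) normal_imp_subgroup[OF normal_K[of i]]] by simp
  then obtain k where "k \<in> K i" "x = k \<otimes>\<^bsub>\<Gamma>\<^esub> y" unfolding r_coset_def by blast
  then show "\<theta> i x = \<theta> i y" using assms(2) by (simp add: kernel_def)
next
  assume e: "\<theta> i x = \<theta> i y"
  have "\<theta> i (x \<otimes>\<^bsub>\<Gamma>\<^esub> inv\<^bsub>\<Gamma>\<^esub> y) = \<one>\<^bsub>Q i\<^esub>" using assms e by simp
  then have "x \<otimes>\<^bsub>\<Gamma>\<^esub> inv\<^bsub>\<Gamma>\<^esub> y \<in> K i" using assms by (simp add: kernel_def)
  moreover have "x = (x \<otimes>\<^bsub>\<Gamma>\<^esub> inv\<^bsub>\<Gamma>\<^esub> y) \<otimes>\<^bsub>\<Gamma>\<^esub> y" using assms by (simp add: \<Gamma>.m_assoc)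
  ultimately have "x \<in> K i #>\<^bsub>\<Gamma>\<^esub> y" unfolding r_coset_def by blast
  then show "K i #>\<^bsub>\<Gamma>\<^esub> x = K i #>\<^bsub>\<Gamma>\<^esub> y"
    using \<Gamma>.repr_independence[OF _ assms(2) normal_imp_subgroup[OF normal_K]] by simp
qed

text \<open>The embedding of \<open>\<Gamma>/K\<^sub>i\<close> into \<open>Q\<^sub>i\<close> induced by \<open>\<theta>\<^sub>i\<close>.\<close>

definition \<iota> :: "nat \<Rightarrow> 'g set \<Rightarrow> 'q" where
  "\<iota> i c = \<theta> i (SOME x. x \<in> carrier \<Gamma> \<and> c = K i #>\<^bsub>\<Gamma>\<^esub> x)"

lemma \<iota>_coset: "x \<in> carrier \<Gamma> \<Longrightarrow> \<iota> i (K i #>\<^bsub>\<Gamma>\<^esub> x) = \<theta> i x"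
proof -
  assume x: "x \<in> carrier \<Gamma>"
  define y where "y = (SOME y. y \<in> carrier \<Gamma> \<and> K i #>\<^bsub>\<Gamma>\<^esub> x = K i #>\<^bsub>\<Gamma>\<^esub> y)"
  have "y \<in> carrier \<Gamma> \<and> K i #>\<^bsub>\<Gamma>\<^esub> x = K i #>\<^bsub>\<Gamma>\<^esub> y"
    unfolding y_def by (rule someI[of _ x]) (use x in simp)
  then have "\<theta> i y = \<theta> i x" using coset_eq_iff[OF x, of y i] by simp
  then show ?thesis unfolding \<iota>_def y_def .
qed

lemma quotient_points: "carrier (\<Gamma> Mod K i) = (\<lambda>x. K i #>\<^bsub>\<Gamma>\<^esub> x) ` carrier \<Gamma>"
  by (rule carrier_FactGroup)

lemma \<iota>_inj: "inj_on (\<iota> i) (carrier (\<Gamma> Mod K i))"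
proof (rule inj_onI)
  fix c d assume "c \<in> carrier (\<Gamma> Mod K i)" "d \<in> carrier (\<Gamma> Mod K i)" and e: "\<iota> i c = \<iota> i d"
  then obtain x y where "x \<in> carrier \<Gamma>" "y \<in> carrier \<Gamma>" "c = K i #>\<^bsub>\<Gamma>\<^esub> x" "d = K i #>\<^bsub>\<Gamma>\<^esub> y"
    unfolding quotient_points by blast
  then show "c = d" using e coset_eq_iff \<iota>_coset by metis
qed

lemma \<iota>_closed: "c \<in> carrier (\<Gamma> Mod K i) \<Longrightarrow> \<iota> i c \<in> carrier (Q i)"
  unfolding quotient_points using \<iota>_coset by fastforce

lemma finite_quotient: "finite (carrier (\<Gamma> Mod K i))"
  by (rule inj_on_finite[OF \<iota>_inj _ finite_Q]) (auto intro: \<iota>_closed)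

lemma finite_index: "finite_index_normal (K i) \<Gamma>"
  using finite_quotient[of i] normal_K[of i] by (simp add: finite_index_normal_def FactGroup_def)

lemma residually_finite: "residually_finite \<Gamma>"
  unfolding residually_finite_def
proof (intro ballI impI)
  fix g assume "g \<noteq> \<one>\<^bsub>\<Gamma>\<^esub>"
  then have "g \<notin> (\<Inter>i. K i)" using separating by simp
  then obtain i where "g \<notin> K i" by auto
  then show "\<exists>N. finite_index_normal N \<Gamma> \<and> g \<notin> N" using finite_index by (intro exI[of _ "K i"]) simp
qed

lemma gens_closed: "T \<subseteq> carrier \<Gamma>"
  using gens by (simp add: finite_generating_set_def)

lemma quotient_dist_le_iff:
  assumes "x \<in> carrier (\<Gamma> Mod K i)" "y \<in> carrier (\<Gamma> Mod K i)"
  shows "quotient_dist i x y \<le> n \<longleftrightarrow> (\<exists>w\<in>word_ball \<Gamma> T n. \<iota> i y = \<iota> i x \<otimes>\<^bsub>Q i\<^esub> \<theta> i w)"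
proof -
  obtain a b where ab: "a \<in> carrier \<Gamma>" "b \<in> carrier \<Gamma>" "x = K i #>\<^bsub>\<Gamma>\<^esub> a" "y = K i #>\<^bsub>\<Gamma>\<^esub> b"
    using assms by (auto simp: quotient_points)
  have "w \<in> carrier \<Gamma>" if "w \<in> word_ball \<Gamma> T n" for w
    using \<Gamma>.word_ball_closed[OF gens_closed] that by blast
  then show ?thesis
    using normal.word_metric_FactGroup_le_iff[OF normal_K gens ab(1,2), of i n] ab
    by (simp add: \<iota>_coset coset_eq_iff)
qed

lemma quotient_dist_eq_0_iff:
  assumes "x \<in> carrier (\<Gamma> Mod K i)" "y \<in> carrier (\<Gamma> Mod K i)"
  shows "quotient_dist i x y = 0 \<longleftrightarrow> x = y"
proof -
  have "quotient_dist i x y = 0 \<longleftrightarrow> \<iota> i y = \<iota> i x"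
    using quotient_dist_le_iff[OF assms, of 0] \<iota>_closed[OF assms(1)] by (simp add: \<Gamma>.word_ball_0)
  then show ?thesis using inj_onD[OF \<iota>_inj, of i x y] assms by metis
qed

lemma quotient_dist_commute_le:
  assumes "x \<in> carrier (\<Gamma> Mod K i)" "y \<in> carrier (\<Gamma> Mod K i)"
  shows "quotient_dist i y x \<le> quotient_dist i x y"
proof -
  obtain w where w: "w \<in> word_ball \<Gamma> T (quotient_dist i x y)" "\<iota> i y = \<iota> i x \<otimes>\<^bsub>Q i\<^esub> \<theta> i w"
    using quotient_dist_le_iff[OF assms, of "quotient_dist i x y"] by auto
  have wc: "w \<in> carrier \<Gamma>" using \<Gamma>.word_ball_closed[OF gens_closed] w by blast
  have "\<iota> i x = \<iota> i y \<otimes>\<^bsub>Q i\<^esub> \<theta> i (inv\<^bsub>\<Gamma>\<^esub> w)"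
    using w(2) \<iota>_closed[OF assms(1)] wc by (simp add: \<theta>.H.m_assoc)
  then show ?thesis using \<Gamma>.word_ball_inv[OF gens_closed w(1)] quotient_dist_le_iff[OF assms(2,1)] by blast
qed

lemma quotient_dist_commute:
  assumes "x \<in> carrier (\<Gamma> Mod K i)" "y \<in> carrier (\<Gamma> Mod K i)"
  shows "quotient_dist i x y = quotient_dist i y x"
  using quotient_dist_commute_le[OF assms] quotient_dist_commute_le[OF assms(2,1)] by (rule antisym[rotated])

lemma quotient_dist_triangle:
  assumes "x \<in> carrier (\<Gamma> Mod K i)" "y \<in> carrier (\<Gamma> Mod K i)" "z \<in> carrier (\<Gamma> Mod K i)"
  shows "quotient_dist i x z \<le> quotient_dist i x y + quotient_dist i y z"
proof -
  obtain u where u: "u \<in> word_ball \<Gamma> T (quotient_dist i x y)" "\<iota> i y = \<iota> i x \<otimes>\<^bsub>Q i\<^esub> \<theta> i u"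
    using quotient_dist_le_iff[OF assms(1,2), of "quotient_dist i x y"] by auto
  obtain w where w: "w \<in> word_ball \<Gamma> T (quotient_dist i y z)" "\<iota> i z = \<iota> i y \<otimes>\<^bsub>Q i\<^esub> \<theta> i w"
    using quotient_dist_le_iff[OF assms(2,3), of "quotient_dist i y z"] by auto
  have "u \<in> carrier \<Gamma>" "w \<in> carrier \<Gamma>" using \<Gamma>.word_ball_closed[OF gens_closed] u w by blast+
  then have "\<iota> i z = \<iota> i x \<otimes>\<^bsub>Q i\<^esub> \<theta> i (u \<otimes>\<^bsub>\<Gamma>\<^esub> w)"
    using w(2) u(2) \<iota>_closed[OF assms(1)] by (simp add: \<theta>.H.m_assoc)
  then show ?thesis
    using \<Gamma>.word_ball_mult[OF gens_closed u(1) w(1)] quotient_dist_le_iff[OF assms(1,3)] by blast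
qed

lemma quotient_dist_le_diam:
  assumes "x \<in> carrier (\<Gamma> Mod K i)" "y \<in> carrier (\<Gamma> Mod K i)"
  shows "quotient_dist i x y \<le> diam i"
  unfolding word_diameter_def
proof (rule Max_ge)
  have "{quotient_dist i x y |x y. x \<in> carrier (\<Gamma> Mod K i) \<and> y \<in> carrier (\<Gamma> Mod K i)} =
    (\<lambda>(x, y). quotient_dist i x y) ` (carrier (\<Gamma> Mod K i) \<times> carrier (\<Gamma> Mod K i))" by auto
  then show "finite {quotient_dist i x y |x y. x \<in> carrier (\<Gamma> Mod K i) \<and> y \<in> carrier (\<Gamma> Mod K i)}"
    using finite_quotient by simp
qed (use assms in blast)

text \<open>Positions of the components on a line.  The increments exceed the diameters of both neighbouring
  components, as the definition of a box space demands; the summand \<open>j\<close> makes them grow, so that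
  only finitely many pairs of components are within a given distance of each other.\<close>

definition height :: "nat \<Rightarrow> nat" where
  "height i = (\<Sum>j<i. 1 + j + diam j + diam (Suc j))"

lemma height_gap:
  assumes "i < j"
  shows "height i + j + diam j \<le> height j" "height i + diam i < height j"
proof -
  obtain k where k: "j = Suc k" using assms by (cases j) auto
  have mono: "height i \<le> height k" if "i \<le> k" for i k
    unfolding height_def by (rule sum_mono2) (use that in auto)
  show "height i + j + diam j \<le> height j"
    using mono[of i k] assms k by (simp add: height_def)
  show "height i + diam i < height j"
    using mono[of "Suc i" j] assms by (simp add: height_def)
qed

text \<open>The maximum makes the function symmetric on all pairs, also outside the box space; on cosets both
  arguments of the maximum agree.\<close>

definition box_dist :: "nat \<times> 'g set \<Rightarrow> nat \<times> 'g set \<Rightarrow> real" where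
  "box_dist p q = (if fst p = fst q
     then real (max (quotient_dist (fst p) (snd p) (snd q)) (quotient_dist (fst p) (snd q) (snd p)))
     else \<bar>real (height (fst p)) - real (height (fst q))\<bar>)"

lemma box_dist_same:
  assumes "x \<in> carrier (\<Gamma> Mod K i)" "y \<in> carrier (\<Gamma> Mod K i)"
  shows "box_dist (i, x) (i, y) = real (quotient_dist i x y)"
  using quotient_dist_commute[OF assms] by (simp add: box_dist_def)

lemma box_dist_different:
  "i \<noteq> j \<Longrightarrow> box_dist (i, x) (j, y) = \<bar>real (height i) - real (height j)\<bar>"
  by (simp add: box_dist_def)

lemma box_dist_separated:
  assumes "i \<noteq> j"
  shows "real (diam i) < \<bar>real (height i) - real (height j)\<bar>"
    "real (max i j) \<le> \<bar>real (height i) - real (height j)\<bar>"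
  using assms height_gap[of i j] height_gap[of j i] by (cases "i < j"; auto)+

lemma box_space_box_dist: "box_space \<Gamma> T K box_dist"
proof -
  let ?X = "box_points \<Gamma> K"
  have "Metric_space ?X box_dist"
  proof
    show "0 \<le> box_dist p q" for p q by (auto simp: box_dist_def)
    show "box_dist p q = box_dist q p" for p q by (simp add: box_dist_def max.commute abs_minus_commute)
    fix p q assume "p \<in> ?X" "q \<in> ?X"
    then obtain i x j y where pq: "p = (i, x)" "q = (j, y)"
      and c: "x \<in> carrier (\<Gamma> Mod K i)" "y \<in> carrier (\<Gamma> Mod K j)"
      by (auto simp: box_points_def)
    show "box_dist p q = 0 \<longleftrightarrow> p = q"
    proof (cases "i = j")
      case True then show ?thesis
        using c quotient_dist_eq_0_iff[of x i y] box_dist_same[of x i y] by (simp add: pq)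
    next
      case False
      then show ?thesis using box_dist_separated(1)[OF False] by (auto simp: pq box_dist_different)
    qed
    fix r assume "r \<in> ?X"
    then obtain k z where r: "r = (k, z)" and cr: "z \<in> carrier (\<Gamma> Mod K k)" by (auto simp: box_points_def)
    show "box_dist p r \<le> box_dist p q + box_dist q r"
    proof (cases "i = k")
      case ik: True
      show ?thesis
      proof (cases "j = i")
        case True then show ?thesis
          using c cr ik quotient_dist_triangle[of x i y z]
          by (simp add: pq r box_dist_same flip: of_nat_add)
      next
        case False
        then have "box_dist p r \<le> box_dist p q"
          using c cr ik quotient_dist_le_diam[of x i z] box_dist_separated(1)[of i j]
          by (simp add: pq r box_dist_same box_dist_different)
        moreover have "0 \<le> box_dist q r" by (auto simp: box_dist_def)
        ultimately show ?thesis by simp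
      qed
    next
      case ik: False
      consider "j = i" | "j = k" | "j \<noteq> i" "j \<noteq> k" by blast
      then show ?thesis
        by cases (use c cr ik in \<open>auto simp: pq r box_dist_same box_dist_different\<close>)
    qed
  qed
  moreover have "real (max (diam i) (diam j)) < box_dist (i, x) (j, y)" if "i \<noteq> j" for i j x y
    using box_dist_separated(1)[OF that] box_dist_separated(1)[OF that[symmetric]] that
    by (auto simp: box_dist_def max_def)
  ultimately show ?thesis
    unfolding box_space_def
    using \<Gamma>.is_group residually_finite gens finite_index nested separating box_dist_same by simp
qed

text \<open>Coordinate 0 holds the height of the component, and the coordinates of the \<open>i\<close>-th component are
  numbered by the pairs \<open>(i, k)\<close>.  Inside a component the distance in \<open>\<ell>\<^sup>2\<close> is the square root of
  \<open>\<kappa>\<^sub>i\<close>.  Between components it is at least the difference of heights; an upper bound is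
  automatic, since only finitely many pairs of points in different components lie within a given
  distance.\<close>

lemma coarsely_embeds_if_controlled:
  assumes euclid: "\<And>i. euclidean_kernel (carrier (Q i)) (\<kappa> i)"
    and controlled: "controlled_kernels \<Gamma> Q \<theta> \<kappa>"
  shows "coarsely_embeds_into_hilbert TYPE(nat \<Rightarrow> real) (box_points \<Gamma> K) box_dist"
proof -
  let ?X = "box_points \<Gamma> K"
  obtain n a where na: "\<And>i q r. q \<in> carrier (Q i) \<Longrightarrow> r \<in> carrier (Q i) \<Longrightarrow>
      \<kappa> i q r = (\<Sum>k<(n i::nat). (a i k q - a i k r)\<^sup>2)"
    using euclid unfolding euclidean_kernel_def by metis
  define f :: "nat \<times> 'g set \<Rightarrow> nat \<Rightarrow> real" where
    "f p m = (case m of 0 \<Rightarrow> real (height (fst p)) | Suc m' \<Rightarrow>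
       (let (j, k) = prod_decode m' in if j = fst p \<and> k < n j then a j k (\<iota> j (snd p)) else 0))" for p m
  define supp where "supp i = insert 0 ((\<lambda>k. Suc (prod_encode (i, k))) ` {..<n i})" for i
  have f0: "f p m = 0" if "m \<notin> supp (fst p)" for p m
  proof (cases m)
    case 0 then show ?thesis using that by (simp add: supp_def)
  next
    case (Suc m')
    obtain j k where jk: "prod_decode m' = (j, k)" by fastforce
    then have "m' = prod_encode (j, k)" by (metis prod_decode_inverse)
    then show ?thesis using that Suc jk by (auto simp: f_def supp_def)
  qed
  have fc: "f p \<in> carrier l2" for p
    unfolding l2_simps by (rule summable_finite[of "supp (fst p)"]) (auto simp: f0 supp_def)
  define \<delta> where "\<delta> p q = sqrt (l2_ip (f p \<ominus>\<^bsub>l2\<^esub> f q) (f p \<ominus>\<^bsub>l2\<^esub> f q))" for p q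
  have \<delta>: "\<delta> p q = sqrt (suminf (\<lambda>m. (f p m - f q m)\<^sup>2))" for p q
    by (simp add: \<delta>_def l2_minus fc l2_ip_def power2_eq_square)
  have sum: "suminf (\<lambda>m. (f p m - f q m)\<^sup>2) = (\<Sum>m\<in>supp (fst p) \<union> supp (fst q). (f p m - f q m)\<^sup>2)" for p q
    by (rule suminf_finite) (auto simp: supp_def f0)
  have \<delta>nn: "0 \<le> \<delta> p q" for p q unfolding \<delta> sum by (simp add: sum_nonneg)
  have same: "\<delta> (i, x) (i, y) = sqrt (\<kappa> i (\<iota> i x) (\<iota> i y))"
    if "x \<in> carrier (\<Gamma> Mod K i)" "y \<in> carrier (\<Gamma> Mod K i)" for i x y
  proof -
    have "(\<Sum>m\<in>supp i. (f (i, x) m - f (i, y) m)\<^sup>2) =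
      (f (i, x) 0 - f (i, y) 0)\<^sup>2 + (\<Sum>m\<in>(\<lambda>k. Suc (prod_encode (i, k))) ` {..<n i}. (f (i, x) m - f (i, y) m)\<^sup>2)"
      unfolding supp_def by (rule sum.insert) auto
    also have "\<dots> = (\<Sum>k<n i. (f (i, x) (Suc (prod_encode (i, k))) - f (i, y) (Suc (prod_encode (i, k))))\<^sup>2)"
      by (subst sum.reindex) (auto simp: inj_on_def f_def)
    also have "\<dots> = \<kappa> i (\<iota> i x) (\<iota> i y)"
      using that by (simp add: f_def na \<iota>_closed)
    finally show ?thesis by (simp add: \<delta> sum)
  qed
  have different: "\<bar>real (height (fst p)) - real (height (fst q))\<bar> \<le> \<delta> p q" for p q
  proof -
    have "(\<Sum>m\<in>{0}. (f p m - f q m)\<^sup>2) \<le> (\<Sum>m\<in>supp (fst p) \<union> supp (fst q). (f p m - f q m)\<^sup>2)"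
      by (rule sum_mono2) (auto simp: supp_def)
    then show ?thesis unfolding \<delta> sum by (intro real_le_rsqrt) (simp add: f_def)
  qed
  have upper: "\<exists>C. \<forall>p\<in>?X. \<forall>q\<in>?X. box_dist p q \<le> r \<longrightarrow> \<delta> p q \<le> C" for r
  proof -
    define N where "N = nat \<lfloor>r\<rfloor>"
    have N: "m \<le> N" if "real m \<le> r" for m using that by (simp add: N_def le_nat_floor)
    have wc: "w \<in> carrier \<Gamma>" if "w \<in> word_ball \<Gamma> T N" for w
      using \<Gamma>.word_ball_closed[OF gens_closed] that by blast
    then have "\<forall>w\<in>word_ball \<Gamma> T N. \<exists>C. \<forall>i. \<forall>q\<in>carrier (Q i). \<kappa> i q (q \<otimes>\<^bsub>Q i\<^esub> \<theta> i w) \<le> C"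
      using controlled by (simp add: controlled_kernels_def)
    then obtain C where C: "\<And>w i q. w \<in> word_ball \<Gamma> T N \<Longrightarrow> q \<in> carrier (Q i) \<Longrightarrow> \<kappa> i q (q \<otimes>\<^bsub>Q i\<^esub> \<theta> i w) \<le> C w"
      by metis
    define C1 where "C1 = (\<Sum>w\<in>word_ball \<Gamma> T N. \<bar>C w\<bar>)"
    have C1: "C w \<le> C1" if "w \<in> word_ball \<Gamma> T N" for w
      using member_le_sum[of w "word_ball \<Gamma> T N" "\<lambda>w. \<bar>C w\<bar>"] that \<Gamma>.finite_word_ball[of T N] gens
      by (auto simp: C1_def finite_generating_set_def)
    \<comment> \<open>Points of different components within distance r both lie in the finite set P.\<close>
    define P where "P = (SIGMA i:{..N}. carrier (\<Gamma> Mod K i))"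
    have "finite P" using finite_quotient by (simp add: P_def)
    define C2 where "C2 = (\<Sum>(p, q)\<in>P \<times> P. \<delta> p q)"
    have C2: "\<delta> p q \<le> C2" if "p \<in> P" "q \<in> P" for p q
      using member_le_sum[of "(p, q)" "P \<times> P" "\<lambda>(p, q). \<delta> p q"] that \<open>finite P\<close> \<delta>nn
      by (auto simp: C2_def)
    have "\<delta> p q \<le> max (sqrt C1) C2" if p: "p \<in> ?X" and q: "q \<in> ?X" and le: "box_dist p q \<le> r" for p q
    proof -
      obtain i x j y where pq: "p = (i, x)" "q = (j, y)" by fastforce
      have c: "x \<in> carrier (\<Gamma> Mod K i)" "y \<in> carrier (\<Gamma> Mod K j)"
        using p q by (auto simp: box_points_def pq)
      show ?thesis
      proof (cases "i = j")
        case True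
        then have "quotient_dist i x y \<le> N" using le box_dist_same[of x i y] c by (intro N) (simp add: pq)
        then obtain w where w: "w \<in> word_ball \<Gamma> T N" "\<iota> i y = \<iota> i x \<otimes>\<^bsub>Q i\<^esub> \<theta> i w"
          using quotient_dist_le_iff c True by blast
        have "\<kappa> i (\<iota> i x) (\<iota> i y) \<le> C1"
          using C[OF w(1) \<iota>_closed[OF c(1)]] C1[OF w(1)] w(2) by simp
        then show ?thesis using same[of x i y] c True by (simp add: pq le_max_iff_disj)
      next
        case False
        then have "real (max i j) \<le> r"
          using le box_dist_separated(2)[OF False] by (simp add: box_dist_def pq)
        then have "max i j \<le> N" by (rule N)
        then have "p \<in> P" "q \<in> P" using c by (auto simp: P_def pq)
        then show ?thesis using C2[of p q] by simp
      qed
    qed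
    then show ?thesis by blast
  qed
  have lower: "\<exists>r. \<forall>p\<in>?X. \<forall>q\<in>?X. \<delta> p q \<le> C \<longrightarrow> box_dist p q \<le> r" for C
  proof -
    obtain F where F: "F \<subseteq> carrier \<Gamma>" "finite F"
      "\<And>i q r. q \<in> carrier (Q i) \<Longrightarrow> r \<in> carrier (Q i) \<Longrightarrow> \<kappa> i q r \<le> C\<^sup>2 \<Longrightarrow> \<exists>w\<in>F. r = q \<otimes>\<^bsub>Q i\<^esub> \<theta> i w"
      using controlled unfolding controlled_kernels_def by metis
    obtain N where N: "F \<subseteq> word_ball \<Gamma> T N"
      using \<Gamma>.finite_subset_word_ball[OF gens F(2,1)] by blast
    have "box_dist p q \<le> max (real N) C" if p: "p \<in> ?X" and q: "q \<in> ?X" and le: "\<delta> p q \<le> C" for p q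
    proof -
      obtain i x j y where pq: "p = (i, x)" "q = (j, y)" by fastforce
      have c: "x \<in> carrier (\<Gamma> Mod K i)" "y \<in> carrier (\<Gamma> Mod K j)"
        using p q by (auto simp: box_points_def pq)
      show ?thesis
      proof (cases "i = j")
        case True
        have "sqrt (\<kappa> i (\<iota> i x) (\<iota> i y)) \<le> C" using le same[of x i y] c True by (simp add: pq)
        then have "\<kappa> i (\<iota> i x) (\<iota> i y) \<le> C\<^sup>2" by (rule sqrt_le_D)
        then obtain w where "w \<in> F" "\<iota> i y = \<iota> i x \<otimes>\<^bsub>Q i\<^esub> \<theta> i w"
          using F(3) \<iota>_closed c True by metis
        then have "quotient_dist i x y \<le> N" using quotient_dist_le_iff c True N by blast
        then show ?thesis using True box_dist_same[of x i y] c by (simp add: pq)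
      next
        case False
        then show ?thesis using different[of p q] le by (simp add: box_dist_def pq)
      qed
    qed
    then show ?thesis by blast
  qed
  obtain \<rho> \<rho>' where \<rho>: "control_function \<rho>" "control_function \<rho>'"
    "\<And>p q. p \<in> ?X \<Longrightarrow> q \<in> ?X \<Longrightarrow> 0 \<le> box_dist p q \<Longrightarrow>
       \<rho> (box_dist p q) \<le> \<delta> p q \<and> \<delta> p q \<le> \<rho>' (box_dist p q)"
    using control_functions_exist[of ?X \<delta> box_dist, OF \<delta>nn upper lower] by blast
  have "0 \<le> box_dist p q" for p q by (auto simp: box_dist_def)
  then show ?thesis
    unfolding coarsely_embeds_into_hilbert_def
    using real_hilbert_space_l2 fc \<rho>
    by (intro exI[of _ l2] exI[of _ l2_ip] exI[of _ f] exI[of _ \<rho>] exI[of _ \<rho>']) (auto simp: \<delta>_def)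
qed

end

section \<open>Controlled cut kernels from an embedded box space\<close>

context real_hilbert_space
begin

lemma smult_mem: "x \<in> carrier V \<Longrightarrow> c \<odot>\<^bsub>V\<^esub> x \<in> carrier V"
proof -
  have "c \<in> carrier real_ring" by (simp add: real_ring_def)
  then show "x \<in> carrier V \<Longrightarrow> c \<odot>\<^bsub>V\<^esub> x \<in> carrier V" by (rule smult_closed)
qed

lemma ip_zero_left: "z \<in> carrier V \<Longrightarrow> ip \<zero>\<^bsub>V\<^esub> z = 0"
  using ip_add_left[of "\<zero>\<^bsub>V\<^esub>" "\<zero>\<^bsub>V\<^esub>" z] by simp

lemma ip_uminus_left:
  assumes "y \<in> carrier V" "z \<in> carrier V"
  shows "ip (\<ominus>\<^bsub>V\<^esub> y) z = - ip y z"
  using ip_add_left[of y "\<ominus>\<^bsub>V\<^esub> y" z] assms by (simp add: M.r_neg ip_zero_left)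

lemma ip_minus_self:
  assumes "x \<in> carrier V" "y \<in> carrier V"
  shows "ip (x \<ominus>\<^bsub>V\<^esub> y) (x \<ominus>\<^bsub>V\<^esub> y) = ip x x - 2 * ip x y + ip y y"
proof -
  have l: "ip (x \<ominus>\<^bsub>V\<^esub> y) z = ip x z - ip y z" if "z \<in> carrier V" for z
    using assms that by (simp add: a_minus_def ip_add_left ip_uminus_left)
  have m: "x \<ominus>\<^bsub>V\<^esub> y \<in> carrier V" using assms by simp
  show ?thesis
    using l[OF m] l[OF assms(1)] l[OF assms(2)] ip_commute[OF assms] ip_commute[OF assms(1) m] ip_commute[OF assms(2) m]
    by simp
qed

lemma ip_finsum_left:
  assumes "finite X" "\<And>x. x \<in> X \<Longrightarrow> f x \<in> carrier V" "z \<in> carrier V"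
  shows "ip (finsum V (\<lambda>x. c x \<odot>\<^bsub>V\<^esub> f x) X) z = (\<Sum>x\<in>X. c x * ip (f x) z)"
  using assms(1,2)
proof (induction X rule: finite_induct)
  case empty then show ?case by (simp add: ip_zero_left assms(3))
next
  case (insert x X)
  have m: "finsum V (\<lambda>x. c x \<odot>\<^bsub>V\<^esub> f x) X \<in> carrier V"
    by (rule M.finsum_closed) (use insert.prems smult_mem in auto)
  have "finsum V (\<lambda>x. c x \<odot>\<^bsub>V\<^esub> f x) (insert x X) = c x \<odot>\<^bsub>V\<^esub> f x \<oplus>\<^bsub>V\<^esub> finsum V (\<lambda>x. c x \<odot>\<^bsub>V\<^esub> f x) X"
    by (rule M.finsum_insert) (use insert smult_mem in auto)
  then show ?case
    using insert m smult_mem[of "f x" "c x"] assms(3)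
    by (simp add: ip_add_left ip_smult_left)
qed

lemma gram_nonneg:
  assumes "finite X" "\<And>x. x \<in> X \<Longrightarrow> f x \<in> carrier V"
  shows "0 \<le> (\<Sum>x\<in>X. \<Sum>y\<in>X. c x * c y * ip (f x) (f y))"
proof -
  define v where "v = finsum V (\<lambda>x. c x \<odot>\<^bsub>V\<^esub> f x) X"
  have v: "v \<in> carrier V" unfolding v_def
    by (rule M.finsum_closed) (use assms smult_mem in auto)
  have "ip v v = (\<Sum>x\<in>X. c x * ip (f x) v)"
    unfolding v_def by (rule ip_finsum_left) (use assms v in \<open>auto simp: v_def\<close>)
  also have "\<dots> = (\<Sum>x\<in>X. c x * (\<Sum>y\<in>X. c y * ip (f x) (f y)))"
  proof (intro sum.cong refl)
    fix x assume x: "x \<in> X"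
    have "ip (f x) v = ip v (f x)" by (rule ip_commute) (use assms x v in auto)
    also have "\<dots> = (\<Sum>y\<in>X. c y * ip (f y) (f x))"
      unfolding v_def by (rule ip_finsum_left) (use assms x in auto)
    also have "\<dots> = (\<Sum>y\<in>X. c y * ip (f x) (f y))"
      by (intro sum.cong refl) (use ip_commute assms x in auto)
    finally show "c x * ip (f x) v = c x * (\<Sum>y\<in>X. c y * ip (f x) (f y))" by simp
  qed
  also have "\<dots> = (\<Sum>x\<in>X. \<Sum>y\<in>X. c x * c y * ip (f x) (f y))"
    by (simp only: sum_distrib_left mult.assoc)
  finally show ?thesis using ip_nonneg[OF v] by simp
qed

lemma euclidean_kernel_norm:
  assumes "finite X" "\<And>x. x \<in> X \<Longrightarrow> f x \<in> carrier V"
  shows "euclidean_kernel X (\<lambda>x y. ip (f x \<ominus>\<^bsub>V\<^esub> f y) (f x \<ominus>\<^bsub>V\<^esub> f y))"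
proof -
  have "\<exists>(n::nat) a. \<forall>x\<in>X. \<forall>y\<in>X. ip (f x) (f y) = (\<Sum>i<n. a i x * a i y)"
    by (rule positive_kernel_gram[OF assms(1)]) (use gram_nonneg[OF assms] ip_commute assms(2) in auto)
  then obtain n a where a: "\<And>x y. x \<in> X \<Longrightarrow> y \<in> X \<Longrightarrow> ip (f x) (f y) = (\<Sum>i<(n::nat). a i x * a i y)"
    by blast
  show ?thesis
  proof (rule euclidean_kernelI[of "{..<n}" _ _ a])
    fix x y assume "x \<in> X" "y \<in> X"
    moreover from this have "ip (f x \<ominus>\<^bsub>V\<^esub> f y) (f x \<ominus>\<^bsub>V\<^esub> f y) = ip (f x) (f x) - 2 * ip (f x) (f y) + ip (f y) (f y)"
      by (intro ip_minus_self assms(2))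
    moreover have "(\<Sum>i<n. (a i x - a i y)\<^sup>2) = (\<Sum>i<n. a i x * a i x) - 2 * (\<Sum>i<n. a i x * a i y) + (\<Sum>i<n. a i y * a i y)"
      unfolding sum_distrib_left sum_subtractf[symmetric] sum.distrib[symmetric]
      by (intro sum.cong refl) (simp add: power2_eq_square algebra_simps)
    ultimately show "ip (f x \<ominus>\<^bsub>V\<^esub> f y) (f x \<ominus>\<^bsub>V\<^esub> f y) = (\<Sum>i<n. (a i x - a i y)\<^sup>2)"
      by (simp only: a)
  qed simp
qed

end

text \<open>The upper and lower control functions of the embedding bound the Euclidean kernels on each quotient
  in terms of the radius of a ball of words, and the passage to cuts costs only constants.\<close>

lemma controlled_cut_kernels:
  assumes box: "box_space H S K d"
    and emb: "coarsely_embeds_into_hilbert TYPE('v) (box_points H K) d"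
  shows "\<exists>\<omega>. (\<forall>i. cut_kernel (carrier (H Mod K i)) (\<omega> i)) \<and>
    controlled_kernels H (\<lambda>i. H Mod K i) (\<lambda>i h. K i #>\<^bsub>H\<^esub> h) \<omega>"
proof -
  have gens: "finite_generating_set H S" and fin: "\<And>i. finite_index_normal (K i) H"
    and dist: "\<And>i x y. x \<in> carrier (H Mod K i) \<Longrightarrow> y \<in> carrier (H Mod K i) \<Longrightarrow>
      d (i, x) (i, y) = real (word_metric (H Mod K i) (quotient_generators H S (K i)) x y)"
    and gH: "group H"
    using box by (auto simp: box_space_def)
  interpret H: group H by (rule gH)
  have normal: "K i \<lhd> H" and finite: "finite (carrier (H Mod K i))" for i
    using fin[of i] by (auto simp: finite_index_normal_def FactGroup_def)
  have SH: "S \<subseteq> carrier H" and finS: "finite S" using gens by (auto simp: finite_generating_set_def)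
  obtain V :: "(real, 'v) module" and ip f \<rho> \<rho>' where V: "real_hilbert_space V ip"
    and f: "f \<in> box_points H K \<rightarrow> carrier V" and \<rho>: "control_function \<rho>" "control_function \<rho>'"
    and bounds: "\<And>p q. p \<in> box_points H K \<Longrightarrow> q \<in> box_points H K \<Longrightarrow>
      \<rho> (d p q) \<le> sqrt (ip (f p \<ominus>\<^bsub>V\<^esub> f q) (f p \<ominus>\<^bsub>V\<^esub> f q)) \<and>
      sqrt (ip (f p \<ominus>\<^bsub>V\<^esub> f q) (f p \<ominus>\<^bsub>V\<^esub> f q)) \<le> \<rho>' (d p q)"
    using emb unfolding coarsely_embeds_into_hilbert_def by blast
  interpret V: real_hilbert_space V ip by (rule V)
  define \<delta> where "\<delta> i x y = sqrt (ip (f (i, x) \<ominus>\<^bsub>V\<^esub> f (i, y)) (f (i, x) \<ominus>\<^bsub>V\<^esub> f (i, y)))" for i x y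
  have fV: "f (i, x) \<in> carrier V" if "x \<in> carrier (H Mod K i)" for i x
    using f that by (auto simp: box_points_def)
  have "\<exists>\<omega>. cut_kernel (carrier (H Mod K i)) \<omega> \<and>
      (\<forall>x\<in>carrier (H Mod K i). \<forall>y\<in>carrier (H Mod K i). \<delta> i x y / 2 - 1 \<le> \<omega> x y \<and> \<omega> x y \<le> \<delta> i x y + 1)" for i
    unfolding \<delta>_def by (rule cut_kernel_approximates_euclidean[OF finite V.euclidean_kernel_norm[OF finite fV]])
  then obtain \<omega> where \<omega>: "\<And>i. cut_kernel (carrier (H Mod K i)) (\<omega> i)"
    "\<And>i x y. x \<in> carrier (H Mod K i) \<Longrightarrow> y \<in> carrier (H Mod K i) \<Longrightarrow>
       \<delta> i x y / 2 - 1 \<le> \<omega> i x y \<and> \<omega> i x y \<le> \<delta> i x y + 1"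
    by metis
  let ?wm = "\<lambda>i. word_metric (H Mod K i) (quotient_generators H S (K i))"
  have bd: "\<rho> (real (?wm i x y)) \<le> \<delta> i x y" "\<delta> i x y \<le> \<rho>' (real (?wm i x y))"
    if "x \<in> carrier (H Mod K i)" "y \<in> carrier (H Mod K i)" for i x y
    using bounds[of "(i, x)" "(i, y)"] that dist[OF that] by (auto simp: \<delta>_def box_points_def)
  have le_iff: "?wm i x y \<le> n \<longleftrightarrow> (\<exists>w\<in>word_ball H S n. y = x \<otimes>\<^bsub>H Mod K i\<^esub> (K i #>\<^bsub>H\<^esub> w))"
    if c: "x \<in> carrier (H Mod K i)" "y \<in> carrier (H Mod K i)" for i x y n
  proof -
    interpret normal "K i" H by (rule normal)
    obtain a b where ab: "a \<in> carrier H" "b \<in> carrier H" "x = K i #>\<^bsub>H\<^esub> a" "y = K i #>\<^bsub>H\<^esub> b"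
      using c by (auto simp: carrier_FactGroup)
    have "x \<otimes>\<^bsub>H Mod K i\<^esub> (K i #>\<^bsub>H\<^esub> w) = K i #>\<^bsub>H\<^esub> (a \<otimes>\<^bsub>H\<^esub> w)" if "w \<in> word_ball H S n" for w
      using ab that H.word_ball_closed[OF SH] by (simp add: rcos_sum subset_iff)
    then show ?thesis
      using word_metric_FactGroup_le_iff[OF gens ab(1,2), of n] ab by simp
  qed
  have mult_mem: "q \<otimes>\<^bsub>H Mod K i\<^esub> (K i #>\<^bsub>H\<^esub> w) \<in> carrier (H Mod K i)"
    if "q \<in> carrier (H Mod K i)" "w \<in> carrier H" for i q w
  proof -
    interpret Q: group "H Mod K i" by (rule normal.factorgroup_is_group[OF normal])
    show ?thesis by (rule Q.m_closed[OF that(1)]) (use that(2) in \<open>simp add: carrier_FactGroup\<close>)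
  qed
  have "controlled_kernels H (\<lambda>i. H Mod K i) (\<lambda>i h. K i #>\<^bsub>H\<^esub> h) \<omega>"
    unfolding controlled_kernels_def
  proof (intro conjI ballI allI)
    fix w assume w: "w \<in> carrier H"
    obtain N where N: "w \<in> word_ball H S N"
      using H.finite_subset_word_ball[OF gens, of "{w}"] w by auto
    have "\<omega> i q (q \<otimes>\<^bsub>H Mod K i\<^esub> (K i #>\<^bsub>H\<^esub> w)) \<le> \<rho>' (real N) + 1" if q: "q \<in> carrier (H Mod K i)" for i q
    proof -
      let ?r = "q \<otimes>\<^bsub>H Mod K i\<^esub> (K i #>\<^bsub>H\<^esub> w)"
      have r: "?r \<in> carrier (H Mod K i)" by (rule mult_mem[OF q w])
      have "?wm i q ?r \<le> N" using le_iff[OF q r] N by blast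
      then have "\<rho>' (real (?wm i q ?r)) \<le> \<rho>' (real N)"
        using \<rho>(2) by (auto simp: control_function_def intro: mono_onD)
      then show ?thesis using bd(2)[OF q r] \<omega>(2)[OF q r] by linarith
    qed
    then show "\<exists>C. \<forall>i. \<forall>q\<in>carrier (H Mod K i). \<omega> i q (q \<otimes>\<^bsub>H Mod K i\<^esub> (K i #>\<^bsub>H\<^esub> w)) \<le> C" by blast
  next
    fix C :: real
    have "eventually (\<lambda>t. 2 * C + 3 \<le> \<rho> t) at_top"
      using \<rho>(1) by (auto simp: control_function_def filterlim_at_top)
    then obtain t where t: "\<And>s. t \<le> s \<Longrightarrow> 2 * C + 3 \<le> \<rho> s" by (auto simp: eventually_at_top_linorder)
    define N where "N = nat \<lceil>t\<rceil>"
    have "\<exists>w\<in>word_ball H S N. r = q \<otimes>\<^bsub>H Mod K i\<^esub> (K i #>\<^bsub>H\<^esub> w)"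
      if q: "q \<in> carrier (H Mod K i)" and r: "r \<in> carrier (H Mod K i)" and le: "\<omega> i q r \<le> C" for i q r
    proof -
      have "\<rho> (real (?wm i q r)) < 2 * C + 3" using bd(1)[OF q r] \<omega>(2)[OF q r] le by linarith
      then have "\<not> t \<le> real (?wm i q r)" using t by fastforce
      then have "?wm i q r \<le> N" unfolding N_def by linarith
      then show ?thesis using le_iff[OF q r] by blast
    qed
    then show "\<exists>F\<subseteq>carrier H. finite F \<and> (\<forall>i. \<forall>q\<in>carrier (H Mod K i). \<forall>r\<in>carrier (H Mod K i).
        \<omega> i q r \<le> C \<longrightarrow> (\<exists>w\<in>F. r = q \<otimes>\<^bsub>H Mod K i\<^esub> (K i #>\<^bsub>H\<^esub> w)))"
      using H.word_ball_closed[OF SH, of N] H.finite_word_ball[OF finS, of N] by blast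
  qed
  then show ?thesis using \<omega>(1) by blast
qed

section \<open>Finitely generated abelian groups are residually finite\<close>

text \<open>The homomorphism from the free abelian group of exponents on \<open>S\<close> onto the subgroup generated by \<open>S\<close>.\<close>

definition power_product :: "('a, 'm) monoid_scheme \<Rightarrow> 'a set \<Rightarrow> ('a \<Rightarrow> int) \<Rightarrow> 'a" where
  "power_product G S e = finprod G (\<lambda>s. s [^]\<^bsub>G\<^esub> e s) S"

context comm_group
begin

context
  fixes S assumes S: "finite S" "S \<subseteq> carrier G"
begin

lemma power_in_carrier: "(\<lambda>s. s [^] (e s :: int)) \<in> S \<rightarrow> carrier G"
  using S by (auto intro!: int_pow_closed)

lemma power_product_closed: "power_product G S e \<in> carrier G"
  unfolding power_product_def by (rule finprod_closed[OF power_in_carrier])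

lemma power_product_cong: "(\<And>s. s \<in> S \<Longrightarrow> e s = e' s) \<Longrightarrow> power_product G S e = power_product G S e'"
  unfolding power_product_def using power_in_carrier[of e'] by (intro finprod_cong') auto

lemma power_product_add: "power_product G S (\<lambda>s. e s + e' s) = power_product G S e \<otimes> power_product G S e'"
proof -
  have "power_product G S (\<lambda>s. e s + e' s) = finprod G (\<lambda>s. s [^] e s \<otimes> s [^] e' s) S"
    unfolding power_product_def
    by (intro finprod_cong') (use S in \<open>auto simp: int_pow_mult intro!: m_closed int_pow_closed\<close>)
  also have "\<dots> = power_product G S e \<otimes> power_product G S e'"
    unfolding power_product_def by (rule finprod_multf[OF power_in_carrier power_in_carrier])
  finally show ?thesis .
qed

lemma power_product_zero: "power_product G S (\<lambda>s. 0) = \<one>"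
  unfolding power_product_def by (simp add: finprod_one)

lemma power_product_delta:
  assumes "s \<in> S"
  shows "power_product G S (\<lambda>t. if s = t then k else 0) = s [^] k"
proof -
  have "power_product G S (\<lambda>t. if s = t then k else 0) = finprod G (\<lambda>t. if s = t then t [^] k else \<one>) S"
    unfolding power_product_def
    by (intro finprod_cong') (use S in \<open>auto intro!: int_pow_closed\<close>)
  also have "\<dots> = s [^] k"
    by (rule finprod_singleton[OF assms S(1) power_in_carrier])
  finally show ?thesis .
qed

lemma generate_power_product:
  assumes "g \<in> generate G S"
  shows "\<exists>e. g = power_product G S e"
  using assms
proof (induction rule: generate.induct)
  case one
  then show ?case using power_product_zero by metis
next
  case (incl s)
  then have "s = power_product G S (\<lambda>t. if s = t then 1 else 0)"
    using power_product_delta[of s 1] S by (simp add: subset_iff)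
  then show ?case by (intro exI[of _ "\<lambda>t. if s = t then 1 else 0"])
next
  case (inv s)
  then have "inv s = power_product G S (\<lambda>t. if s = t then - 1 else 0)"
    using power_product_delta[of s "- 1"] S by (simp add: subset_iff int_pow_neg)
  then show ?case by (intro exI[of _ "\<lambda>t. if s = t then - 1 else 0"])
next
  case (eng h1 h2)
  then show ?case using power_product_add by metis
qed

lemma power_product_scale:
  "power_product G S (\<lambda>s. int m * e s) = power_product G S e [^] m"
proof (induction m)
  case 0 then show ?case by (simp add: power_product_zero)
next
  case (Suc m)
  have "power_product G S (\<lambda>s. int (Suc m) * e s) = power_product G S (\<lambda>s. int m * e s + e s)"
    by (rule power_product_cong) (simp add: algebra_simps)
  then show ?case using Suc by (simp add: power_product_add)
qed

end

lemma maximal_subgroup_avoiding: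
  assumes "g \<in> carrier G" "g \<noteq> \<one>"
  shows "\<exists>N. subgroup N G \<and> g \<notin> N \<and> (\<forall>M. subgroup M G \<longrightarrow> g \<notin> M \<longrightarrow> N \<subseteq> M \<longrightarrow> M = N)"
proof -
  define \<A> where "\<A> = {N. subgroup N G \<and> g \<notin> N}"
  have "\<exists>N\<in>\<A>. \<forall>M\<in>\<A>. N \<subseteq> M \<longrightarrow> M = N"
  proof (rule subset_Zorn_nonempty)
    show "\<A> \<noteq> {}" using triv_subgroup assms(2) by (auto simp: \<A>_def)
    fix \<C> assume ne: "\<C> \<noteq> {}" and ch: "subset.chain \<A> \<C>"
    have sub: "subgroup N G" "g \<notin> N" if "N \<in> \<C>" for N
      using ch that by (auto simp: subset.chain_def \<A>_def)
    have "subgroup (\<Union>\<C>) G"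
    proof (rule subgroupI)
      show "\<Union>\<C> \<subseteq> carrier G" using subgroup.subset[OF sub(1)] by auto
      show "\<Union>\<C> \<noteq> {}" using ne subgroup.one_closed[OF sub(1)] by auto
      show "inv x \<in> \<Union>\<C>" if x: "x \<in> \<Union>\<C>" for x
      proof -
        obtain M where "M \<in> \<C>" "x \<in> M" using x by auto
        then have "inv x \<in> M" using subgroup.m_inv_closed[OF sub(1)] by simp
        then show ?thesis using \<open>M \<in> \<C>\<close> by auto
      qed
      fix x y assume "x \<in> \<Union>\<C>" "y \<in> \<Union>\<C>"
      then obtain M N where MN: "M \<in> \<C>" "N \<in> \<C>" "x \<in> M" "y \<in> N" by auto
      then have "M \<subseteq> N \<or> N \<subseteq> M" using ch unfolding subset.chain_def by blast
      then obtain L where L: "L \<in> \<C>" "x \<in> L" "y \<in> L" using MN by auto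
      then have "x \<otimes> y \<in> L" using subgroup.m_closed[OF sub(1)] by simp
      then show "x \<otimes> y \<in> \<Union>\<C>" using L(1) by auto
    qed
    then show "\<Union>\<C> \<in> \<A>" using sub(2) by (auto simp: \<A>_def)
  qed
  then show ?thesis unfolding \<A>_def by blast
qed

text \<open>If no positive power of \<open>x\<close> lies in \<open>N\<close>, then by maximality \<open>g\<close> lies in the subgroup generated by \<open>N\<close>
  and any positive power of \<open>x\<close>.  For \<open>x\<close> itself this writes \<open>g\<close>, modulo \<open>N\<close>, as \<open>x\<^sup>a\<close> with \<open>a \<noteq> 0\<close>; for the
  power with exponent \<open>2\<bar>a\<bar>\<close> it writes \<open>g\<close> as a power of \<open>x\<close> whose exponent is a multiple of \<open>2a\<close>.
  The two exponents differ, and \<open>x\<close> to their difference lies in \<open>N\<close>.\<close>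

lemma torsion_modulo_maximal_subgroup:
  assumes N: "subgroup N G" "g \<notin> N"
    and max: "\<And>M. subgroup M G \<Longrightarrow> g \<notin> M \<Longrightarrow> N \<subseteq> M \<Longrightarrow> M = N"
    and x: "x \<in> carrier G"
  shows "\<exists>k>0. x [^] (k::nat) \<in> N"
proof (rule ccontr)
  assume "\<not> ?thesis"
  then have no: "x [^] (k::nat) \<notin> N" if "k > 0" for k using that by blast
  interpret N: subgroup N G by (rule N(1))
  have adjoin: "\<exists>n\<in>N. \<exists>a::int. g = n \<otimes> y [^] a" if y: "y \<in> carrier G" "y \<notin> N" for y
  proof (rule ccontr)
    assume not: "\<not> ?thesis"
    define M where "M = {n \<otimes> y [^] (a::int) |n a. n \<in> N}"
    have "subgroup M G"
    proof (rule subgroupI)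
      show "M \<subseteq> carrier G" using y N.subset by (auto simp: M_def)
      show "M \<noteq> {}" using N.one_closed unfolding M_def by blast
      show "inv u \<in> M" if uM: "u \<in> M" for u
      proof -
        obtain n a where u: "u = n \<otimes> y [^] (a::int)" "n \<in> N" using uM by (auto simp: M_def)
        then have "inv u = inv n \<otimes> y [^] (- a)"
          using y N.mem_carrier by (simp add: inv_mult int_pow_neg)
        then show ?thesis using u N.m_inv_closed unfolding M_def by blast
      qed
      fix u v assume "u \<in> M" "v \<in> M"
      then obtain n a n' a' where uv: "u = n \<otimes> y [^] (a::int)" "n \<in> N" "v = n' \<otimes> y [^] (a'::int)" "n' \<in> N"
        by (auto simp: M_def)
      have "u \<otimes> v = (n \<otimes> n') \<otimes> y [^] (a + a')"
        using uv y N.mem_carrier by (simp add: int_pow_mult m_ac)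
      then show "u \<otimes> v \<in> M" using uv N.m_closed unfolding M_def by blast
    qed
    moreover have "g \<notin> M" using not by (auto simp: M_def)
    moreover have "N \<subseteq> M"
    proof
      fix n assume "n \<in> N"
      then have "n = n \<otimes> y [^] (0::int)" using N.mem_carrier by simp
      then show "n \<in> M" using \<open>n \<in> N\<close> unfolding M_def by blast
    qed
    ultimately have "M = N" by (rule max)
    moreover have "y = \<one> \<otimes> y [^] (1::int)" using y by simp
    then have "y \<in> M" using N.one_closed unfolding M_def by blast
    ultimately show False using y by simp
  qed
  have "x \<notin> N" using no[of 1] x by simp
  then obtain n a where na: "n \<in> N" "g = n \<otimes> x [^] (a::int)" using adjoin[OF x] by blast
  have "a \<noteq> 0"
  proof
    assume "a = 0"
    then have "g = n" using na N.mem_carrier by simp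
    then show False using na N(2) by simp
  qed
  \<comment> \<open>The factor 2 makes the exponent a of g no multiple of the exponent of y.\<close>
  define y where "y = x [^] nat (2 * \<bar>a\<bar>)"
  have "y \<notin> N" unfolding y_def by (rule no) (use \<open>a \<noteq> 0\<close> in simp)
  moreover have "y \<in> carrier G" using x by (simp add: y_def)
  ultimately obtain n' b where nb: "n' \<in> N" "g = n' \<otimes> y [^] (b::int)" using adjoin by blast
  have "y = x [^] (2 * \<bar>a\<bar>)" unfolding y_def by (simp add: int_pow_int[symmetric])
  then have yb: "y [^] b = x [^] (2 * \<bar>a\<bar> * b)" using x by (simp add: int_pow_pow)
  define m where "m = a - 2 * \<bar>a\<bar> * b"
  have "m \<noteq> 0"
  proof
    assume "m = 0"
    then have "\<bar>a\<bar> = \<bar>2 * \<bar>a\<bar> * b\<bar>" by (simp add: m_def)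
    also have "\<dots> = \<bar>a\<bar> * (2 * \<bar>b\<bar>)" by (simp add: abs_mult)
    finally have "2 * \<bar>b\<bar> = 1" using \<open>a \<noteq> 0\<close> by simp
    then show False by presburger
  qed
  have "n \<otimes> x [^] a = n' \<otimes> x [^] (2 * \<bar>a\<bar> * b)" using na nb yb by simp
  moreover have "x [^] a = x [^] m \<otimes> x [^] (2 * \<bar>a\<bar> * b)"
    using x by (simp add: m_def flip: int_pow_mult)
  ultimately have "(n \<otimes> x [^] m) \<otimes> x [^] (2 * \<bar>a\<bar> * b) = n' \<otimes> x [^] (2 * \<bar>a\<bar> * b)"
    using na nb x N.mem_carrier by (simp add: m_assoc)
  then have "n \<otimes> x [^] m = n'" using na nb x N.mem_carrier by simp
  then have "x [^] m = inv n \<otimes> n'" using na nb x N.mem_carrier by (metis inv_solve_left int_pow_closed)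
  then have mN: "x [^] m \<in> N" using na nb N.m_closed N.m_inv_closed by simp
  have "x [^] nat \<bar>m\<bar> \<in> N"
  proof (cases "m \<ge> 0")
    case True then show ?thesis using mN by (simp add: int_pow_int[symmetric])
  next
    case False
    then have "x [^] nat \<bar>m\<bar> = inv (x [^] m)" using x by (simp add: int_pow_int[symmetric] int_pow_neg)
    then show ?thesis using mN N.m_inv_closed by simp
  qed
  then show False using no[of "nat \<bar>m\<bar>"] \<open>m \<noteq> 0\<close> by simp
qed

text \<open>Modulo a subgroup maximal among those avoiding \<open>g\<close> all generators are torsion, so for a common
  multiple \<open>m\<close> of their orders all \<open>m\<close>-th powers lie in that subgroup.\<close>

lemma separating_exponent:
  assumes S: "finite S" "S \<subseteq> carrier G" "generate G S = carrier G"
    and g: "g \<in> carrier G" "g \<noteq> \<one>"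
  shows "\<exists>m>0. \<forall>x\<in>carrier G. x [^] (m::nat) \<noteq> g"
proof -
  obtain N where N: "subgroup N G" "g \<notin> N"
    and max: "\<And>M. subgroup M G \<Longrightarrow> g \<notin> M \<Longrightarrow> N \<subseteq> M \<Longrightarrow> M = N"
    using maximal_subgroup_avoiding[OF g] by blast
  interpret N: subgroup N G by (rule N(1))
  have "\<forall>s\<in>S. \<exists>k>0. s [^] (k::nat) \<in> N"
    using torsion_modulo_maximal_subgroup[OF N max] S(2) by blast
  then obtain k where k: "\<And>s. s \<in> S \<Longrightarrow> k s > 0 \<and> s [^] (k s :: nat) \<in> N" by metis
  define m where "m = (\<Prod>s\<in>S. k s)"
  have powN: "y [^] (l::nat) \<in> N" if "y \<in> N" for y l
    by (induction l) (use that N.m_closed N.one_closed in auto)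
  have mS: "s [^] m \<in> N" if s: "s \<in> S" for s
  proof -
    have "m = k s * (\<Prod>s\<in>S - {s}. k s)" unfolding m_def by (rule prod.remove[OF S(1) s])
    moreover have "s \<in> carrier G" using s S(2) by blast
    ultimately have "s [^] m = (s [^] k s) [^] (\<Prod>s\<in>S - {s}. k s)" by (simp add: nat_pow_pow)
    then show ?thesis using powN k[OF s] by simp
  qed
  have "x [^] m \<in> N" if "x \<in> generate G S" for x
    using that
  proof (induction rule: generate.induct)
    case one then show ?case by simp
  next
    case (incl h) then show ?case by (rule mS)
  next
    case (inv h)
    moreover from this have "h \<in> carrier G" using S(2) by blast
    ultimately show ?case using mS[of h] N.m_inv_closed by (simp add: nat_pow_inv)
  next
    case (eng h1 h2)
    then have "h1 \<in> carrier G" "h2 \<in> carrier G" using S(3) by auto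
    then show ?case using eng.IH N.m_closed by (simp add: nat_pow_distrib)
  qed
  then have "\<forall>x\<in>carrier G. x [^] m \<noteq> g" using S(3) N(2) by blast
  moreover have "m > 0" unfolding m_def by (rule prod_pos) (use k in blast)
  ultimately show ?thesis by blast
qed

definition power_subgroup :: "nat \<Rightarrow> 'a set" where
  "power_subgroup m = (\<lambda>x. x [^] m) ` carrier G"

lemma subgroup_power_subgroup: "subgroup (power_subgroup m) G"
proof (rule subgroupI)
  show "power_subgroup m \<subseteq> carrier G" by (auto simp: power_subgroup_def)
  show "power_subgroup m \<noteq> {}" using one_closed by (auto simp: power_subgroup_def)
  show "inv y \<in> power_subgroup m" if y: "y \<in> power_subgroup m" for y
  proof -
    obtain x where "x \<in> carrier G" "y = x [^] m" using y by (auto simp: power_subgroup_def)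
    then have "inv y = (inv x) [^] m" "inv x \<in> carrier G" by (simp_all add: nat_pow_inv)
    then show ?thesis unfolding power_subgroup_def by blast
  qed
  fix u v assume "u \<in> power_subgroup m" "v \<in> power_subgroup m"
  then obtain x y where "x \<in> carrier G" "y \<in> carrier G" "u = x [^] m" "v = y [^] m"
    by (auto simp: power_subgroup_def)
  then have "u \<otimes> v = (x \<otimes> y) [^] m" "x \<otimes> y \<in> carrier G" by (simp_all add: nat_pow_distrib)
  then show "u \<otimes> v \<in> power_subgroup m" unfolding power_subgroup_def by blast
qed

lemma power_subgroup_mult: "power_subgroup (m * k) \<subseteq> power_subgroup m"
proof
  fix y assume "y \<in> power_subgroup (m * k)"
  then obtain x where "x \<in> carrier G" "y = x [^] (m * k)" by (auto simp: power_subgroup_def)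
  then have "y = (x [^] k) [^] m" "x [^] k \<in> carrier G" by (simp_all add: nat_pow_pow mult.commute)
  then show "y \<in> power_subgroup m" unfolding power_subgroup_def by blast
qed

text \<open>Exponents of the generators only matter modulo \<open>m\<close>.\<close>

lemma finite_index_power_subgroup:
  assumes S: "finite S" "S \<subseteq> carrier G" "generate G S = carrier G" and m: "m > 0"
  shows "finite_index_normal (power_subgroup m) G"
proof -
  let ?N = "power_subgroup m"
  interpret N: subgroup ?N G by (rule subgroup_power_subgroup)
  have normal: "?N \<lhd> G" by (rule subgroup_imp_normal[OF subgroup_power_subgroup])
  have "rcosets ?N \<subseteq> (\<lambda>e. ?N #> power_product G S e) ` (S \<rightarrow>\<^sub>E {0..<int m})"
  proof
    fix c assume "c \<in> rcosets ?N"
    then obtain x where x: "x \<in> carrier G" "c = ?N #> x" by (auto simp: RCOSETS_def)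
    then obtain e where e: "x = power_product G S e"
      using generate_power_product[OF S(1,2)] S(3) by blast
    define e1 where "e1 = (\<lambda>s\<in>S. e s mod int m)"
    define z where "z = power_product G S (\<lambda>s. e s div int m)"
    have z: "z \<in> carrier G" unfolding z_def by (rule power_product_closed[OF S(1,2)])
    have y: "power_product G S e1 \<in> carrier G" by (rule power_product_closed[OF S(1,2)])
    have "x = power_product G S (\<lambda>s. int m * (e s div int m) + e1 s)"
      unfolding e by (rule power_product_cong[OF S(1,2)]) (simp add: e1_def)
    also have "\<dots> = z [^] m \<otimes> power_product G S e1"
      by (simp only: power_product_add[OF S(1,2)] power_product_scale[OF S(1,2)] z_def)
    finally have "x \<in> ?N #> power_product G S e1"
      using z unfolding r_coset_def power_subgroup_def by blast
    then have "?N #> power_product G S e1 = c"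
      using repr_independence[OF _ y subgroup_power_subgroup] x by simp
    moreover have "e1 \<in> S \<rightarrow>\<^sub>E {0..<int m}" using m by (auto simp: e1_def)
    ultimately show "c \<in> (\<lambda>e. ?N #> power_product G S e) ` (S \<rightarrow>\<^sub>E {0..<int m})" by blast
  qed
  moreover have "finite (S \<rightarrow>\<^sub>E {0..<int m})" using S(1) by (intro finite_PiE) auto
  ultimately have "finite (rcosets ?N)" by (meson finite_imageI finite_subset)
  then show ?thesis using normal by (simp add: finite_index_normal_def)
qed

text \<open>The subgroups of \<open>i!\<close>-th powers are nested, and since every \<open>m\<close> divides \<open>m!\<close>, the chain separates
  from the identity every element that is not an \<open>m\<close>-th power for some \<open>m\<close>.\<close>

lemma residual_chain:
  assumes S: "finite S" "S \<subseteq> carrier G" "generate G S = carrier G"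
  shows "\<exists>N. (\<forall>i::nat. finite_index_normal (N i) G) \<and> (\<forall>i. N (Suc i) \<subseteq> N i) \<and> (\<Inter>i. N i) = {\<one>}"
proof (intro exI conjI allI)
  let ?N = "\<lambda>i. power_subgroup (fact i)"
  show "finite_index_normal (?N i) G" for i by (rule finite_index_power_subgroup[OF S]) simp
  show "?N (Suc i) \<subseteq> ?N i" for i using power_subgroup_mult[of "fact i" "Suc i"] by (simp add: mult.commute)
  show "(\<Inter>i. ?N i) = {\<one>}"
  proof
    show "{\<one>} \<subseteq> (\<Inter>i. ?N i)" using subgroup.one_closed[OF subgroup_power_subgroup] by auto
    show "(\<Inter>i. ?N i) \<subseteq> {\<one>}"
    proof
      fix g assume g: "g \<in> (\<Inter>i. ?N i)"
      show "g \<in> {\<one>}"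
      proof (rule ccontr)
        assume "g \<notin> {\<one>}"
        moreover have "g \<in> carrier G" using g subgroup.subset[OF subgroup_power_subgroup[of "fact 0"]] by blast
        ultimately obtain m where m: "m > 0" "\<And>x. x \<in> carrier G \<Longrightarrow> x [^] (m::nat) \<noteq> g"
          using separating_exponent[OF S, of g] by auto
        have "m dvd fact m" using m(1) by (intro dvd_fact) auto
        then obtain q where "fact m = m * q" by (auto simp: dvd_def)
        moreover have "g \<in> power_subgroup (fact m)" using g by blast
        ultimately have "g \<in> power_subgroup m" using power_subgroup_mult[of m q] by (metis subsetD)
        then show False using m(2) by (auto simp: power_subgroup_def)
      qed
    qed
  qed
qed

end

section \<open>Controlled kernels on the quotients of an abelian group\<close>

lemma sum_card_fibres_le:
  assumes "finite A" "finite Y"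
  shows "(\<Sum>C\<in>Y. real (card {e\<in>A. \<phi> e = C})) \<le> real (card A)"
proof -
  have "(\<Sum>C\<in>Y. card {e\<in>A. \<phi> e = C}) = card (\<Union>C\<in>Y. {e\<in>A. \<phi> e = C})"
    using assms by (intro card_UN_disjoint[symmetric]) auto
  also have "\<dots> \<le> card A" by (rule card_mono) (use assms in auto)
  finally show ?thesis by (simp flip: of_nat_sum)
qed

lemma sum_card_fibres:
  assumes "finite A" "finite Y" "\<phi> ` A \<subseteq> Y"
  shows "(\<Sum>C\<in>Y. real (card {e\<in>A. \<phi> e = C})) = real (card A)"
proof -
  have "(\<Sum>C\<in>Y. card {e\<in>A. \<phi> e = C}) = card (\<Union>C\<in>Y. {e\<in>A. \<phi> e = C})"
    using assms by (intro card_UN_disjoint[symmetric]) auto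
  also have "(\<Union>C\<in>Y. {e\<in>A. \<phi> e = C}) = A" using assms by auto
  finally show ?thesis by (simp flip: of_nat_sum)
qed

text \<open>The \<open>\<ell>\<^sup>1\<close>-distance of the push-forwards of two counting measures under \<open>\<phi>\<close> is at most that of the
  measures themselves.  The bound does not depend on \<open>\<phi>\<close>, hence not on the quotient to which it maps.\<close>

lemma sum_fibre_difference_le:
  assumes "finite A" "finite B" "finite Y"
  shows "(\<Sum>C\<in>Y. \<bar>real (card {e\<in>A. \<phi> e = C}) - real (card {e\<in>B. \<phi> e = C})\<bar>)
    \<le> real (card (A - B)) + real (card (B - A))"
proof -
  have split: "real (card {e\<in>A. \<phi> e = C}) \<le> real (card {e\<in>B. \<phi> e = C}) + real (card {e\<in>A - B. \<phi> e = C})"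
    if "finite A" "finite B" for A B :: "'a set" and C
  proof -
    have "card {e\<in>A. \<phi> e = C} \<le> card ({e\<in>B. \<phi> e = C} \<union> {e\<in>A - B. \<phi> e = C})"
      by (rule card_mono) (use that in auto)
    also have "\<dots> \<le> card {e\<in>B. \<phi> e = C} + card {e\<in>A - B. \<phi> e = C}" by (rule card_Un_le)
    finally show ?thesis by simp
  qed
  have "(\<Sum>C\<in>Y. \<bar>real (card {e\<in>A. \<phi> e = C}) - real (card {e\<in>B. \<phi> e = C})\<bar>)
    \<le> (\<Sum>C\<in>Y. real (card {e\<in>A - B. \<phi> e = C}) + real (card {e\<in>B - A. \<phi> e = C}))"
  proof (rule sum_mono)
    fix C
    show "\<bar>real (card {e\<in>A. \<phi> e = C}) - real (card {e\<in>B. \<phi> e = C})\<bar>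
      \<le> real (card {e\<in>A - B. \<phi> e = C}) + real (card {e\<in>B - A. \<phi> e = C})"
      using split[OF assms(1,2), of C] split[OF assms(2,1), of C] by linarith
  qed
  also have "\<dots> \<le> real (card (A - B)) + real (card (B - A))"
    unfolding sum.distrib using assms by (intro add_mono sum_card_fibres_le) auto
  finally show ?thesis .
qed

text \<open>The Folner sets of the free abelian group of exponents.\<close>

definition exponent_box :: "'a set \<Rightarrow> nat \<Rightarrow> ('a \<Rightarrow> int) set" where
  "exponent_box S L = S \<rightarrow>\<^sub>E {0..<int L}"

definition shift_exponents :: "'a set \<Rightarrow> ('a \<Rightarrow> int) \<Rightarrow> ('a \<Rightarrow> int) \<Rightarrow> ('a \<Rightarrow> int)" where
  "shift_exponents S v e = (\<lambda>s\<in>S. e s + v s)"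

lemma finite_exponent_box: "finite S \<Longrightarrow> finite (exponent_box S L)"
  unfolding exponent_box_def by (intro finite_PiE) auto

lemma card_exponent_box: "finite S \<Longrightarrow> card (exponent_box S L) = L ^ card S"
  unfolding exponent_box_def by (simp add: card_PiE)

text \<open>Stated without division: the slice has density \<open>card (X \<inter> {0..<int L}) / L\<close> in the box.\<close>

lemma card_box_slice:
  assumes S: "finite S" "s \<in> S"
  shows "card {e \<in> exponent_box S L. e s \<in> X} * L \<le> card (X \<inter> {0..<int L}) * card (exponent_box S L)"
proof -
  have "{e \<in> exponent_box S L. e s \<in> X} = (\<Pi>\<^sub>E t\<in>S. if t = s then X \<inter> {0..<int L} else {0..<int L})"
    (is "?A = ?B")
  proof (intro equalityI subsetI)
    fix e assume "e \<in> ?A"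
    then show "e \<in> ?B" by (auto simp: exponent_box_def PiE_iff)
  next
    fix e assume e: "e \<in> ?B"
    have "e t \<in> {0..<int L}" if "t \<in> S" for t
      using PiE_mem[OF e that] by (simp split: if_splits)
    moreover have "e s \<in> X" using PiE_mem[OF e S(2)] by simp
    moreover have "e \<in> extensional S" using e by (simp add: PiE_iff)
    ultimately show "e \<in> ?A" by (simp add: exponent_box_def PiE_iff)
  qed
  then have "card {e \<in> exponent_box S L. e s \<in> X} = (\<Prod>t\<in>S. card (if t = s then X \<inter> {0..<int L} else {0..<int L}))"
    using S(1) by (simp add: card_PiE)
  also have "\<dots> = card (X \<inter> {0..<int L}) * (\<Prod>t\<in>S - {s}. card (if t = s then X \<inter> {0..<int L} else {0..<int L}))"
    by (subst prod.remove[OF S]) simp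
  also have "(\<Prod>t\<in>S - {s}. card (if t = s then X \<inter> {0..<int L} else {0..<int L})) = (\<Prod>t\<in>S - {s}. L)"
    by (intro prod.cong) auto
  also have "\<dots> = L ^ (card S - 1)" using S by simp
  finally show ?thesis
    using card_gt_0_iff[of S] S by (cases "card S") (auto simp: card_exponent_box)
qed

text \<open>A point of the box outside its translate has a coordinate \<open>s\<close> among the at most \<open>\<bar>v s\<bar>\<close> values that the
  shift vacates; sum the densities of these slices.\<close>

lemma card_box_minus_shift:
  assumes S: "finite S" and L: "L > 0"
  shows "real (card (exponent_box S L - shift_exponents S v ` exponent_box S L))
    \<le> (\<Sum>s\<in>S. \<bar>real_of_int (v s)\<bar>) / real L * real (card (exponent_box S L))"
proof -
  let ?B = "exponent_box S L"
  \<comment> \<open>X s is the set of the values of the coordinate s that have left the box after shifting back by v.\<close>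
  define X where "X s = {k. k - v s \<notin> {0..<int L}}" for s
  have "?B - shift_exponents S v ` ?B \<subseteq> (\<Union>s\<in>S. {e \<in> ?B. e s \<in> X s})"
  proof
    fix e assume e: "e \<in> ?B - shift_exponents S v ` ?B"
    show "e \<in> (\<Union>s\<in>S. {e \<in> ?B. e s \<in> X s})"
    proof (rule ccontr)
      assume no: "e \<notin> (\<Union>s\<in>S. {e \<in> ?B. e s \<in> X s})"
      have "e s - v s \<in> {0..<int L}" if "s \<in> S" for s
        using no e that by (auto simp: X_def)
      then have "(\<lambda>s\<in>S. e s - v s) \<in> ?B" unfolding exponent_box_def by (intro restrict_PiE_iff[THEN iffD2]) auto
      moreover have "e = shift_exponents S v (\<lambda>s\<in>S. e s - v s)"
      proof
        fix s show "e s = shift_exponents S v (\<lambda>s\<in>S. e s - v s) s"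
          using e by (cases "s \<in> S") (auto simp: shift_exponents_def exponent_box_def PiE_iff extensional_def)
      qed
      ultimately have "e \<in> shift_exponents S v ` ?B" by blast
      then show False using e by blast
    qed
  qed
  then have "card (?B - shift_exponents S v ` ?B) \<le> card (\<Union>s\<in>S. {e \<in> ?B. e s \<in> X s})"
    by (intro card_mono) (use S finite_exponent_box[OF S] in auto)
  also have "\<dots> \<le> (\<Sum>s\<in>S. card {e \<in> ?B. e s \<in> X s})" by (rule card_UN_le[OF S])
  finally have "real (card (?B - shift_exponents S v ` ?B)) \<le> (\<Sum>s\<in>S. real (card {e \<in> ?B. e s \<in> X s}))"
    by (simp flip: of_nat_sum)
  also have "\<dots> \<le> (\<Sum>s\<in>S. \<bar>real_of_int (v s)\<bar> / real L * real (card ?B))"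
  proof (rule sum_mono)
    fix s assume s: "s \<in> S"
    have "card (X s \<inter> {0..<int L}) \<le> card (if v s \<ge> 0 then {0..<v s} else {int L + v s..<int L})"
      by (rule card_mono) (auto simp: X_def)
    then have "real (card (X s \<inter> {0..<int L})) \<le> \<bar>real_of_int (v s)\<bar>" by (auto split: if_splits)
    moreover have "real (card {e \<in> ?B. e s \<in> X s}) * real L \<le> real (card (X s \<inter> {0..<int L})) * real (card ?B)"
      using card_box_slice[OF S s, of L "X s"] by (simp flip: of_nat_mult)
    ultimately have "real (card {e \<in> ?B. e s \<in> X s}) * real L \<le> \<bar>real_of_int (v s)\<bar> * real (card ?B)"
      by (meson mult_right_mono of_nat_0_le_iff order_trans)
    then show "real (card {e \<in> ?B. e s \<in> X s}) \<le> \<bar>real_of_int (v s)\<bar> / real L * real (card ?B)"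
      using L by (simp add: field_simps)
  qed
  also have "\<dots> = (\<Sum>s\<in>S. \<bar>real_of_int (v s)\<bar>) / real L * real (card ?B)"
    by (simp add: sum_distrib_right sum_divide_distrib)
  finally show ?thesis .
qed

lemma sqrt_difference_square_le: "0 \<le> a \<Longrightarrow> 0 \<le> b \<Longrightarrow> (sqrt a - sqrt b)\<^sup>2 \<le> \<bar>a - b\<bar>"
proof -
  assume ab: "0 \<le> a" "0 \<le> b"
  have "\<bar>sqrt a - sqrt b\<bar> * \<bar>sqrt a - sqrt b\<bar> \<le> \<bar>sqrt a - sqrt b\<bar> * \<bar>sqrt a + sqrt b\<bar>"
    by (rule mult_left_mono) (use ab real_sqrt_ge_zero[of a] real_sqrt_ge_zero[of b] in linarith)+
  also have "\<dots> = \<bar>(sqrt a - sqrt b) * (sqrt a + sqrt b)\<bar>" by (simp add: abs_mult)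
  also have "(sqrt a - sqrt b) * (sqrt a + sqrt b) = a - b" using ab by (simp add: algebra_simps)
  finally show ?thesis by (simp add: power2_eq_square)
qed

text \<open>\<open>P n i q\<close> is the push-forward to \<open>Q\<^sub>i\<close> of the uniform measure on the \<open>n\<close>-th box, translated by \<open>q\<close>, and
  \<open>t n i\<close> is the squared distance of the square roots of two such measures, which is at most their
  \<open>\<ell>\<^sup>1\<close>-distance.  A fixed \<open>w\<close> moves the \<open>n\<close>-th measure by at most a constant multiple of \<open>2\<^sup>-\<^sup>n\<close>, so the
  sum over \<open>n\<close> is bounded.  Conversely, a summand below 2 means
  that the two measures are not disjoint, so \<open>q\<close> and \<open>r\<close> differ by a quotient of two elements of the
  box.  The sum stops at \<open>n = i\<close> to be finite; for \<open>i\<close> smaller than the number of summands that are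
  needed, representatives of all the elements of \<open>Q\<^sub>i\<close> are put into the finite set.\<close>

lemma abelian_controlled_kernels:
  fixes G :: "('a, 'm) monoid_scheme" and Q :: "nat \<Rightarrow> ('q, 'l) monoid_scheme"
  assumes "comm_group G" and gens: "finite_generating_set G S"
    and Q: "\<And>i. group (Q i)" and finQ: "\<And>i. finite (carrier (Q i))"
    and hom: "\<And>i. \<theta> i \<in> hom G (Q i)" and onto: "\<And>i. \<theta> i ` carrier G = carrier (Q i)"
  shows "\<exists>\<kappa>. (\<forall>i. euclidean_kernel (carrier (Q i)) (\<kappa> i)) \<and> controlled_kernels G Q \<theta> \<kappa>"
proof -
  interpret comm_group G by fact
  interpret Q: group "Q i" for i by (rule Q)
  have S: "finite S" "S \<subseteq> carrier G" "generate G S = carrier G"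
    using gens by (auto simp: finite_generating_set_def)
  note ppc = power_product_closed[OF S(1,2)]
  have \<theta>c: "\<theta> i x \<in> carrier (Q i)" if "x \<in> carrier G" for i x
    using hom that by (auto simp: hom_def)
  have \<theta>m: "\<theta> i (x \<otimes>\<^bsub>G\<^esub> y) = \<theta> i x \<otimes>\<^bsub>Q i\<^esub> \<theta> i y" if "x \<in> carrier G" "y \<in> carrier G" for i x y
    using hom_mult[OF hom that] .
  define B where "B n = exponent_box S (2 ^ n)" for n
  have finB: "finite (B n)" for n unfolding B_def by (rule finite_exponent_box[OF S(1)])
  have cardB: "real (card (B n)) > 0" for n unfolding B_def by (simp add: card_exponent_box[OF S(1)])
  define P where "P n i q C = real (card {e \<in> B n. q \<otimes>\<^bsub>Q i\<^esub> \<theta> i (power_product G S e) = C}) / real (card (B n))" for n i q C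
  have Pnn: "0 \<le> P n i q C" for n i q C by (simp add: P_def)
  define t where "t n i q r = (\<Sum>C\<in>carrier (Q i). (sqrt (P n i q C) - sqrt (P n i r C))\<^sup>2)" for n i q r
  have tnn: "0 \<le> t n i q r" for n i q r unfolding t_def by (simp add: sum_nonneg)
  define \<kappa> where "\<kappa> i q r = (\<Sum>n\<le>i. t n i q r)" for i q r
  have euclid: "euclidean_kernel (carrier (Q i)) (\<kappa> i)" for i
    unfolding \<kappa>_def
    by (intro euclidean_kernel_sum finite_atMost)
       (rule euclidean_kernelI[OF finQ[of i], where a = "\<lambda>C q. sqrt (P _ i q C)"], simp add: t_def)
  have "controlled_kernels G Q \<theta> \<kappa>"
    unfolding controlled_kernels_def
  proof (intro conjI ballI allI)
    fix w assume w: "w \<in> carrier G"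
    then obtain v where v: "w = power_product G S v"
      using generate_power_product[OF S(1,2)] S(3) by blast
    define V where "V = (\<Sum>s\<in>S. \<bar>real_of_int (v s)\<bar>)"
    have "V \<ge> 0" by (simp add: V_def sum_nonneg)
    have t_le: "t n i q (q \<otimes>\<^bsub>Q i\<^esub> \<theta> i w) \<le> 2 * V * (1 / 2) ^ n" if q: "q \<in> carrier (Q i)" for n i q
    proof -
      let ?sh = "shift_exponents S v"
      define \<phi> where "\<phi> e = q \<otimes>\<^bsub>Q i\<^esub> \<theta> i (power_product G S e)" for e
      have inj: "inj_on ?sh (B n)"
      proof (rule inj_onI)
        fix e e' assume e: "e \<in> B n" "e' \<in> B n" "?sh e = ?sh e'"
        have "e s = e' s" if "s \<in> S" for s
          using fun_cong[OF e(3), of s] that by (simp add: shift_exponents_def)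
        then show "e = e'" using e(1,2) unfolding B_def exponent_box_def by (intro PiE_ext) auto
      qed
      have \<phi>sh: "\<phi> (?sh e) = q \<otimes>\<^bsub>Q i\<^esub> \<theta> i w \<otimes>\<^bsub>Q i\<^esub> \<theta> i (power_product G S e)" for e
      proof -
        have "power_product G S (?sh e) = power_product G S (\<lambda>s. v s + e s)"
          by (rule power_product_cong[OF S(1,2)]) (simp add: shift_exponents_def)
        also have "\<dots> = w \<otimes>\<^bsub>G\<^esub> power_product G S e"
          by (simp only: power_product_add[OF S(1,2)] v)
        finally show ?thesis
          using q w ppc[of e] \<theta>c by (simp add: \<phi>_def \<theta>m Q.m_assoc)
      qed
      have "card {e \<in> B n. q \<otimes>\<^bsub>Q i\<^esub> \<theta> i w \<otimes>\<^bsub>Q i\<^esub> \<theta> i (power_product G S e) = C} = card {e \<in> ?sh ` B n. \<phi> e = C}" for C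
      proof -
        have "{e \<in> ?sh ` B n. \<phi> e = C} = ?sh ` {e \<in> B n. \<phi> (?sh e) = C}" by auto
        moreover have "inj_on ?sh {e \<in> B n. \<phi> (?sh e) = C}" by (rule inj_on_subset[OF inj]) auto
        ultimately show ?thesis using card_image[of ?sh "{e \<in> B n. \<phi> (?sh e) = C}"] by (simp add: \<phi>sh)
      qed
      then have P': "P n i (q \<otimes>\<^bsub>Q i\<^esub> \<theta> i w) C = real (card {e \<in> ?sh ` B n. \<phi> e = C}) / real (card (B n))" for C
        by (simp add: P_def)
      have "t n i q (q \<otimes>\<^bsub>Q i\<^esub> \<theta> i w) \<le> (\<Sum>C\<in>carrier (Q i). \<bar>P n i q C - P n i (q \<otimes>\<^bsub>Q i\<^esub> \<theta> i w) C\<bar>)"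
        unfolding t_def by (intro sum_mono sqrt_difference_square_le Pnn)
      also have "\<dots> = (\<Sum>C\<in>carrier (Q i). \<bar>real (card {e \<in> B n. \<phi> e = C}) - real (card {e \<in> ?sh ` B n. \<phi> e = C})\<bar>) / real (card (B n))"
        unfolding sum_divide_distrib P' by (intro sum.cong refl) (simp add: P_def \<phi>_def flip: diff_divide_distrib)
      also have "\<dots> \<le> (real (card (B n - ?sh ` B n)) + real (card (?sh ` B n - B n))) / real (card (B n))"
        by (intro divide_right_mono sum_fibre_difference_le finB finite_imageI finQ) simp
      also have "card (?sh ` B n - B n) = card (B n - ?sh ` B n)"
      proof -
        have "card (?sh ` B n - B n) = card (?sh ` B n) - card (?sh ` B n \<inter> B n)"
          by (rule card_Diff_subset_Int) (use finB in auto)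
        moreover have "card (B n - ?sh ` B n) = card (B n) - card (B n \<inter> ?sh ` B n)"
          by (rule card_Diff_subset_Int) (use finB in auto)
        ultimately show ?thesis using card_image[OF inj] by (simp add: Int_commute)
      qed
      also have "(real (card (B n - ?sh ` B n)) + real (card (B n - ?sh ` B n))) / real (card (B n)) \<le> 2 * V * (1 / 2) ^ n"
      proof -
        have "real (card (B n - ?sh ` B n)) \<le> V / real (2 ^ n) * real (card (B n))"
          unfolding B_def V_def by (rule card_box_minus_shift[OF S(1)]) simp
        then show ?thesis using cardB[of n] by (simp add: field_simps power_divide)
      qed
      finally show ?thesis .
    qed
    have "\<kappa> i q (q \<otimes>\<^bsub>Q i\<^esub> \<theta> i w) \<le> 4 * V" if q: "q \<in> carrier (Q i)" for i q
    proof -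
      have "\<kappa> i q (q \<otimes>\<^bsub>Q i\<^esub> \<theta> i w) \<le> (\<Sum>n\<le>i. 2 * V * (1 / 2) ^ n)"
        unfolding \<kappa>_def by (rule sum_mono) (rule t_le[OF q])
      also have "\<dots> = 2 * V * (\<Sum>n\<le>i. (1 / 2) ^ n)" by (rule sum_distrib_left[symmetric])
      also have "\<dots> \<le> 2 * V * 2"
      proof (rule mult_left_mono)
        have "(\<Sum>n\<le>i. (1 / 2 :: real) ^ n) = 2 - (1 / 2) ^ i" by (induction i) auto
        then show "(\<Sum>n\<le>i. (1 / 2 :: real) ^ n) \<le> 2" by simp
      qed (use \<open>V \<ge> 0\<close> in simp)
      finally show ?thesis by simp
    qed
    then show "\<exists>C. \<forall>i. \<forall>q\<in>carrier (Q i). \<kappa> i q (q \<otimes>\<^bsub>Q i\<^esub> \<theta> i w) \<le> C" by blast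
  next
    fix C :: real
    define N where "N = nat \<lceil>C\<rceil> + 1"
    have N: "C < 2 * real N" unfolding N_def using real_nat_ceiling_ge[of C] by simp
    have "\<forall>i. \<exists>R. R \<subseteq> carrier G \<and> finite R \<and> carrier (Q i) = \<theta> i ` R"
      using finite_subset_image[OF finQ] onto by (metis order_refl)
    then obtain R where R: "\<And>i. R i \<subseteq> carrier G" "\<And>i. finite (R i)" "\<And>i. carrier (Q i) = \<theta> i ` R i" by metis
    \<comment> \<open>The first part handles the finitely many quotients with i < N, the second the others.\<close>
    define F where "F = (\<Union>i<N. R i) \<union> (\<Union>n<N. (\<lambda>(e, e'). power_product G S e \<otimes>\<^bsub>G\<^esub> inv\<^bsub>G\<^esub> power_product G S e') ` (B n \<times> B n))"
    have F: "F \<subseteq> carrier G" "finite F" unfolding F_def using R finB ppc by auto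
    have "\<exists>w\<in>F. r = q \<otimes>\<^bsub>Q i\<^esub> \<theta> i w"
      if q: "q \<in> carrier (Q i)" and r: "r \<in> carrier (Q i)" and le: "\<kappa> i q r \<le> C" for i q r
    proof (cases "i < N")
      case True
      have "inv\<^bsub>Q i\<^esub> q \<otimes>\<^bsub>Q i\<^esub> r \<in> \<theta> i ` R i" using q r R(3)[of i, symmetric] by simp
      then obtain w where w: "w \<in> R i" "inv\<^bsub>Q i\<^esub> q \<otimes>\<^bsub>Q i\<^esub> r = \<theta> i w" by blast
      have "r = q \<otimes>\<^bsub>Q i\<^esub> (inv\<^bsub>Q i\<^esub> q \<otimes>\<^bsub>Q i\<^esub> r)" using q r by (simp flip: Q.m_assoc)
      then have "r = q \<otimes>\<^bsub>Q i\<^esub> \<theta> i w" by (simp only: w)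
      moreover have "w \<in> F" using w True unfolding F_def by blast
      ultimately show ?thesis by blast
    next
      case False
      have "\<exists>n<N. t n i q r < 2"
      proof (rule ccontr)
        assume "\<not> ?thesis"
        then have "\<And>n. n < N \<Longrightarrow> 2 \<le> t n i q r" by force
        then have "(\<Sum>n<N. 2) \<le> (\<Sum>n<N. t n i q r)" by (intro sum_mono) auto
        also have "\<dots> \<le> \<kappa> i q r" unfolding \<kappa>_def
          by (rule sum_mono2) (use False tnn in auto)
        finally show False using le N by simp
      qed
      then obtain n where n: "n < N" "t n i q r < 2" by blast
      have total: "(\<Sum>C\<in>carrier (Q i). P n i p C) = 1" if p: "p \<in> carrier (Q i)" for p
      proof -
        have "(\<Sum>C\<in>carrier (Q i). real (card {e \<in> B n. p \<otimes>\<^bsub>Q i\<^esub> \<theta> i (power_product G S e) = C})) = real (card (B n))"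
          by (rule sum_card_fibres[OF finB finQ]) (use p \<theta>c ppc in auto)
        then show ?thesis using cardB[of n] by (simp add: P_def flip: sum_divide_distrib)
      qed
      have "\<exists>D\<in>carrier (Q i). P n i q D \<noteq> 0 \<and> P n i r D \<noteq> 0"
      proof (rule ccontr)
        assume no: "\<not> ?thesis"
        have "t n i q r = (\<Sum>C\<in>carrier (Q i). P n i q C + P n i r C)"
          unfolding t_def
        proof (intro sum.cong refl)
          fix D assume "D \<in> carrier (Q i)"
          then have "P n i q D = 0 \<or> P n i r D = 0" using no by blast
          then show "(sqrt (P n i q D) - sqrt (P n i r D))\<^sup>2 = P n i q D + P n i r D"
            using Pnn[of n i q D] Pnn[of n i r D] by auto
        qed
        then show False using n(2) total[OF q] total[OF r] by (simp add: sum.distrib)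
      qed
      then obtain D where D: "P n i q D \<noteq> 0" "P n i r D \<noteq> 0" by blast
      have "{e \<in> B n. q \<otimes>\<^bsub>Q i\<^esub> \<theta> i (power_product G S e) = D} \<noteq> {}"
        using D(1) unfolding P_def by (metis card.empty div_0 of_nat_0)
      moreover have "{e \<in> B n. r \<otimes>\<^bsub>Q i\<^esub> \<theta> i (power_product G S e) = D} \<noteq> {}"
        using D(2) unfolding P_def by (metis card.empty div_0 of_nat_0)
      ultimately obtain e e' where e: "e \<in> B n" "q \<otimes>\<^bsub>Q i\<^esub> \<theta> i (power_product G S e) = D"
        "e' \<in> B n" "r \<otimes>\<^bsub>Q i\<^esub> \<theta> i (power_product G S e') = D" by blast
      let ?x = "power_product G S e" and ?y = "power_product G S e'"
      interpret \<theta>: group_hom G "Q i" "\<theta> i"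
        by (rule group_hom.intro[OF is_group Q group_hom_axioms.intro[OF hom]])
      have "r = q \<otimes>\<^bsub>Q i\<^esub> \<theta> i (?x \<otimes>\<^bsub>G\<^esub> inv\<^bsub>G\<^esub> ?y)"
      proof -
        have "r = D \<otimes>\<^bsub>Q i\<^esub> inv\<^bsub>Q i\<^esub> \<theta> i ?y"
          unfolding e(4)[symmetric] using r \<theta>c[OF ppc] by (simp add: Q.m_assoc)
        also have "\<dots> = q \<otimes>\<^bsub>Q i\<^esub> \<theta> i (?x \<otimes>\<^bsub>G\<^esub> inv\<^bsub>G\<^esub> ?y)"
          unfolding e(2)[symmetric] using q \<theta>c[OF ppc] ppc by (simp add: Q.m_assoc)
        finally show ?thesis .
      qed
      moreover have "?x \<otimes>\<^bsub>G\<^esub> inv\<^bsub>G\<^esub> ?y \<in> F"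
      proof -
        have "?x \<otimes>\<^bsub>G\<^esub> inv\<^bsub>G\<^esub> ?y \<in> (\<lambda>(e, e'). power_product G S e \<otimes>\<^bsub>G\<^esub> inv\<^bsub>G\<^esub> power_product G S e') ` (B n \<times> B n)"
          by (rule image_eqI[of _ _ "(e, e')"]) (use e in auto)
        then show ?thesis unfolding F_def using n(1) by (intro UnI2 UN_I[of n]) auto
      qed
      ultimately show ?thesis by (rule rev_bexI[rotated])
    qed
    then show "\<exists>F\<subseteq>carrier G. finite F \<and> (\<forall>i. \<forall>q\<in>carrier (Q i). \<forall>r\<in>carrier (Q i).
        \<kappa> i q r \<le> C \<longrightarrow> (\<exists>w\<in>F. r = q \<otimes>\<^bsub>Q i\<^esub> \<theta> i w))"
      using F by blast
  qed
  then show ?thesis using euclid by blast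
qed

section \<open>Finite quotients of the wreath product\<close>

lemma (in comm_monoid) gfinprod_reindex:
  assumes inj: "inj_on \<tau> A" and f: "f \<in> \<tau> ` A \<rightarrow> carrier G"
  shows "gfinprod G f (\<tau> ` A) = gfinprod G (\<lambda>x. f (\<tau> x)) A"
proof -
  let ?B = "{x \<in> A. f (\<tau> x) \<noteq> \<one>}"
  have img: "{y \<in> \<tau> ` A. f y \<noteq> \<one>} = \<tau> ` ?B" by auto
  have injB: "inj_on \<tau> ?B" by (rule inj_on_subset[OF inj]) auto
  have "finprod G f (\<tau> ` ?B) = finprod G (\<lambda>x. f (\<tau> x)) ?B"
    by (rule finprod_reindex[OF _ injB]) (use f in auto)
  then show ?thesis unfolding gfinprod_def img finite_image_iff[OF injB] by simp
qed

text \<open>Normality of \<open>M\<close> lets the translation pass through the coset representatives.\<close>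

lemma (in group) translate_coset:
  assumes M: "M \<lhd> G" and h: "h \<in> carrier G" and c: "c \<in> carrier G"
  shows "(\<lambda>z. inv h \<otimes> z) ` (M #> c) = M #> (inv h \<otimes> c)"
proof -
  interpret M: normal M G by (rule M)
  show ?thesis
  proof (intro equalityI subsetI)
    fix y assume "y \<in> (\<lambda>z. inv h \<otimes> z) ` (M #> c)"
    then obtain m where m: "m \<in> M" "y = inv h \<otimes> (m \<otimes> c)" unfolding r_coset_def by blast
    have mc: "m \<in> carrier G" using m(1) by (rule M.mem_carrier)
    have "y = (inv h \<otimes> m \<otimes> h) \<otimes> (inv h \<otimes> c)"
    proof -
      have "h \<otimes> (inv h \<otimes> c) = c" using h c by (simp flip: m_assoc)
      then show ?thesis using m(2) mc h c by (simp add: m_assoc)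
    qed
    moreover have "inv h \<otimes> m \<otimes> h \<in> M" by (rule M.inv_op_closed1[OF h m(1)])
    ultimately show "y \<in> M #> (inv h \<otimes> c)" unfolding r_coset_def by blast
  next
    fix y assume "y \<in> M #> (inv h \<otimes> c)"
    then obtain m where m: "m \<in> M" "y = m \<otimes> (inv h \<otimes> c)" unfolding r_coset_def by blast
    have mc: "m \<in> carrier G" using m(1) by (rule M.mem_carrier)
    have "y = inv h \<otimes> ((h \<otimes> m \<otimes> inv h) \<otimes> c)"
    proof -
      have "inv h \<otimes> (h \<otimes> m \<otimes> inv h \<otimes> c) = (inv h \<otimes> h) \<otimes> (m \<otimes> (inv h \<otimes> c))"
        using mc h c by (simp only: m_assoc inv_closed m_closed)
      then show ?thesis using m(2) mc h c by simp
    qed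
    moreover have "h \<otimes> m \<otimes> inv h \<in> M" by (rule M.inv_op_closed2[OF h m(1)])
    ultimately show "y \<in> (\<lambda>z. inv h \<otimes> z) ` (M #> c)" unfolding r_coset_def by blast
  qed
qed

locale wreath_quotient =
  G: comm_group G + H: group H
  for G :: "('a, 'm) monoid_scheme" and H :: "('b, 'n) monoid_scheme" +
  fixes N :: "'a set" and M :: "'b set"
  assumes N_index: "finite_index_normal N G" and M_index: "finite_index_normal M H"
begin

lemma normal_N: "N \<lhd> G" and normal_M: "M \<lhd> H"
  using N_index M_index by (simp_all add: finite_index_normal_def)

lemma finite_G_quotient: "finite (carrier (G Mod N))" and finite_H_quotient: "finite (carrier (H Mod M))"
  using N_index M_index by (simp_all add: finite_index_normal_def FactGroup_def)

lemma group_G_quotient: "group (G Mod N)" and group_H_quotient: "group (H Mod M)"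
  by (rule normal.factorgroup_is_group[OF normal_N] normal.factorgroup_is_group[OF normal_M])+

abbreviation W :: "(('b set \<Rightarrow> 'a set) \<times> 'b set) monoid" where "W \<equiv> (G Mod N) \<wr> (H Mod M)"

text \<open>A lamp of the quotient collects the lamps over one coset of \<open>M\<close>.  The generalised product
  \<^const>\<open>gfinprod\<close> is used since the cosets may be infinite while the supports are finite.\<close>

definition proj :: "('b \<Rightarrow> 'a) \<times> 'b \<Rightarrow> ('b set \<Rightarrow> 'a set) \<times> 'b set" where
  "proj x = (\<lambda>C\<in>carrier (H Mod M). N #>\<^bsub>G\<^esub> gfinprod G (fst x) C, M #>\<^bsub>H\<^esub> snd x)"

lemma group_W: "group W"
  by (rule wreath_group[OF group_G_quotient group_H_quotient])

lemma carrier_W: "carrier W = (carrier (H Mod M) \<rightarrow>\<^sub>E carrier (G Mod N)) \<times> carrier (H Mod M)"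
  using wreath_simps(1)[OF group_G_quotient, of "H Mod M"] finite_H_quotient by simp

lemma finite_W: "finite (carrier W)"
  unfolding carrier_W using finite_G_quotient finite_H_quotient by (intro finite_cartesian_product finite_PiE) auto

lemma coset_subset: "C \<in> carrier (H Mod M) \<Longrightarrow> C \<subseteq> carrier H"
  using normal_imp_subgroup[OF normal_M] subgroup.subset H.r_coset_subset_G
  unfolding carrier_FactGroup by blast

lemma wreath_carrierD:
  assumes "x \<in> carrier (G \<wr> H)"
  shows "fst x \<in> carrier H \<rightarrow> carrier G" "finite {z \<in> carrier H. fst x z \<noteq> \<one>\<^bsub>G\<^esub>}" "snd x \<in> carrier H"
  using assms by (auto simp: wreath_simps[OF G.is_group])

lemma coset_product_closed:
  assumes "f \<in> carrier H \<rightarrow> carrier G" "C \<in> carrier (H Mod M)"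
  shows "gfinprod G f C \<in> carrier G"
proof (rule G.gfinprod_closed)
  show "f \<in> C \<rightarrow> carrier G" using assms(1) coset_subset[OF assms(2)] by (auto simp: Pi_iff subset_iff)
qed

lemma proj_closed: "x \<in> carrier (G \<wr> H) \<Longrightarrow> proj x \<in> carrier W"
  unfolding carrier_W proj_def using wreath_carrierD[of x] coset_product_closed[of "fst x"]
  by (auto simp: carrier_FactGroup)

lemma coset_product_translate:
  assumes f: "f \<in> carrier H \<rightarrow> carrier G" and h: "h \<in> carrier H" and C: "C \<in> carrier (H Mod M)"
  shows "gfinprod G (\<lambda>z. f (inv\<^bsub>H\<^esub> h \<otimes>\<^bsub>H\<^esub> z)) C = gfinprod G f (inv\<^bsub>H Mod M\<^esub> (M #>\<^bsub>H\<^esub> h) \<otimes>\<^bsub>H Mod M\<^esub> C)"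
proof -
  interpret Q: group "H Mod M" by (rule group_H_quotient)
  interpret q: group_hom H "H Mod M" "\<lambda>a. M #>\<^bsub>H\<^esub> a"
    by unfold_locales (rule normal.r_coset_hom_Mod[OF normal_M])
  obtain c where c: "c \<in> carrier H" "C = M #>\<^bsub>H\<^esub> c" using C by (auto simp: carrier_FactGroup)
  have eq: "inv\<^bsub>H Mod M\<^esub> (M #>\<^bsub>H\<^esub> h) \<otimes>\<^bsub>H Mod M\<^esub> C = (\<lambda>z. inv\<^bsub>H\<^esub> h \<otimes>\<^bsub>H\<^esub> z) ` C"
    unfolding c(2) H.translate_coset[OF normal_M h c(1)] using h c(1)
    by (simp only: q.hom_inv[symmetric] q.hom_mult[symmetric] H.inv_closed)
  show ?thesis unfolding eq
  proof (rule G.gfinprod_reindex[symmetric])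
    show "inj_on (\<lambda>z. inv\<^bsub>H\<^esub> h \<otimes>\<^bsub>H\<^esub> z) C"
      using coset_subset[OF C] h by (intro inj_onI) (auto simp: subset_iff)
    show "f \<in> (\<lambda>z. inv\<^bsub>H\<^esub> h \<otimes>\<^bsub>H\<^esub> z) ` C \<rightarrow> carrier G"
      using coset_subset[OF C] h f by (auto simp: subset_iff Pi_iff)
  qed
qed

text \<open>Commutativity of \<open>G\<close> enters here: the product of \<open>f z \<otimes> f' (h\<^sup>-\<^sup>1 z)\<close> over a coset splits into two
  products, and the second is the lamp of the quotient at the translated coset.\<close>

lemma proj_hom: "proj \<in> hom (G \<wr> H) W"
proof (rule homI)
  fix x assume "x \<in> carrier (G \<wr> H)"
  then show "proj x \<in> carrier W" by (rule proj_closed)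
next
  fix x y assume x: "x \<in> carrier (G \<wr> H)" and y: "y \<in> carrier (G \<wr> H)"
  interpret Q: group "H Mod M" by (rule group_H_quotient)
  interpret W: group "G \<wr> H" by (rule wreath_group[OF G.is_group H.is_group])
  obtain f h f' h' where xy: "x = (f, h)" "y = (f', h')" by fastforce
  have f: "f \<in> carrier H \<rightarrow> carrier G" "finite {z \<in> carrier H. f z \<noteq> \<one>\<^bsub>G\<^esub>}" "h \<in> carrier H"
    and f': "f' \<in> carrier H \<rightarrow> carrier G" "finite {z \<in> carrier H. f' z \<noteq> \<one>\<^bsub>G\<^esub>}" "h' \<in> carrier H"
    using wreath_carrierD[OF x] wreath_carrierD[OF y] by (simp_all add: xy)
  let ?g = "\<lambda>z. f' (inv\<^bsub>H\<^esub> h \<otimes>\<^bsub>H\<^esub> z)"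
  have g: "?g \<in> carrier H \<rightarrow> carrier G" using f'(1) f(3) by (auto simp: Pi_iff)
  have finite_g: "finite {z \<in> carrier H. ?g z \<noteq> \<one>\<^bsub>G\<^esub>}"
  proof (rule finite_imageD)
    show "finite ((\<lambda>z. inv\<^bsub>H\<^esub> h \<otimes>\<^bsub>H\<^esub> z) ` {z \<in> carrier H. ?g z \<noteq> \<one>\<^bsub>G\<^esub>})"
      by (rule finite_subset[OF _ f'(2)]) (use f(3) in auto)
    show "inj_on (\<lambda>z. inv\<^bsub>H\<^esub> h \<otimes>\<^bsub>H\<^esub> z) {z \<in> carrier H. ?g z \<noteq> \<one>\<^bsub>G\<^esub>}"
      using f(3) by (auto simp: inj_on_def)
  qed
  have "gfinprod G (\<lambda>z\<in>carrier H. f z \<otimes>\<^bsub>G\<^esub> ?g z) C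
      = gfinprod G f C \<otimes>\<^bsub>G\<^esub> gfinprod G f' (inv\<^bsub>H Mod M\<^esub> (M #>\<^bsub>H\<^esub> h) \<otimes>\<^bsub>H Mod M\<^esub> C)"
    if C: "C \<in> carrier (H Mod M)" for C
  proof -
    have sub: "C \<subseteq> carrier H" by (rule coset_subset[OF C])
    have "gfinprod G (\<lambda>z\<in>carrier H. f z \<otimes>\<^bsub>G\<^esub> ?g z) C = gfinprod G (\<lambda>z. f z \<otimes>\<^bsub>G\<^esub> ?g z) C"
    proof (rule G.gfinprod_cong[OF refl])
      show "(\<lambda>z\<in>carrier H. f z \<otimes>\<^bsub>G\<^esub> ?g z) \<in> C \<rightarrow> carrier G"
        using sub f(1) g by (auto simp: Pi_iff subset_iff)
    qed (use sub in \<open>auto simp: simp_implies_def\<close>)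
    also have "\<dots> = gfinprod G f C \<otimes>\<^bsub>G\<^esub> gfinprod G ?g C"
    proof (rule G.gfinprod_distrib)
      show "finite {z \<in> C. f z \<noteq> \<one>\<^bsub>G\<^esub>}" by (rule finite_subset[OF _ f(2)]) (use sub in auto)
      show "finite {z \<in> C. ?g z \<noteq> \<one>\<^bsub>G\<^esub>}" by (rule finite_subset[OF _ finite_g]) (use sub in auto)
      show "f \<in> C \<rightarrow> carrier G" using f(1) sub by auto
      show "?g \<in> C \<rightarrow> carrier G" using g sub by (intro Pi_I) (auto simp: Pi_iff subset_iff)
    qed
    also have "gfinprod G ?g C = gfinprod G f' (inv\<^bsub>H Mod M\<^esub> (M #>\<^bsub>H\<^esub> h) \<otimes>\<^bsub>H Mod M\<^esub> C)"
      by (rule coset_product_translate[OF f'(1) f(3) C])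
    finally show ?thesis .
  qed
  note product = this
  have Mh: "M #>\<^bsub>H\<^esub> h \<in> carrier (H Mod M)" using f(3) by (simp add: carrier_FactGroup)
  have "proj (x \<otimes>\<^bsub>G \<wr> H\<^esub> y) = (\<lambda>C\<in>carrier (H Mod M). N #>\<^bsub>G\<^esub> gfinprod G (\<lambda>z\<in>carrier H. f z \<otimes>\<^bsub>G\<^esub> ?g z) C, M #>\<^bsub>H\<^esub> (h \<otimes>\<^bsub>H\<^esub> h'))"
    by (simp add: proj_def xy wreath_simps[OF G.is_group])
  also have "\<dots> = proj x \<otimes>\<^bsub>W\<^esub> proj y"
    unfolding proj_def xy fst_conv snd_conv wreath_simps(2)[OF group_G_quotient]
  proof (rule arg_cong2[of _ _ _ _ Pair])
    show "M #>\<^bsub>H\<^esub> (h \<otimes>\<^bsub>H\<^esub> h') = (M #>\<^bsub>H\<^esub> h) \<otimes>\<^bsub>H Mod M\<^esub> (M #>\<^bsub>H\<^esub> h')"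
      using normal.rcos_sum[OF normal_M f(3) f'(3)] by simp
    show "(\<lambda>C\<in>carrier (H Mod M). N #>\<^bsub>G\<^esub> gfinprod G (\<lambda>z\<in>carrier H. f z \<otimes>\<^bsub>G\<^esub> ?g z) C) =
      (\<lambda>C\<in>carrier (H Mod M). (\<lambda>C\<in>carrier (H Mod M). N #>\<^bsub>G\<^esub> gfinprod G f C) C \<otimes>\<^bsub>G Mod N\<^esub>
         (\<lambda>C\<in>carrier (H Mod M). N #>\<^bsub>G\<^esub> gfinprod G f' C) (inv\<^bsub>H Mod M\<^esub> (M #>\<^bsub>H\<^esub> h) \<otimes>\<^bsub>H Mod M\<^esub> C))"
    proof (rule restrict_ext)
      fix C assume C: "C \<in> carrier (H Mod M)"
      have D: "inv\<^bsub>H Mod M\<^esub> (M #>\<^bsub>H\<^esub> h) \<otimes>\<^bsub>H Mod M\<^esub> C \<in> carrier (H Mod M)"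
        by (intro Q.m_closed Q.inv_closed Mh C)
      show "N #>\<^bsub>G\<^esub> gfinprod G (\<lambda>z\<in>carrier H. f z \<otimes>\<^bsub>G\<^esub> ?g z) C =
        (\<lambda>C\<in>carrier (H Mod M). N #>\<^bsub>G\<^esub> gfinprod G f C) C \<otimes>\<^bsub>G Mod N\<^esub>
         (\<lambda>C\<in>carrier (H Mod M). N #>\<^bsub>G\<^esub> gfinprod G f' C) (inv\<^bsub>H Mod M\<^esub> (M #>\<^bsub>H\<^esub> h) \<otimes>\<^bsub>H Mod M\<^esub> C)"
        using normal.rcos_sum[OF normal_N coset_product_closed[OF f(1) C] coset_product_closed[OF f'(1) D]]
        by (simp only: product[OF C] restrict_apply'[OF C] restrict_apply'[OF D]) (simp only: mult_FactGroup)
    qed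
  qed
  finally show "proj (x \<otimes>\<^bsub>G \<wr> H\<^esub> y) = proj x \<otimes>\<^bsub>W\<^esub> proj y" .
qed

lemma kernel_proj:
  "x \<in> kernel (G \<wr> H) W proj \<longleftrightarrow>
     x \<in> carrier (G \<wr> H) \<and> snd x \<in> M \<and> (\<forall>C\<in>carrier (H Mod M). gfinprod G (fst x) C \<in> N)"
proof (cases "x \<in> carrier (G \<wr> H)")
  case True
  note x = wreath_carrierD[OF True]
  have "proj x = \<one>\<^bsub>W\<^esub> \<longleftrightarrow> (\<forall>C\<in>carrier (H Mod M). N #>\<^bsub>G\<^esub> gfinprod G (fst x) C = N) \<and> M #>\<^bsub>H\<^esub> snd x = M"
    unfolding proj_def wreath_simps(3)[OF group_G_quotient] prod.inject one_FactGroup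
    by (auto simp: fun_eq_iff restrict_def split: if_splits)
  also have "M #>\<^bsub>H\<^esub> snd x = M \<longleftrightarrow> snd x \<in> M"
    using group.coset_join1[OF H.is_group, of M "snd x"] H.coset_join2[OF x(3) normal_imp_subgroup[OF normal_M]] x(3)
      normal_imp_subgroup[OF normal_M] by blast
  also have "(\<forall>C\<in>carrier (H Mod M). N #>\<^bsub>G\<^esub> gfinprod G (fst x) C = N) \<longleftrightarrow> (\<forall>C\<in>carrier (H Mod M). gfinprod G (fst x) C \<in> N)"
  proof (intro ball_cong refl)
    fix C assume "C \<in> carrier (H Mod M)"
    then have c: "gfinprod G (fst x) C \<in> carrier G" by (rule coset_product_closed[OF x(1)])
    show "N #>\<^bsub>G\<^esub> gfinprod G (fst x) C = N \<longleftrightarrow> gfinprod G (fst x) C \<in> N"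
      using G.coset_join1[OF _ c normal_imp_subgroup[OF normal_N]] G.coset_join2[OF c normal_imp_subgroup[OF normal_N]] by blast
  qed
  finally show ?thesis using True by (auto simp: kernel_def)
qed (simp add: kernel_def)

end

section \<open>Kernels on a wreath product from cuts of the base\<close>

text \<open>Up to the factor \<open>1/2\<close> this is the squared distance between the basis vectors indexed by \<open>u x\<close> and \<open>u y\<close>.\<close>

lemma euclidean_kernel_discrete:
  assumes "finite X"
  shows "euclidean_kernel X (\<lambda>x y. of_bool (u x \<noteq> u y))"
proof -
  have "of_bool (u x \<noteq> u y) = (\<Sum>v\<in>u ` X. 1 / 2 * (of_bool (u x = v) - of_bool (u y = v))\<^sup>2 :: real)"
    if "x \<in> X" "y \<in> X" for x y
  proof (cases "u x = u y")
    case False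
    have "(\<Sum>v\<in>u ` X. 1 / 2 * (of_bool (u x = v) - of_bool (u y = v))\<^sup>2 :: real)
      = (\<Sum>v\<in>{u x, u y}. 1 / 2 * (of_bool (u x = v) - of_bool (u y = v))\<^sup>2)"
      by (rule sum.mono_neutral_right) (use assms that in auto)
    then show ?thesis using False by simp
  qed simp
  moreover have "euclidean_kernel X (\<lambda>x y. \<Sum>v\<in>u ` X. 1 / 2 * (of_bool (u x = v) - of_bool (u y = v))\<^sup>2)"
  proof (rule euclidean_kernel_weighted_sum)
    fix v show "euclidean_kernel X (\<lambda>x y. (of_bool (u x = v) - of_bool (u y = v))\<^sup>2)"
      by (rule euclidean_kernelI[of "{()}" _ _ "\<lambda>_ x. of_bool (u x = v)"]) auto
  qed (use assms in auto)
  ultimately show ?thesis by (simp add: euclidean_kernel_def)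
qed

text \<open>What the set \<open>E\<close> sees of \<open>(f, h)\<close>: nothing if the lighter \<open>h\<close> is outside \<open>E\<close>, and otherwise all lamps
  outside \<open>E\<close>.\<close>

definition inside_view :: "'y set \<Rightarrow> 'y set \<Rightarrow> ('y \<Rightarrow> 'z) \<times> 'y \<Rightarrow> ('y \<Rightarrow> 'z) option" where
  "inside_view Y E x = (if snd x \<in> E then Some (restrict (fst x) (Y - E)) else None)"

lemma inside_view_eq_iff:
  "inside_view Y E (f, h) = inside_view Y E (f', h') \<longleftrightarrow>
     (h \<in> E \<longleftrightarrow> h' \<in> E) \<and> (h \<in> E \<longrightarrow> (\<forall>z\<in>Y - E. f z = f' z))"
proof -
  have "restrict f (Y - E) = restrict f' (Y - E) \<longleftrightarrow> (\<forall>z\<in>Y - E. f z = f' z)"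
    by (metis restrict_apply' restrict_ext)
  then show ?thesis by (simp add: inside_view_def)
qed

text \<open>Each cut contributes what it and its complement see, so that a lamp \<open>z\<close> with \<open>f z \<noteq> f' z\<close> is
  detected by every cut that separates \<open>h\<close> from \<open>z\<close>, no matter on which side \<open>h\<close> lies.  A cut
  that does not separate \<open>h\<close> from \<open>h'\<close> sees a difference at most once, and only if it separates \<open>h\<close>
  from some such lamp.\<close>

lemma wreath_kernel_of_cuts:
  fixes \<omega> :: "'y \<Rightarrow> 'y \<Rightarrow> real" and X :: "(('y \<Rightarrow> 'z) \<times> 'y) set"
  assumes "cut_kernel Y \<omega>" and "finite X" and "finite Y" and X: "X \<subseteq> UNIV \<times> Y"
  shows "\<exists>\<kappa>. euclidean_kernel X \<kappa> \<and>
    (\<forall>f h f' h'. (f, h) \<in> X \<longrightarrow> (f', h') \<in> X \<longrightarrow>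
       \<omega> h h' \<le> \<kappa> (f, h) (f', h') \<and>
       (\<forall>z\<in>Y. f z \<noteq> f' z \<longrightarrow> \<omega> h z \<le> \<kappa> (f, h) (f', h')) \<and>
       \<kappa> (f, h) (f', h') \<le> 2 * \<omega> h h' + (\<Sum>z\<in>{z\<in>Y. f z \<noteq> f' z}. \<omega> h z))"
proof -
  obtain J :: "(nat set \<times> int) set" and w E where J: "finite J" and w: "\<And>j. j \<in> J \<Longrightarrow> 0 \<le> w j"
    and \<omega>: "\<And>x y. x \<in> Y \<Longrightarrow> y \<in> Y \<Longrightarrow> \<omega> x y = (\<Sum>j\<in>J. w j * of_bool ((x \<in> E j) \<noteq> (y \<in> E j)))"
  proof -
    obtain J :: "(nat set \<times> int) set" and w E where "finite J \<and> (\<forall>j\<in>J. 0 \<le> w j) \<and>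
        (\<forall>x\<in>Y. \<forall>y\<in>Y. \<omega> x y = (\<Sum>j\<in>J. w j * of_bool ((x \<in> E j) \<noteq> (y \<in> E j))))"
      using assms(1) unfolding cut_kernel_def by blast
    then show ?thesis by (intro that[of J w E]) simp_all
  qed
  define \<sigma> where "\<sigma> E x y = (of_bool (inside_view Y E x \<noteq> inside_view Y E y)
      + of_bool (inside_view Y (- E) x \<noteq> inside_view Y (- E) y) :: real)" for E and x y :: "('y \<Rightarrow> 'z) \<times> 'y"
  define \<kappa> where "\<kappa> x y = (\<Sum>j\<in>J. w j * \<sigma> (E j) x y)" for x y
  have "euclidean_kernel X \<kappa>"
    unfolding \<kappa>_def \<sigma>_def
    by (intro euclidean_kernel_weighted_sum J w euclidean_kernel_add euclidean_kernel_discrete \<open>finite X\<close>)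
  moreover have "\<omega> h h' \<le> \<kappa> (f, h) (f', h')" "\<And>z. z \<in> Y \<Longrightarrow> f z \<noteq> f' z \<Longrightarrow> \<omega> h z \<le> \<kappa> (f, h) (f', h')"
    "\<kappa> (f, h) (f', h') \<le> 2 * \<omega> h h' + (\<Sum>z\<in>{z\<in>Y. f z \<noteq> f' z}. \<omega> h z)"
    if "(f, h) \<in> X" "(f', h') \<in> X" for f h f' h'
  proof -
    have h: "h \<in> Y" "h' \<in> Y" using that X by auto
    show "\<omega> h h' \<le> \<kappa> (f, h) (f', h')"
      unfolding \<omega>[OF h] \<kappa>_def
      by (intro sum_mono mult_left_mono w) (auto simp: \<sigma>_def inside_view_eq_iff)
    show "\<omega> h z \<le> \<kappa> (f, h) (f', h')" if z: "z \<in> Y" "f z \<noteq> f' z" for z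
      unfolding \<omega>[OF h(1) z(1)] \<kappa>_def
    proof (intro sum_mono mult_left_mono w)
      fix j
      show "of_bool ((h \<in> E j) \<noteq> (z \<in> E j)) \<le> \<sigma> (E j) (f, h) (f', h')"
        unfolding \<sigma>_def inside_view_eq_iff using z by auto
    qed
    let ?D = "{z\<in>Y. f z \<noteq> f' z}"
    have pointwise: "\<sigma> F (f, h) (f', h') \<le> 2 * of_bool ((h \<in> F) \<noteq> (h' \<in> F)) + (\<Sum>z\<in>?D. of_bool ((h \<in> F) \<noteq> (z \<in> F)))" for F
    proof (cases "(h \<in> F) = (h' \<in> F) \<and> \<sigma> F (f, h) (f', h') \<noteq> 0")
      case True
      then obtain z where z: "z \<in> ?D" "(h \<in> F) \<noteq> (z \<in> F)"
        by (auto simp: \<sigma>_def inside_view_eq_iff split: if_splits)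
      have "\<sigma> F (f, h) (f', h') \<le> 1" using True by (auto simp: \<sigma>_def inside_view_eq_iff)
      also have "(1::real) \<le> (\<Sum>z\<in>?D. of_bool ((h \<in> F) \<noteq> (z \<in> F)))"
        using member_le_sum[of z ?D "\<lambda>z. of_bool ((h \<in> F) \<noteq> (z \<in> F)) :: real"] z \<open>finite Y\<close> by simp
      finally show ?thesis using True by simp
    next
      case False
      have "0 \<le> (\<Sum>z\<in>?D. of_bool ((h \<in> F) \<noteq> (z \<in> F)) :: real)" by (intro sum_nonneg) simp
      moreover have "\<sigma> F (f, h) (f', h') \<le> 2" by (simp add: \<sigma>_def)
      ultimately show ?thesis using False by auto
    qed
    have "\<kappa> (f, h) (f', h') \<le> (\<Sum>j\<in>J. w j * (2 * of_bool ((h \<in> E j) \<noteq> (h' \<in> E j)) + (\<Sum>z\<in>?D. of_bool ((h \<in> E j) \<noteq> (z \<in> E j)))))"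
      unfolding \<kappa>_def by (intro sum_mono mult_left_mono pointwise w)
    also have "\<dots> = 2 * \<omega> h h' + (\<Sum>j\<in>J. \<Sum>z\<in>?D. w j * of_bool ((h \<in> E j) \<noteq> (z \<in> E j)))"
      unfolding \<omega>[OF h] distrib_left sum.distrib
      by (simp only: sum_distrib_left mult.left_commute[of _ 2])
    also have "(\<Sum>j\<in>J. \<Sum>z\<in>?D. w j * of_bool ((h \<in> E j) \<noteq> (z \<in> E j))) = (\<Sum>z\<in>?D. \<omega> h z)"
      unfolding sum.swap[of _ _ J] by (intro sum.cong refl) (simp add: \<omega> h)
    finally show "\<kappa> (f, h) (f', h') \<le> 2 * \<omega> h h' + (\<Sum>z\<in>?D. \<omega> h z)" .
  qed
  ultimately show ?thesis by blast
qed

section \<open>Controlled kernels on the quotients of the wreath product\<close>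

context wreath_quotient
begin

lemma coset_of_member:
  assumes "C \<in> carrier (H Mod M)" "z \<in> C"
  shows "C = M #>\<^bsub>H\<^esub> z"
proof -
  obtain c where "c \<in> carrier H" "C = M #>\<^bsub>H\<^esub> c" using assms(1) by (auto simp: carrier_FactGroup)
  then show ?thesis using H.repr_independence[OF _ _ normal_imp_subgroup[OF normal_M]] assms(2) by metis
qed

lemma coset_closed: "z \<in> carrier H \<Longrightarrow> M #>\<^bsub>H\<^esub> z \<in> carrier (H Mod M)"
  by (auto simp: carrier_FactGroup)

lemma mult_W:
  "(f, h) \<otimes>\<^bsub>W\<^esub> (f', h') = (\<lambda>C\<in>carrier (H Mod M). f C \<otimes>\<^bsub>G Mod N\<^esub> f' (inv\<^bsub>H Mod M\<^esub> h \<otimes>\<^bsub>H Mod M\<^esub> C), h \<otimes>\<^bsub>H Mod M\<^esub> h')"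
  by (rule wreath_simps(2)[OF group_G_quotient])

lemma coset_one: "N #>\<^bsub>G\<^esub> \<one>\<^bsub>G\<^esub> = \<one>\<^bsub>G Mod N\<^esub>"
  using G.coset_mult_one[OF subgroup.subset[OF normal_imp_subgroup[OF normal_N]]] by simp

end

locale wreath_quotients =
  G: comm_group G + H: group H
  for G :: "('a, 'm) monoid_scheme" and H :: "('b, 'n) monoid_scheme" +
  fixes N :: "nat \<Rightarrow> 'a set" and M :: "nat \<Rightarrow> 'b set"
  assumes N_index: "\<And>i. finite_index_normal (N i) G" and M_index: "\<And>i. finite_index_normal (M i) H"
begin

lemma wreath_quotient: "wreath_quotient G H (N i) (M i)"
  by unfold_locales (rule N_index M_index)+

abbreviation "A i \<equiv> G Mod N i"
abbreviation "B i \<equiv> H Mod M i"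
abbreviation "W i \<equiv> A i \<wr> B i"
abbreviation "proj i \<equiv> wreath_quotient.proj G H (N i) (M i)"

text \<open>For the upper bound, right multiplication by \<open>w = (g, k)\<close> only changes the lamps over the set \<open>T\<close> of
  translated cosets that meet the support \<open>Z\<close> of \<open>g\<close>; the new factor at such a lamp is the product of
  \<open>g\<close> over a subset of \<open>Z\<close>, and there are finitely many of these, independently of \<open>i\<close>.

  For the lower bound, both \<open>h'\<close> and the lamps that differ are translates of \<open>h\<close> by elements of a finite
  \<open>F\<omega> \<subseteq> H\<close>, and the lamps change by elements of a finite \<open>F\<alpha> \<subseteq> G\<close>.  Placing these changes at chosen
  representatives in \<open>F\<omega>\<close> lifts the difference to an element of the finite set \<open>F\<close> of lamp
  configurations supported in \<open>F\<omega>\<close>.\<close>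

lemma wreath_controlled_kernels:
  assumes \<alpha>_euclid: "\<And>i. euclidean_kernel (carrier (A i)) (\<alpha> i)"
    and \<alpha>: "controlled_kernels G A (\<lambda>i g. N i #>\<^bsub>G\<^esub> g) \<alpha>"
    and \<omega>_cut: "\<And>i. cut_kernel (carrier (B i)) (\<omega> i)"
    and \<omega>: "controlled_kernels H B (\<lambda>i h. M i #>\<^bsub>H\<^esub> h) \<omega>"
  shows "\<exists>\<kappa>. (\<forall>i. euclidean_kernel (carrier (W i)) (\<kappa> i)) \<and> controlled_kernels (G \<wr> H) W proj \<kappa>"
proof -
  note finB = wreath_quotient.finite_H_quotient[OF wreath_quotient]
  note carrier_W = wreath_quotient.carrier_W[OF wreath_quotient]
  note finite_W = wreath_quotient.finite_W[OF wreath_quotient]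
  have grA: "group (A i)" and grB: "group (B i)" for i
    using wreath_quotient.group_G_quotient[OF wreath_quotient] wreath_quotient.group_H_quotient[OF wreath_quotient] by auto
  define dominates where "dominates i \<kappa> f h f' h' \<longleftrightarrow>
      \<omega> i h h' \<le> \<kappa> (f, h) (f', h') \<and>
      (\<forall>z\<in>carrier (B i). f z \<noteq> f' z \<longrightarrow> \<omega> i h z \<le> \<kappa> (f, h) (f', h')) \<and>
      \<kappa> (f, h) (f', h') \<le> 2 * \<omega> i h h' + (\<Sum>z\<in>{z\<in>carrier (B i). f z \<noteq> f' z}. \<omega> i h z)"
    for i and \<kappa> :: "('b set \<Rightarrow> 'a set) \<times> 'b set \<Rightarrow> ('b set \<Rightarrow> 'a set) \<times> 'b set \<Rightarrow> real" and f h f' h'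
  have "\<forall>i. \<exists>\<kappa>. euclidean_kernel (carrier (W i)) \<kappa> \<and>
      (\<forall>f h f' h'. (f, h) \<in> carrier (W i) \<longrightarrow> (f', h') \<in> carrier (W i) \<longrightarrow> dominates i \<kappa> f h f' h')"
    unfolding dominates_def
    by (rule allI, rule wreath_kernel_of_cuts[OF \<omega>_cut finite_W finB]) (auto simp: carrier_W)
  from choice[OF this] obtain \<mu> where \<mu>': "\<forall>i. euclidean_kernel (carrier (W i)) (\<mu> i) \<and>
      (\<forall>f h f' h'. (f, h) \<in> carrier (W i) \<longrightarrow> (f', h') \<in> carrier (W i) \<longrightarrow> dominates i (\<mu> i) f h f' h')" ..
  have \<mu>_euclid: "euclidean_kernel (carrier (W i)) (\<mu> i)" for i using \<mu>' by simp
  have \<mu>: "\<omega> i h h' \<le> \<mu> i (f, h) (f', h')"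
    "\<And>z. z \<in> carrier (B i) \<Longrightarrow> f z \<noteq> f' z \<Longrightarrow> \<omega> i h z \<le> \<mu> i (f, h) (f', h')"
    "\<mu> i (f, h) (f', h') \<le> 2 * \<omega> i h h' + (\<Sum>z\<in>{z\<in>carrier (B i). f z \<noteq> f' z}. \<omega> i h z)"
    if "(f, h) \<in> carrier (W i)" "(f', h') \<in> carrier (W i)" for i f h f' h'
  proof -
    have "dominates i (\<mu> i) f h f' h'" using \<mu>' that by simp
    then show "\<omega> i h h' \<le> \<mu> i (f, h) (f', h')"
      "\<And>z. z \<in> carrier (B i) \<Longrightarrow> f z \<noteq> f' z \<Longrightarrow> \<omega> i h z \<le> \<mu> i (f, h) (f', h')"
      "\<mu> i (f, h) (f', h') \<le> 2 * \<omega> i h h' + (\<Sum>z\<in>{z\<in>carrier (B i). f z \<noteq> f' z}. \<omega> i h z)"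
      unfolding dominates_def by simp_all
  qed
  define \<kappa> where "\<kappa> i x y = (\<Sum>C\<in>carrier (B i). \<alpha> i (fst x C) (fst y C)) + \<mu> i x y" for i x y
  have lamp_closed: "f C \<in> carrier (A i)" if "(f, h) \<in> carrier (W i)" "C \<in> carrier (B i)" for i f h C
    using that by (auto simp: carrier_W)
  have "euclidean_kernel (carrier (W i)) (\<kappa> i)" for i
    unfolding \<kappa>_def
  proof (intro euclidean_kernel_add euclidean_kernel_sum finB \<mu>_euclid)
    fix C assume "C \<in> carrier (B i)"
    then show "euclidean_kernel (carrier (W i)) (\<lambda>x y. \<alpha> i (fst x C) (fst y C))"
      by (intro euclidean_kernel_pullback[OF \<alpha>_euclid]) (auto simp: carrier_W)
  qed
  moreover have "controlled_kernels (G \<wr> H) W proj \<kappa>"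
    unfolding controlled_kernels_def
  proof (intro conjI ballI allI)
    fix w assume w: "w \<in> carrier (G \<wr> H)"
    obtain g k where gk: "w = (g, k)" by fastforce
    define Z where "Z = {z \<in> carrier H. g z \<noteq> \<one>\<^bsub>G\<^esub>}"
    have g: "g \<in> carrier H \<rightarrow> carrier G" and Z: "finite Z" and k: "k \<in> carrier H"
      using w by (auto simp: gk Z_def wreath_simps[OF G.is_group])
    obtain C\<alpha> where C\<alpha>: "\<And>u i q. u \<in> carrier G \<Longrightarrow> q \<in> carrier (A i) \<Longrightarrow> \<alpha> i q (q \<otimes>\<^bsub>A i\<^esub> (N i #>\<^bsub>G\<^esub> u)) \<le> C\<alpha> u"
      using \<alpha> unfolding controlled_kernels_def by metis
    obtain C\<omega> where C\<omega>: "\<And>u i q. u \<in> carrier H \<Longrightarrow> q \<in> carrier (B i) \<Longrightarrow> \<omega> i q (q \<otimes>\<^bsub>B i\<^esub> (M i #>\<^bsub>H\<^esub> u)) \<le> C\<omega> u"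
      using \<omega> unfolding controlled_kernels_def by metis
    define a where "a = (\<Sum>Y\<in>Pow Z. \<bar>C\<alpha> (finprod G g Y)\<bar>)"
    define b where "b = (\<Sum>z\<in>Z. \<bar>C\<omega> z\<bar>)"
    have ab: "a \<ge> 0" "b \<ge> 0" by (auto simp: a_def b_def sum_nonneg)
    have "\<kappa> i x (x \<otimes>\<^bsub>W i\<^esub> proj i w) \<le> real (card Z) * a + (2 * C\<omega> k + real (card Z) * b)"
      if x: "x \<in> carrier (W i)" for i x
    proof -
      interpret wq: wreath_quotient G H "N i" "M i" by (rule wreath_quotient)
      interpret A: group "A i" by (rule grA)
      interpret B: group "B i" by (rule grB)
      obtain f h where xfh: "x = (f, h)" by fastforce
      have h: "h \<in> carrier (B i)" using x by (simp add: xfh carrier_W)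
      define f' where "f' = (\<lambda>C\<in>carrier (B i). f C \<otimes>\<^bsub>A i\<^esub> (N i #>\<^bsub>G\<^esub> gfinprod G g (inv\<^bsub>B i\<^esub> h \<otimes>\<^bsub>B i\<^esub> C)))"
      define h' where "h' = h \<otimes>\<^bsub>B i\<^esub> (M i #>\<^bsub>H\<^esub> k)"
      have y: "x \<otimes>\<^bsub>W i\<^esub> proj i w = (f', h')"
        unfolding xfh wq.proj_def gk wq.mult_W fst_conv snd_conv f'_def h'_def
      proof (intro arg_cong2[of _ _ _ _ Pair] restrict_ext refl)
        fix C assume C: "C \<in> carrier (B i)"
        have D: "inv\<^bsub>B i\<^esub> h \<otimes>\<^bsub>B i\<^esub> C \<in> carrier (B i)" by (intro B.m_closed B.inv_closed h C)
        show "f C \<otimes>\<^bsub>A i\<^esub> (\<lambda>C\<in>carrier (B i). N i #>\<^bsub>G\<^esub> gfinprod G g C) (inv\<^bsub>B i\<^esub> h \<otimes>\<^bsub>B i\<^esub> C) =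
          f C \<otimes>\<^bsub>A i\<^esub> (N i #>\<^bsub>G\<^esub> gfinprod G g (inv\<^bsub>B i\<^esub> h \<otimes>\<^bsub>B i\<^esub> C))"
          unfolding restrict_apply'[OF D] ..
      qed
      have yc: "(f', h') \<in> carrier (W i)"
        unfolding y[symmetric] by (rule monoid.m_closed[OF group.is_monoid[OF wq.group_W] x wq.proj_closed[OF w]])
      have xc: "(f, h) \<in> carrier (W i)" using x by (simp add: xfh)
      define T where "T = (\<lambda>z. h \<otimes>\<^bsub>B i\<^esub> (M i #>\<^bsub>H\<^esub> z)) ` Z"
      have T: "finite T" "card T \<le> card Z" unfolding T_def using Z by (auto intro: card_image_le)
      have TB: "T \<subseteq> carrier (B i)"       proof
        fix C assume "C \<in> T"
        then obtain z where z: "z \<in> Z" "C = h \<otimes>\<^bsub>B i\<^esub> (M i #>\<^bsub>H\<^esub> z)" unfolding T_def by blast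
        then have "M i #>\<^bsub>H\<^esub> z \<in> carrier (B i)" by (intro wq.coset_closed) (simp add: Z_def)
        then show "C \<in> carrier (B i)" unfolding z(2) by (rule B.m_closed[OF h])
      qed
      have same: "f' C = f C" if C: "C \<in> carrier (B i)" "C \<notin> T" for C
      proof -
        let ?D = "inv\<^bsub>B i\<^esub> h \<otimes>\<^bsub>B i\<^esub> C"
        have D: "?D \<in> carrier (B i)" by (intro B.m_closed B.inv_closed h C)
        have "{z \<in> ?D. g z \<noteq> \<one>\<^bsub>G\<^esub>} = {}"
        proof (rule ccontr)
          assume "{z \<in> ?D. g z \<noteq> \<one>\<^bsub>G\<^esub>} \<noteq> {}"
          then obtain z where z: "z \<in> ?D" "g z \<noteq> \<one>\<^bsub>G\<^esub>" by blast
          then have "z \<in> Z" using wq.coset_subset[OF D] by (auto simp: Z_def)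
          moreover have "C = h \<otimes>\<^bsub>B i\<^esub> ?D"
            using B.m_assoc[OF h B.inv_closed[OF h] C(1)] B.r_inv[OF h] B.l_one[OF C(1)] by argo
          ultimately have "C \<in> T" unfolding T_def using wq.coset_of_member[OF D z(1)] by (metis imageI)
          then show False using C by simp
        qed
        then have "gfinprod G g ?D = \<one>\<^bsub>G\<^esub>" by (simp only: gfinprod_def G.finprod_empty if_cancel finite.emptyI if_True)
        then show ?thesis
          using C A.r_one[OF lamp_closed[OF xc C(1)]] by (simp only: f'_def restrict_apply'[OF C(1)] wq.coset_one)
      qed
      have lamp: "\<alpha> i (f C) (f' C) \<le> a" if C: "C \<in> carrier (B i)" for C
      proof -
        let ?D = "inv\<^bsub>B i\<^esub> h \<otimes>\<^bsub>B i\<^esub> C"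
        have D: "?D \<in> carrier (B i)" by (intro B.m_closed B.inv_closed h C)
        let ?Y = "{z \<in> ?D. g z \<noteq> \<one>\<^bsub>G\<^esub>}"
        have Y: "?Y \<in> Pow Z" using wq.coset_subset[OF D] by (auto simp: Z_def)
        then have "finite ?Y" using Z by (auto intro: finite_subset)
        then have e: "gfinprod G g ?D = finprod G g ?Y" by (simp only: gfinprod_def if_True)
        have c: "finprod G g ?Y \<in> carrier G" using wq.coset_product_closed[OF g D] by (simp only: e)
        have "\<alpha> i (f C) (f' C) \<le> C\<alpha> (finprod G g ?Y)"
          using C\<alpha>[OF c lamp_closed[OF xc C]] by (simp only: f'_def restrict_apply'[OF C] e)
        also have "\<dots> \<le> a" unfolding a_def
          using member_le_sum[OF Y, of "\<lambda>Y. \<bar>C\<alpha> (finprod G g Y)\<bar>"] Z by simp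
        finally show ?thesis .
      qed
      have "(\<Sum>C\<in>carrier (B i). \<alpha> i (f C) (f' C)) = (\<Sum>C\<in>T. \<alpha> i (f C) (f' C))"
        by (rule sum.mono_neutral_right[OF finB TB])
           (use same euclidean_kernel_refl[OF \<alpha>_euclid lamp_closed[OF xc]] in auto)
      also have "\<dots> \<le> real (card T) * a" by (rule sum_bounded_above) (use lamp TB in auto)
      also have "\<dots> \<le> real (card Z) * a" using T ab by (intro mult_right_mono) auto
      finally have 1: "(\<Sum>C\<in>carrier (B i). \<alpha> i (f C) (f' C)) \<le> real (card Z) * a" .
      have 2: "\<omega> i h h' \<le> C\<omega> k" unfolding h'_def by (rule C\<omega>[OF k h])
      let ?\<Delta> = "{C \<in> carrier (B i). f C \<noteq> f' C}"
      have \<Delta>T: "?\<Delta> \<subseteq> T" using same by fastforce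
      have "\<omega> i h D \<le> b" if D: "D \<in> ?\<Delta>" for D
      proof -
        obtain z where z: "z \<in> Z" "D = h \<otimes>\<^bsub>B i\<^esub> (M i #>\<^bsub>H\<^esub> z)" using D \<Delta>T unfolding T_def by blast
        have zc: "z \<in> carrier H" using z by (simp add: Z_def)
        have "\<omega> i h D \<le> C\<omega> z" unfolding z(2) by (rule C\<omega>[OF zc h])
        also have "\<dots> \<le> b" unfolding b_def using member_le_sum[OF z(1), of "\<lambda>z. \<bar>C\<omega> z\<bar>"] Z by simp
        finally show ?thesis .
      qed
      then have "(\<Sum>D\<in>?\<Delta>. \<omega> i h D) \<le> real (card ?\<Delta>) * b" by (rule sum_bounded_above)
      also have "\<dots> \<le> real (card Z) * b"
        using card_mono[OF T(1) \<Delta>T] T(2) ab by (intro mult_right_mono) auto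
      finally have 3: "(\<Sum>D\<in>?\<Delta>. \<omega> i h D) \<le> real (card Z) * b" .
      show ?thesis
        using 1 2 3 \<mu>(3)[OF xc yc] unfolding y \<kappa>_def by (simp add: xfh)
    qed
    then show "\<exists>C. \<forall>i. \<forall>q\<in>carrier (W i). \<kappa> i q (q \<otimes>\<^bsub>W i\<^esub> proj i w) \<le> C" by blast
  next
    fix R :: real
    obtain F\<alpha> where F\<alpha>: "F\<alpha> \<subseteq> carrier G" "finite F\<alpha>"
      "\<And>i q r. q \<in> carrier (A i) \<Longrightarrow> r \<in> carrier (A i) \<Longrightarrow> \<alpha> i q r \<le> R \<Longrightarrow> \<exists>u\<in>F\<alpha>. r = q \<otimes>\<^bsub>A i\<^esub> (N i #>\<^bsub>G\<^esub> u)"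
      using \<alpha> unfolding controlled_kernels_def by metis
    obtain F\<omega> where F\<omega>: "F\<omega> \<subseteq> carrier H" "finite F\<omega>"
      "\<And>i q r. q \<in> carrier (B i) \<Longrightarrow> r \<in> carrier (B i) \<Longrightarrow> \<omega> i q r \<le> R \<Longrightarrow> \<exists>u\<in>F\<omega>. r = q \<otimes>\<^bsub>B i\<^esub> (M i #>\<^bsub>H\<^esub> u)"
      using \<omega> unfolding controlled_kernels_def by metis
    define extend where "extend p = (\<lambda>z\<in>carrier H. if z \<in> F\<omega> then p z else \<one>\<^bsub>G\<^esub>)" for p
    define F where "F = (\<lambda>(p, k). (extend p, k)) ` ((F\<omega> \<rightarrow>\<^sub>E insert \<one>\<^bsub>G\<^esub> F\<alpha>) \<times> F\<omega>)"
    have "finite F" unfolding F_def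
      by (intro finite_imageI finite_cartesian_product finite_PiE) (use F\<alpha> F\<omega> in auto)
    have "F \<subseteq> carrier (G \<wr> H)"
    proof
      fix x assume "x \<in> F"
      then obtain p k where pk: "x = (extend p, k)" "p \<in> F\<omega> \<rightarrow>\<^sub>E insert \<one>\<^bsub>G\<^esub> F\<alpha>" "k \<in> F\<omega>" unfolding F_def by auto
      have "p z \<in> carrier G" if "z \<in> F\<omega>" for z using PiE_mem[OF pk(2) that] F\<alpha>(1) by auto
      then have "extend p \<in> carrier H \<rightarrow>\<^sub>E carrier G" by (auto simp: extend_def)
      moreover have "{z \<in> carrier H. extend p z \<noteq> \<one>\<^bsub>G\<^esub>} \<subseteq> F\<omega>" by (auto simp: extend_def)
      then have "finite {z \<in> carrier H. extend p z \<noteq> \<one>\<^bsub>G\<^esub>}" using F\<omega>(2) by (rule finite_subset)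
      ultimately show "x \<in> carrier (G \<wr> H)"
        using pk F\<omega>(1) by (auto simp: wreath_simps(1)[OF G.is_group])
    qed
    have "\<exists>w\<in>F. y = x \<otimes>\<^bsub>W i\<^esub> proj i w"
      if x: "x \<in> carrier (W i)" and y: "y \<in> carrier (W i)" and le: "\<kappa> i x y \<le> R" for i x y
    proof -
      interpret wq: wreath_quotient G H "N i" "M i" by (rule wreath_quotient)
      interpret A: group "A i" by (rule grA)
      interpret B: group "B i" by (rule grB)
      obtain f h f' h' where xy: "x = (f, h)" "y = (f', h')" by fastforce
      have xc: "(f, h) \<in> carrier (W i)" and yc: "(f', h') \<in> carrier (W i)" using x y by (simp_all add: xy)
      have h: "h \<in> carrier (B i)" and h': "h' \<in> carrier (B i)" using xc yc by (simp_all add: carrier_W)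
      have \<alpha>nn: "0 \<le> \<alpha> i (f C) (f' C)" if "C \<in> carrier (B i)" for C
        by (rule euclidean_kernel_nonneg[OF \<alpha>_euclid lamp_closed[OF xc that] lamp_closed[OF yc that]])
      have \<mu>R: "\<mu> i (f, h) (f', h') \<le> R"
      proof -
        have "0 \<le> (\<Sum>C\<in>carrier (B i). \<alpha> i (f C) (f' C))" by (rule sum_nonneg) (rule \<alpha>nn)
        then show ?thesis using le by (simp add: \<kappa>_def xy)
      qed
      have \<alpha>R: "\<alpha> i (f C) (f' C) \<le> R" if C: "C \<in> carrier (B i)" for C
      proof -
        have "\<alpha> i (f C) (f' C) \<le> (\<Sum>C\<in>carrier (B i). \<alpha> i (f C) (f' C))"
          by (rule member_le_sum[OF C]) (use \<alpha>nn finB in auto)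
        moreover have "0 \<le> \<mu> i (f, h) (f', h')" by (rule euclidean_kernel_nonneg[OF \<mu>_euclid xc yc])
        ultimately show ?thesis using le by (simp add: \<kappa>_def xy)
      qed
      obtain k where k: "k \<in> F\<omega>" "h' = h \<otimes>\<^bsub>B i\<^esub> (M i #>\<^bsub>H\<^esub> k)"
        using F\<omega>(3)[OF h h'] \<mu>(1)[OF xc yc] \<mu>R by (meson order_trans)
      have "\<forall>C\<in>carrier (B i). \<exists>u\<in>F\<alpha>. f' C = f C \<otimes>\<^bsub>A i\<^esub> (N i #>\<^bsub>G\<^esub> u)"
        using F\<alpha>(3)[OF lamp_closed[OF xc] lamp_closed[OF yc] \<alpha>R] by blast
      then obtain u where u: "\<And>C. C \<in> carrier (B i) \<Longrightarrow> u C \<in> F\<alpha>"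
        "\<And>C. C \<in> carrier (B i) \<Longrightarrow> f' C = f C \<otimes>\<^bsub>A i\<^esub> (N i #>\<^bsub>G\<^esub> u C)" by metis
      let ?\<Delta> = "{C \<in> carrier (B i). f C \<noteq> f' C}"
      have "\<forall>C\<in>?\<Delta>. \<exists>z. z \<in> F\<omega> \<and> C = h \<otimes>\<^bsub>B i\<^esub> (M i #>\<^bsub>H\<^esub> z)"
      proof
        fix C assume C: "C \<in> ?\<Delta>"
        then have "\<omega> i h C \<le> R" using \<mu>(2)[OF xc yc, of C] \<mu>R by simp
        moreover have "C \<in> carrier (B i)" using C by simp
        ultimately show "\<exists>z. z \<in> F\<omega> \<and> C = h \<otimes>\<^bsub>B i\<^esub> (M i #>\<^bsub>H\<^esub> z)"
          using F\<omega>(3)[OF h, of C] by (simp only: Bex_def)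
      qed
      from bchoice[OF this] obtain \<zeta> where \<zeta>':
        "\<forall>C\<in>?\<Delta>. \<zeta> C \<in> F\<omega> \<and> C = h \<otimes>\<^bsub>B i\<^esub> (M i #>\<^bsub>H\<^esub> \<zeta> C)" ..
      have \<zeta>: "\<zeta> C \<in> F\<omega>" "C = h \<otimes>\<^bsub>B i\<^esub> (M i #>\<^bsub>H\<^esub> \<zeta> C)" if "C \<in> ?\<Delta>" for C
        using bspec[OF \<zeta>' that] by (rule conjunct1, rule conjunct2)
      \<comment> \<open>At most one representative per coset carries the change u C of its lamp: the chosen one.\<close>
      define p where "p = (\<lambda>z\<in>F\<omega>. let C = h \<otimes>\<^bsub>B i\<^esub> (M i #>\<^bsub>H\<^esub> z) in if C \<in> ?\<Delta> \<and> \<zeta> C = z then u C else \<one>\<^bsub>G\<^esub>)"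
      have p: "p \<in> F\<omega> \<rightarrow>\<^sub>E insert \<one>\<^bsub>G\<^esub> F\<alpha>" unfolding p_def by (auto simp: Let_def u(1))
      define g where "g = extend p"
      have gF: "(g, k) \<in> F" unfolding F_def g_def using p k(1) by (intro image_eqI[of _ _ "(p, k)"]) auto
      have g_val: "g z = (if z \<in> F\<omega> \<and> h \<otimes>\<^bsub>B i\<^esub> D \<in> ?\<Delta> \<and> \<zeta> (h \<otimes>\<^bsub>B i\<^esub> D) = z then u (h \<otimes>\<^bsub>B i\<^esub> D) else \<one>\<^bsub>G\<^esub>)"
        if D: "D \<in> carrier (B i)" "z \<in> D" for D z
      proof -
        have zc: "z \<in> carrier H" using wq.coset_subset[OF D(1)] D(2) by blast
        show ?thesis
          unfolding g_def extend_def restrict_apply'[OF zc] wq.coset_of_member[OF D] p_def Let_def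
          by simp
      qed
      have lamps: "f' C = f C \<otimes>\<^bsub>A i\<^esub> (N i #>\<^bsub>G\<^esub> gfinprod G g (inv\<^bsub>B i\<^esub> h \<otimes>\<^bsub>B i\<^esub> C))" if C: "C \<in> carrier (B i)" for C
      proof -
        let ?D = "inv\<^bsub>B i\<^esub> h \<otimes>\<^bsub>B i\<^esub> C"
        have D: "?D \<in> carrier (B i)" by (intro B.m_closed B.inv_closed h C)
        have hD: "h \<otimes>\<^bsub>B i\<^esub> ?D = C"
          using B.m_assoc[OF h B.inv_closed[OF h] C] B.r_inv[OF h] B.l_one[OF C] by argo
        show ?thesis
        proof (cases "C \<in> ?\<Delta>")
          case False
          then have "{z \<in> ?D. g z \<noteq> \<one>\<^bsub>G\<^esub>} = {}" using g_val[OF D] unfolding hD by auto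
          then have "gfinprod G g ?D = \<one>\<^bsub>G\<^esub>" by (simp only: gfinprod_def G.finprod_empty if_cancel finite.emptyI if_True)
          then show ?thesis
            using C False A.r_one[OF lamp_closed[OF xc C]] wq.coset_one by simp
        next
          case True
          have uc: "u C \<in> carrier G" using u(1)[OF C] F\<alpha>(1) by blast
          have zD: "\<zeta> C \<in> ?D"
          proof -
            have zc: "\<zeta> C \<in> carrier H" using \<zeta>(1)[OF True] F\<omega>(1) by blast
            have "inv\<^bsub>B i\<^esub> h \<otimes>\<^bsub>B i\<^esub> (h \<otimes>\<^bsub>B i\<^esub> (M i #>\<^bsub>H\<^esub> \<zeta> C)) = M i #>\<^bsub>H\<^esub> \<zeta> C"
              using B.m_assoc[OF B.inv_closed[OF h] h wq.coset_closed[OF zc]] B.l_inv[OF h]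
                B.l_one[OF wq.coset_closed[OF zc]] by argo
            then have "M i #>\<^bsub>H\<^esub> \<zeta> C = ?D" unfolding \<zeta>(2)[OF True, symmetric] by (rule sym)
            then show ?thesis using H.rcos_self[OF zc normal_imp_subgroup[OF wq.normal_M]] by simp
          qed
          have val: "g z = (if z = \<zeta> C then u C else \<one>\<^bsub>G\<^esub>)" if z: "z \<in> ?D" for z
            using g_val[OF D z] True \<zeta>(1)[OF True] unfolding hD by auto
          have "gfinprod G g ?D = u C"
          proof (cases "u C = \<one>\<^bsub>G\<^esub>")
            case True
            then have "{z \<in> ?D. g z \<noteq> \<one>\<^bsub>G\<^esub>} = {}" using val by auto
            then show ?thesis using True by (simp only: gfinprod_def G.finprod_empty if_cancel finite.emptyI if_True)
          next
            case False
            then have "{z \<in> ?D. g z \<noteq> \<one>\<^bsub>G\<^esub>} = {\<zeta> C}" using val zD by (auto split: if_splits)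
            moreover have "finprod G g {\<zeta> C} = u C"
              using G.finprod_insert[of "{}" "\<zeta> C" g] val[OF zD] uc by simp
            ultimately show ?thesis by (simp add: gfinprod_def)
          qed
          then show ?thesis using u(2)[OF C] by (simp only:)
        qed
      qed
      have "y = x \<otimes>\<^bsub>W i\<^esub> proj i (g, k)"
        unfolding xy wq.proj_def wq.mult_W fst_conv snd_conv k(2)
      proof (rule arg_cong2[of _ _ _ _ Pair])
        show "f' = (\<lambda>C\<in>carrier (B i). f C \<otimes>\<^bsub>A i\<^esub> (\<lambda>C\<in>carrier (B i). N i #>\<^bsub>G\<^esub> gfinprod G g C) (inv\<^bsub>B i\<^esub> h \<otimes>\<^bsub>B i\<^esub> C))"
        proof
          fix C
          show "f' C = (\<lambda>C\<in>carrier (B i). f C \<otimes>\<^bsub>A i\<^esub> (\<lambda>C\<in>carrier (B i). N i #>\<^bsub>G\<^esub> gfinprod G g C) (inv\<^bsub>B i\<^esub> h \<otimes>\<^bsub>B i\<^esub> C)) C"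
          proof (cases "C \<in> carrier (B i)")
            case True
            have D: "inv\<^bsub>B i\<^esub> h \<otimes>\<^bsub>B i\<^esub> C \<in> carrier (B i)" by (intro B.m_closed B.inv_closed h True)
            show ?thesis unfolding restrict_apply'[OF True] restrict_apply'[OF D] by (rule lamps[OF True])
          next
            case False
            then show ?thesis using yc by (auto simp: carrier_W PiE_iff extensional_def)
          qed
        qed
      qed simp
      then show ?thesis using gF by (rule rev_bexI[rotated])
    qed
    then show "\<exists>F\<subseteq>carrier (G \<wr> H). finite F \<and> (\<forall>i. \<forall>q\<in>carrier (W i). \<forall>r\<in>carrier (W i).
        \<kappa> i q r \<le> R \<longrightarrow> (\<exists>w\<in>F. r = q \<otimes>\<^bsub>W i\<^esub> proj i w))"
      using \<open>finite F\<close> \<open>F \<subseteq> carrier (G \<wr> H)\<close> by blast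
  qed
  ultimately show ?thesis by blast
qed

end

section \<open>The kernels of the wreath quotients\<close>

lemma (in comm_group) finprod_in_subgroup:
  assumes K: "subgroup K G" and "finite L" "\<And>l. l \<in> L \<Longrightarrow> g l \<in> K"
  shows "finprod G g L \<in> K"
  using assms(2,3)
proof (induction L rule: finite_induct)
  case empty then show ?case using subgroup.one_closed[OF K] by simp
next
  case (insert l L)
  have "g \<in> insert l L \<rightarrow> carrier G" using insert.prems subgroup.mem_carrier[OF K] by auto
  then have "finprod G g (insert l L) = g l \<otimes> finprod G g L"
    using insert.hyps by (intro finprod_insert) auto
  then show ?case using insert subgroup.m_closed[OF K] by simp
qed

lemma (in comm_group) finprod_in_subgroup_if_fibres:
  assumes K: "subgroup K G" and Z: "finite Z" and f: "f \<in> Z \<rightarrow> carrier G"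
    and fibres: "\<And>l. l \<in> c ` Z \<Longrightarrow> finprod G f {z \<in> Z. c z = l} \<in> K"
  shows "finprod G f Z \<in> K"
proof -
  have "finprod G f (\<Union>l\<in>c ` Z. {z \<in> Z. c z = l}) = finprod G (\<lambda>l. finprod G f {z \<in> Z. c z = l}) (c ` Z)"
    by (rule finprod_UN_disjoint) (use Z f in \<open>auto simp: pairwise_def disjnt_def\<close>)
  also have "(\<Union>l\<in>c ` Z. {z \<in> Z. c z = l}) = Z" by auto
  also have "finprod G (\<lambda>l. finprod G f {z \<in> Z. c z = l}) (c ` Z) \<in> K"
    by (rule finprod_in_subgroup[OF K finite_imageI[OF Z] fibres])
  finally show ?thesis .
qed

context wreath_quotients
begin

abbreviation "K i \<equiv> kernel (G \<wr> H) (W i) (proj i)"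

text \<open>A coset of \<open>M\<^sub>i\<close> is a disjoint union of cosets of the smaller group \<open>M\<^sub>i\<^sub>+\<^sub>1\<close>, so its lamp is a product of
  lamps that lie in \<open>N\<^sub>i\<^sub>+\<^sub>1 \<subseteq> N\<^sub>i\<close>.\<close>

lemma kernel_nested:
  assumes N: "N (Suc i) \<subseteq> N i" and M: "M (Suc i) \<subseteq> M i"
  shows "K (Suc i) \<subseteq> K i"
proof
  fix x assume x: "x \<in> K (Suc i)"
  interpret wq: wreath_quotient G H "N i" "M i" by (rule wreath_quotient)
  interpret wq': wreath_quotient G H "N (Suc i)" "M (Suc i)" by (rule wreath_quotient)
  have xc: "x \<in> carrier (G \<wr> H)" and "snd x \<in> M (Suc i)"
    and fibre: "\<And>C. C \<in> carrier (B (Suc i)) \<Longrightarrow> gfinprod G (fst x) C \<in> N (Suc i)"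
    using x unfolding wq'.kernel_proj by auto
  note f = wq.wreath_carrierD[OF xc]
  have "gfinprod G (fst x) C \<in> N i" if C: "C \<in> carrier (B i)" for C
  proof -
    let ?Z = "{z \<in> C. fst x z \<noteq> \<one>\<^bsub>G\<^esub>}"
    have CH: "C \<subseteq> carrier H" by (rule wq.coset_subset[OF C])
    have finZ: "finite ?Z" by (rule finite_subset[OF _ f(2)]) (use CH in auto)
    have "finprod G (fst x) ?Z \<in> N i"
    proof (rule G.finprod_in_subgroup_if_fibres[OF normal_imp_subgroup[OF wq.normal_N] finZ])
      show "fst x \<in> ?Z \<rightarrow> carrier G" using f(1) CH by auto
      fix l assume "l \<in> (\<lambda>z. M (Suc i) #>\<^bsub>H\<^esub> z) ` ?Z"
      then obtain z where z: "z \<in> ?Z" "l = M (Suc i) #>\<^bsub>H\<^esub> z" by blast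
      have zH: "z \<in> carrier H" using z CH by blast
      have l: "l \<in> carrier (B (Suc i))" unfolding z(2) by (rule wq'.coset_closed[OF zH])
      have lC: "l \<subseteq> C"
      proof -
        have "C = M i #>\<^bsub>H\<^esub> z" by (rule wq.coset_of_member[OF C]) (use z in simp)
        then show ?thesis unfolding z(2) r_coset_def using M by blast
      qed
      have "{z' \<in> ?Z. M (Suc i) #>\<^bsub>H\<^esub> z' = l} = {z \<in> l. fst x z \<noteq> \<one>\<^bsub>G\<^esub>}"
      proof (intro equalityI subsetI)
        fix z' assume z': "z' \<in> {z' \<in> ?Z. M (Suc i) #>\<^bsub>H\<^esub> z' = l}"
        then have "z' \<in> carrier H" using CH by blast
        then have "z' \<in> M (Suc i) #>\<^bsub>H\<^esub> z'" by (rule H.rcos_self[OF _ normal_imp_subgroup[OF wq'.normal_M]])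
        then show "z' \<in> {z \<in> l. fst x z \<noteq> \<one>\<^bsub>G\<^esub>}" using z' by simp
      next
        fix z' assume z': "z' \<in> {z \<in> l. fst x z \<noteq> \<one>\<^bsub>G\<^esub>}"
        then have "l = M (Suc i) #>\<^bsub>H\<^esub> z'" by (intro wq'.coset_of_member[OF l]) simp
        then show "z' \<in> {z' \<in> ?Z. M (Suc i) #>\<^bsub>H\<^esub> z' = l}" using z' lC by auto
      qed
      moreover have "finite {z \<in> l. fst x z \<noteq> \<one>\<^bsub>G\<^esub>}" by (rule finite_subset[OF _ finZ]) (use lC in auto)
      ultimately have "finprod G (fst x) {z' \<in> ?Z. M (Suc i) #>\<^bsub>H\<^esub> z' = l} = gfinprod G (fst x) l"
        by (simp add: gfinprod_def)
      then show "finprod G (fst x) {z' \<in> ?Z. M (Suc i) #>\<^bsub>H\<^esub> z' = l} \<in> N i" using fibre[OF l] N by auto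
    qed
    then show ?thesis using finZ by (simp add: gfinprod_def)
  qed
  then show "x \<in> K i"
    unfolding wq.kernel_proj using xc \<open>snd x \<in> M (Suc i)\<close> M by auto
qed

text \<open>For large \<open>j\<close> the coset of \<open>z\<close> contains no other point of the support of \<open>f\<close>, so the lamp over this coset
  is \<open>f z\<close> itself.  Hence \<open>f z\<close> lies in all \<open>N\<^sub>j\<close>.\<close>

lemma kernel_separating:
  assumes N: "\<And>i. N (Suc i) \<subseteq> N i" "(\<Inter>i. N i) = {\<one>\<^bsub>G\<^esub>}"
    and M: "\<And>i. M (Suc i) \<subseteq> M i" "(\<Inter>i. M i) = {\<one>\<^bsub>H\<^esub>}"
  shows "(\<Inter>i. K i) = {\<one>\<^bsub>G \<wr> H\<^esub>}"
proof
  have decN: "N j \<subseteq> N i" and decM: "M j \<subseteq> M i" if "i \<le> j" for i j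
    using lift_Suc_antimono_le[of N, OF N(1) that] lift_Suc_antimono_le[of M, OF M(1) that] by auto
  show "{\<one>\<^bsub>G \<wr> H\<^esub>} \<subseteq> (\<Inter>i. K i)"
  proof -
    have "\<one>\<^bsub>G \<wr> H\<^esub> \<in> K i" for i
    proof -
      interpret wq: wreath_quotient G H "N i" "M i" by (rule wreath_quotient)
      interpret group_hom "G \<wr> H" "W i" "proj i"
        by (rule group_hom.intro[OF wreath_group[OF G.is_group H.is_group] wq.group_W
              group_hom_axioms.intro[OF wq.proj_hom]])
      show ?thesis by (rule subgroup.one_closed[OF subgroup_kernel])
    qed
    then show ?thesis by simp
  qed
  show "(\<Inter>i. K i) \<subseteq> {\<one>\<^bsub>G \<wr> H\<^esub>}"
  proof
    fix x assume "x \<in> (\<Inter>i. K i)"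
    then have xK: "x \<in> K i" for i by simp
    have x: "x \<in> carrier (G \<wr> H)" "snd x \<in> M i"
      "\<And>C. C \<in> carrier (B i) \<Longrightarrow> gfinprod G (fst x) C \<in> N i" for i
      using xK[of i] unfolding wreath_quotient.kernel_proj[OF wreath_quotient] by auto
    note f = wreath_quotient.wreath_carrierD[OF wreath_quotient x(1)]
    have "snd x \<in> (\<Inter>i. M i)" using x(2) by simp
    then have h: "snd x = \<one>\<^bsub>H\<^esub>" using M(2) by simp
    have one: "fst x z = \<one>\<^bsub>G\<^esub>" if z: "z \<in> carrier H" for z
    proof -
      define Z where "Z = {y \<in> carrier H. fst x y \<noteq> \<one>\<^bsub>G\<^esub>} - {z}"
      have "finite Z" using f(2) by (simp add: Z_def)
      have "\<exists>i. y \<notin> M i #>\<^bsub>H\<^esub> z" if y: "y \<in> Z" for y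
      proof (rule ccontr)
        assume "\<not> ?thesis"
        then have "y \<in> M i #>\<^bsub>H\<^esub> z" for i by blast
        then have "\<exists>m. m \<in> M i \<and> y = m \<otimes>\<^bsub>H\<^esub> z" for i unfolding r_coset_def by blast
        moreover have yH: "y \<in> carrier H" using y by (simp add: Z_def)
        have "m = y \<otimes>\<^bsub>H\<^esub> inv\<^bsub>H\<^esub> z" if m: "m \<in> M i" "y = m \<otimes>\<^bsub>H\<^esub> z" for m i
        proof -
          have "m \<in> carrier H"
            using m(1) subgroup.mem_carrier[OF normal_imp_subgroup[OF wreath_quotient.normal_M[OF wreath_quotient]]] by blast
          then show ?thesis using m(2) z by (simp add: H.m_assoc)
        qed
        ultimately have "y \<otimes>\<^bsub>H\<^esub> inv\<^bsub>H\<^esub> z \<in> M i" for i by metis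
        then have "y \<otimes>\<^bsub>H\<^esub> inv\<^bsub>H\<^esub> z \<in> (\<Inter>i. M i)" by simp
        then have "y \<otimes>\<^bsub>H\<^esub> inv\<^bsub>H\<^esub> z = \<one>\<^bsub>H\<^esub>" using M(2) by simp
        then have "y = z" using yH z H.inv_equality[of y "inv\<^bsub>H\<^esub> z"] by simp
        then show False using y by (simp add: Z_def)
      qed
      then obtain I where I: "\<And>y. y \<in> Z \<Longrightarrow> y \<notin> M (I y) #>\<^bsub>H\<^esub> z" by metis
      define n where "n = Max (insert 0 (I ` Z))"
      have "fst x z \<in> N i" for i
      proof -
        define j where "j = max i n"
        interpret wq: wreath_quotient G H "N j" "M j" by (rule wreath_quotient)
        let ?C = "M j #>\<^bsub>H\<^esub> z"
        have C: "?C \<in> carrier (B j)" by (rule wq.coset_closed[OF z])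
        have zC: "z \<in> ?C" by (rule H.rcos_self[OF z normal_imp_subgroup[OF wq.normal_M]])
        have notin: "y \<notin> ?C" if y: "y \<in> Z" for y
        proof -
          have "I y \<le> n" unfolding n_def by (rule Max_ge) (use \<open>finite Z\<close> y in auto)
          then have "M j \<subseteq> M (I y)" by (intro decM) (simp add: j_def)
          then have "?C \<subseteq> M (I y) #>\<^bsub>H\<^esub> z" unfolding r_coset_def by blast
          then show ?thesis using I[OF y] by blast
        qed
        have "gfinprod G (fst x) ?C = fst x z"
        proof (cases "fst x z = \<one>\<^bsub>G\<^esub>")
          case True
          have "{y \<in> ?C. fst x y \<noteq> \<one>\<^bsub>G\<^esub>} = {}" using notin wq.coset_subset[OF C] True by (auto simp: Z_def)
          then show ?thesis using True by (simp only: gfinprod_def G.finprod_empty if_cancel finite.emptyI if_True)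
        next
          case False
          have "{y \<in> ?C. fst x y \<noteq> \<one>\<^bsub>G\<^esub>} = {z}" using notin wq.coset_subset[OF C] False zC by (auto simp: Z_def)
          moreover have "finprod G (fst x) {z} = fst x z"
            using G.finprod_insert[of "{}" z "fst x"] f(1) z by (simp add: Pi_iff)
          ultimately show ?thesis by (simp add: gfinprod_def)
        qed
        then have "fst x z \<in> N j" using x(3)[OF C] by simp
        then show ?thesis using decN[of i j] by (auto simp: j_def)
      qed
      then have "fst x z \<in> (\<Inter>i. N i)" by simp
      then show ?thesis using N(2) by simp
    qed
    have "fst x = (\<lambda>z\<in>carrier H. \<one>\<^bsub>G\<^esub>)"
    proof
      fix z show "fst x z = (\<lambda>z\<in>carrier H. \<one>\<^bsub>G\<^esub>) z"
        using one[of z] x(1) by (cases "z \<in> carrier H") (auto simp: wreath_simps(1)[OF G.is_group] PiE_iff extensional_def)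
    qed
    then show "x \<in> {\<one>\<^bsub>G \<wr> H\<^esub>}" using h by (simp add: wreath_simps(3)[OF G.is_group] prod_eq_iff)
  qed
qed

end

section \<open>The box space of the wreath product\<close>

theorem theorem1p5:
  fixes G :: "('a, 'm) monoid_scheme" and H :: "('b, 'n) monoid_scheme"
    and S :: "'b set" and T :: "(('b \<Rightarrow> 'a) \<times> 'b) set"
  assumes "comm_group G" and "finitely_generated G"
    and "group H" and "residually_finite H"
    and "finite_generating_set H S"
    and "finite_generating_set (G \<wr> H) T"
    and "\<exists>K d. box_space H S K d \<and>
           coarsely_embeds_into_hilbert TYPE('v) (box_points H K) d"
  shows "\<exists>K d. box_space (G \<wr> H) T K d \<and>
           coarsely_embeds_into_hilbert TYPE(nat \<Rightarrow> real) (box_points (G \<wr> H) K) d"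
proof -
  obtain M d where box: "box_space H S M d"
    and emb: "coarsely_embeds_into_hilbert TYPE('v) (box_points H M) d"
    using assms(7) by blast
  have M: "\<And>i. finite_index_normal (M i) H" "\<And>i. M (Suc i) \<subseteq> M i" "(\<Inter>i. M i) = {\<one>\<^bsub>H\<^esub>}"
    using box unfolding box_space_def by auto
  obtain SG where SG: "finite_generating_set G SG" using assms(2) by (auto simp: finitely_generated_def)
  obtain N where N: "\<And>i::nat. finite_index_normal (N i) G" "\<And>i. N (Suc i) \<subseteq> N i" "(\<Inter>i. N i) = {\<one>\<^bsub>G\<^esub>}"
    using comm_group.residual_chain[OF assms(1), of SG] SG unfolding finite_generating_set_def by blast
  interpret G: comm_group G by (rule assms(1))
  interpret H: group H by (rule assms(3))
  interpret wreath_quotients G H N M by unfold_locales (rule N(1) M(1))+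
  have "\<exists>\<alpha>. (\<forall>i. euclidean_kernel (carrier (A i)) (\<alpha> i)) \<and> controlled_kernels G A (\<lambda>i g. N i #>\<^bsub>G\<^esub> g) \<alpha>"
  proof (rule abelian_controlled_kernels[OF assms(1) SG])
    fix i
    interpret wq: wreath_quotient G H "N i" "M i" by (rule wreath_quotient)
    show "group (A i)" by (rule wq.group_G_quotient)
    show "finite (carrier (A i))" by (rule wq.finite_G_quotient)
    show "(\<lambda>g. N i #>\<^bsub>G\<^esub> g) \<in> hom G (A i)" by (rule normal.r_coset_hom_Mod[OF wq.normal_N])
    show "(\<lambda>g. N i #>\<^bsub>G\<^esub> g) ` carrier G = carrier (A i)" by (simp add: carrier_FactGroup)
  qed
  then obtain \<alpha> where \<alpha>: "\<And>i. euclidean_kernel (carrier (A i)) (\<alpha> i)"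
    "controlled_kernels G A (\<lambda>i g. N i #>\<^bsub>G\<^esub> g) \<alpha>" by blast
  obtain \<omega> where \<omega>: "\<And>i. cut_kernel (carrier (B i)) (\<omega> i)"
    "controlled_kernels H B (\<lambda>i h. M i #>\<^bsub>H\<^esub> h) \<omega>"
    using controlled_cut_kernels[OF box emb] by blast
  obtain \<kappa> where \<kappa>: "\<And>i. euclidean_kernel (carrier (W i)) (\<kappa> i)" "controlled_kernels (G \<wr> H) W proj \<kappa>"
    using wreath_controlled_kernels[OF \<alpha> \<omega>] by blast
  interpret wreath_box: box_quotients "G \<wr> H" T W proj
  proof (intro box_quotients.intro box_quotients_axioms.intro)
    show "group (G \<wr> H)" by (rule wreath_group[OF assms(1)[THEN comm_group.axioms(2)] assms(3)])
    show "finite_generating_set (G \<wr> H) T" by fact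
    show "(\<Inter>i. K i) = {\<one>\<^bsub>G \<wr> H\<^esub>}" by (rule kernel_separating[OF N(2,3) M(2,3)])
    fix i
    interpret wq: wreath_quotient G H "N i" "M i" by (rule wreath_quotient)
    show "group (W i)" by (rule wq.group_W)
    show "finite (carrier (W i))" by (rule wq.finite_W)
    show "proj i \<in> hom (G \<wr> H) (W i)" by (rule wq.proj_hom)
    show "K (Suc i) \<subseteq> K i" by (rule kernel_nested[OF N(2) M(2)])
  qed
  show ?thesis
    using wreath_box.box_space_box_dist wreath_box.coarsely_embeds_if_controlled[OF \<kappa>] by blast
qed

end
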